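(* Let $(u_{1,0},\dots,u_{N,0})\in D(A)$. The corresponding solution $(u_1,\dots,u_N)$ of $$\begin{cases}\partial_tu_i(t,x)+\partial_xu_i(t,x)+\alpha_i(t)\chi_i(x)u_i(t,x)=0,& t\ge0,\ x\in[0,L_i],\ 1\le i\le N,\\ u_i(t,0)=\sum_{j=1}^Nm_{ij}u_j(t,L_j),& t\ge0,\ 1\le i\le N,\\ u_i(0,x)=u_{i,0}(x),& x\in[0,L_i],\ 1\le i\le N,\end{cases}$$ is given by $$u_i(t,x)=\begin{cases}u_{i,0}(x-t)\exp\Big(-\int_{[0,t]\cap[t-x+a_i,\,t-x+b_i]}\alpha_i(s)\,ds\Big),&\text{if }0\le t\le x,\\[2mm] u_i(t-x,0)\exp\Big(-\int_{[0,t]\cap[t-x+a_i,\,t-x+b_i]}\alpha_i(s)\,ds\Big),&\text{if }t\ge x,\end{cases}$$ where $u_i(t,0)$ is given for $t\ge0$ by $$u_i(t,0)=\sum_{j=1}^N\ \sum_{\substack{\mathfrak n\in\mathfrak N_j\\ L(\mathfrak n)\le t}}\vartheta^{(i)}_{j,\ \mathfrak n+\lfloor(t-L(\mathfrak n))/L_j\rfloor\mathbf 1_j,\ L_j-\{t-L(\mathfrak n)\}_{L_j},\ t}\;u_{j,0}\big(L_j-\{t-L(\mathfrak n)\}_{L_j}\big)$$ and the coefficients $\vartheta^{(i)}_{j,\mathfrak n,x,t}$ are defined for $i,j\in\{1,\dots,N\}$, $\mathfrak n\in\mathfrak N$, $x\in[0,L_j]$ and $t\in\mathbb R$ by $$\vartheta^{(i)}_{j,\mathfrak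 n,x,t}=\varepsilon_{j,\mathfrak n,x,t}\,\vartheta^{(i)}_{j,\mathfrak n,L_j,t},\qquad \varepsilon_{j,\mathfrak n,x,t}=\exp\Big(-\int_{I_{j,\mathfrak n,x,t}}\alpha_j(s)\,ds\Big),$$ where $I_{j,\mathfrak n,x,t}=[t-L(\mathfrak n)-L_j+\max(x,a_j),\ t-L(\mathfrak n)-L_j+b_j]$, and $$\vartheta^{(i)}_{j,\mathbf 0,L_j,t}=m_{ij},\qquad \vartheta^{(i)}_{j,\mathfrak n,L_j,t}=\sum_{\substack{k=1\\ n_k\ge1}}^Nm_{kj}\,\vartheta^{(i)}_{k,\mathfrak n-\mathbf 1_k,0,t}\quad(\mathfrak n\in\mathfrak N\setminus\{\mathbf 0\}).$$
   Context: Let $N\ge2$, $0\le N_d\le N$, $L_1,\dots,L_N>0$, $M=(m_{ij})$ an arbitrary real $N\times N$ matrix, $p\in[1,+\infty)$. For $1\le i\le N_d$: $[a_i,b_i]\subset[0,L_i]$ with $a_i<b_i$, $\chi_i$ is the characteristic function of $[a_i,b_i]$, and $\alpha_i\in L^\infty(\mathbb R,[0,1])$. Convention for $N_d+1\le i\le N$: $\alpha_i\equiv1$ and $a_i=b_i=L_i$, so $\chi_i=0$ almost everywhere. An interval $[c,d]$ with $c>d$ is empty. $\mathsf X_p=\prod_iL^p(0,L_i)$; $D(A)=\{(u_i)\in\prod_iW^{1,p}(0,L_i): u_i(0)=\sum_jm_{ij}u_j(L_j)\ \forall i\}$, $A(u_1,\dots,u_N)=(-u_1',\dots,-u_N')$,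 which generates a strongly continuous semigroup on $\mathsf X_p$; $B_i\in\mathcal L(\mathsf X_p)$ maps $(u_1,\dots,u_N)$ to the vector with $i$-th entry $-\chi_iu_i$ and zeros elsewhere. The solution with initial condition $z_0\in\mathsf X_p$ is the unique $z=(u_1,\dots,u_N)\in\mathcal C^0([0,\infty),\mathsf X_p)$ with $z(t)=e^{tA}z_0+\int_0^te^{(t-\tau)A}\sum_{i=1}^{N_d}\alpha_i(\tau)B_iz(\tau)\,d\tau$. When $z_0\in D(A)$ one has $z(t)\in D(A)$ for all $t\ge0$, and $u_i(t,\cdot)\in W^{1,p}(0,L_i)$ is identified with its continuous representative on $[0,L_i]$. Notation: $\mathbb N=\{0,1,2,\dots\}$; $\mathfrak N=\mathbb N^N$; $\mathfrak N_j=\{\mathfrak n\in\mathfrak N: n_j=0\}$; $\mathbf 0=(0,\dots,0)$; $\mathbf 1_j$ is the $j$-th canonical unit vector; $L(\mathfrak n)=\sum_{i=1}^Nn_iL_i$; $\{x\}_y=x-\lfloor x/y\rfloor y$ for $x\in\mathbb R$, $y>0$. *)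

theory Defs
  imports "HOL-Analysis.Analysis" "HOL-Library.Function_Algebras" "HOL-Library.Real_Mod"
begin

text \<open>
  Elements of \<open>L\<^sup>p\<close> spaces are represented by Borel functions. Identities between classes are
  therefore stated almost everywhere (relation \<open>Xeq\<close> below), and operators on classes act on
  representatives. A state \<open>u :: state\<close> has components \<open>u i\<close> for \<open>i \<in> {1..N}\<close>; the values of
  \<open>u\<close> at other indices are never used. Addition and subtraction of states are pointwise.
\<close>

type_synonym state = "nat \<Rightarrow> real \<Rightarrow> real"


section \<open>Lebesgue and Sobolev spaces on an interval\<close>

definition seg :: "real \<Rightarrow> real measure" where
  "seg l = restrict_space lborel {0<..<l}"

definition Lp :: "real \<Rightarrow> real \<Rightarrow> (real \<Rightarrow> real) set" where
  "Lp p l = {f \<in> borel_measurable (seg l). integrable (seg l) (\<lambda>x. \<bar>f x\<bar> powr p)}"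

text \<open>The test functions are the \<open>C\<^sup>1\<close> functions with compact support in \<open>]0, l[\<close>.\<close>

definition weak_deriv :: "real \<Rightarrow> (real \<Rightarrow> real) \<Rightarrow> (real \<Rightarrow> real) \<Rightarrow> bool" where
  "weak_deriv l f g \<longleftrightarrow>
    (\<forall>\<phi> \<phi>'. (\<forall>x. (\<phi> has_real_derivative \<phi>' x) (at x)) \<longrightarrow> continuous_on UNIV \<phi>' \<longrightarrow>
       (\<exists>c d. 0 < c \<and> c \<le> d \<and> d < l \<and> (\<forall>x. x \<notin> {c..d} \<longrightarrow> \<phi> x = 0)) \<longrightarrow>
       (\<integral>x. f x * \<phi>' x \<partial>seg l) = - (\<integral>x. g x * \<phi> x \<partial>seg l))"

definition W1p :: "real \<Rightarrow> real \<Rightarrow> (real \<Rightarrow> real) set" where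
  "W1p p l = {f \<in> Lp p l. \<exists>g \<in> Lp p l. weak_deriv l f g}"

definition wderiv :: "real \<Rightarrow> real \<Rightarrow> (real \<Rightarrow> real) \<Rightarrow> real \<Rightarrow> real" where
  "wderiv p l f = (SOME g. g \<in> Lp p l \<and> weak_deriv l f g)"

text \<open>The continuous representative on the closed interval; its values on \<open>[0, l]\<close> are uniquely
  determined whenever one exists, in particular for \<open>f \<in> W1p p l\<close>.\<close>

definition crep :: "real \<Rightarrow> (real \<Rightarrow> real) \<Rightarrow> real \<Rightarrow> real" where
  "crep l f = (SOME g. continuous_on {0..l} g \<and> (AE x in seg l. g x = f x))"


section \<open>The state space and Bochner integrals of functions with values in it\<close>

definition Xp :: "real \<Rightarrow> nat \<Rightarrow> (nat \<Rightarrow> real) \<Rightarrow> state set" where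
  "Xp p N L = {u. \<forall>i\<in>{1..N}. u i \<in> Lp p (L i)}"

definition Xnorm :: "real \<Rightarrow> nat \<Rightarrow> (nat \<Rightarrow> real) \<Rightarrow> state \<Rightarrow> real" where
  "Xnorm p N L u = (\<Sum>i=1..N. \<integral>x. \<bar>u i x\<bar> powr p \<partial>seg (L i)) powr (1 / p)"

definition Xeq :: "nat \<Rightarrow> (nat \<Rightarrow> real) \<Rightarrow> state \<Rightarrow> state \<Rightarrow> bool" where
  "Xeq N L u v \<longleftrightarrow> (\<forall>i\<in>{1..N}. AE x in seg (L i). u i x = v i x)"

definition scale :: "real \<Rightarrow> state \<Rightarrow> state" where
  "scale c u = (\<lambda>i x. c * u i x)"

definition simple_on :: "real \<Rightarrow> nat \<Rightarrow> (nat \<Rightarrow> real) \<Rightarrow> real \<Rightarrow> (real \<Rightarrow> state) \<Rightarrow> bool" where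
  "simple_on p N L t s \<longleftrightarrow> finite (s ` {0..t}) \<and> s ` {0..t} \<subseteq> Xp p N L \<and>
     (\<forall>v. {\<tau> \<in> {0..t}. s \<tau> = v} \<in> sets borel)"

definition simple_integral_on :: "real \<Rightarrow> (real \<Rightarrow> state) \<Rightarrow> state" where
  "simple_integral_on t s =
     (\<Sum>v \<in> s ` {0..t}. scale (measure lborel {\<tau> \<in> {0..t}. s \<tau> = v}) v)"

text \<open>\<open>has_X_integral p N L t f w\<close>: \<open>f\<close> is Bochner integrable on \<open>[0, t]\<close> as a function with
  values in \<open>Xp p N L\<close>, with integral \<open>w\<close>. This is the library's definition
  \<open>has_bochner_integral\<close>, which cannot be used itself because \<open>Xp p N L\<close> is not a type.\<close>

definition has_X_integral ::
    "real \<Rightarrow> nat \<Rightarrow> (nat \<Rightarrow> real) \<Rightarrow> real \<Rightarrow> (real \<Rightarrow> state) \<Rightarrow> state \<Rightarrow> bool" where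
  "has_X_integral p N L t f w \<longleftrightarrow>
     (\<forall>\<tau>\<in>{0..t}. f \<tau> \<in> Xp p N L) \<and> w \<in> Xp p N L \<and>
     (\<exists>s :: nat \<Rightarrow> real \<Rightarrow> state.
        (\<forall>k. simple_on p N L t (s k)) \<and>
        (\<forall>k. (\<lambda>\<tau>. Xnorm p N L (f \<tau> - s k \<tau>)) \<in> borel_measurable (restrict_space lborel {0..t})) \<and>
        (\<lambda>k. \<integral>\<^sup>+\<tau>. ennreal (Xnorm p N L (f \<tau> - s k \<tau>)) \<partial>restrict_space lborel {0..t})
          \<longlonglongrightarrow> 0 \<and>
        (\<lambda>k. Xnorm p N L (simple_integral_on t (s k) - w)) \<longlonglongrightarrow> 0)"


section \<open>The operators, the semigroup and the solutions\<close>

definition domA :: "real \<Rightarrow> nat \<Rightarrow> (nat \<Rightarrow> real) \<Rightarrow> (nat \<Rightarrow> nat \<Rightarrow> real) \<Rightarrow> state set" where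
  "domA p N L m = {u. (\<forall>i\<in>{1..N}. u i \<in> W1p p (L i)) \<and>
     (\<forall>i\<in>{1..N}. crep (L i) (u i) 0 = (\<Sum>j=1..N. m i j * crep (L j) (u j) (L j)))}"

definition opA :: "real \<Rightarrow> (nat \<Rightarrow> real) \<Rightarrow> state \<Rightarrow> state" where
  "opA p L u = (\<lambda>i x. - wderiv p (L i) (u i) x)"

definition opB :: "(nat \<Rightarrow> real) \<Rightarrow> (nat \<Rightarrow> real) \<Rightarrow> nat \<Rightarrow> state \<Rightarrow> state" where
  "opB a b i u = (\<lambda>k x. if k = i then - indicator {a i..b i} x * u i x else 0)"

definition c0_semigroup ::
    "real \<Rightarrow> nat \<Rightarrow> (nat \<Rightarrow> real) \<Rightarrow> (real \<Rightarrow> state \<Rightarrow> state) \<Rightarrow> bool" where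
  "c0_semigroup p N L T \<longleftrightarrow>
     (\<forall>t\<ge>0. \<forall>u\<in>Xp p N L. T t u \<in> Xp p N L) \<and>
     (\<forall>t\<ge>0. \<forall>u\<in>Xp p N L. \<forall>v\<in>Xp p N L. \<forall>c.
        Xeq N L (T t (scale c u + v)) (scale c (T t u) + T t v)) \<and>
     (\<forall>t\<ge>0. \<exists>C. \<forall>u\<in>Xp p N L. Xnorm p N L (T t u) \<le> C * Xnorm p N L u) \<and>
     (\<forall>u\<in>Xp p N L. Xeq N L (T 0 u) u) \<and>
     (\<forall>s\<ge>0. \<forall>t\<ge>0. \<forall>u\<in>Xp p N L. Xeq N L (T (s + t) u) (T s (T t u))) \<and>
     (\<forall>u\<in>Xp p N L. ((\<lambda>t. Xnorm p N L (T t u - u)) \<longlongrightarrow> 0) (at_right 0))"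

definition is_right_deriv0 ::
    "real \<Rightarrow> nat \<Rightarrow> (nat \<Rightarrow> real) \<Rightarrow> (real \<Rightarrow> state \<Rightarrow> state) \<Rightarrow> state \<Rightarrow> state \<Rightarrow> bool" where
  "is_right_deriv0 p N L T u w \<longleftrightarrow>
     ((\<lambda>h. Xnorm p N L (scale (1 / h) (T h u - u) - w)) \<longlongrightarrow> 0) (at_right 0)"

text \<open>\<open>T t\<close> is the semigroup usually written \<open>exp (t A)\<close>: the infinitesimal generator of \<open>T\<close>
  has domain exactly \<open>domA\<close> and coincides there with \<open>opA\<close>.\<close>

definition semigroup_of_A ::
    "real \<Rightarrow> nat \<Rightarrow> (nat \<Rightarrow> real) \<Rightarrow> (nat \<Rightarrow> nat \<Rightarrow> real) \<Rightarrow> (real \<Rightarrow> state \<Rightarrow> state) \<Rightarrow> bool" where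
  "semigroup_of_A p N L m T \<longleftrightarrow> c0_semigroup p N L T \<and>
     (\<forall>u\<in>Xp p N L. (\<exists>w\<in>Xp p N L. is_right_deriv0 p N L T u w) \<longleftrightarrow> u \<in> domA p N L m) \<and>
     (\<forall>u\<in>domA p N L m. is_right_deriv0 p N L T u (opA p L u))"

definition mild_solution ::
    "real \<Rightarrow> nat \<Rightarrow> nat \<Rightarrow> (nat \<Rightarrow> real) \<Rightarrow> (nat \<Rightarrow> real) \<Rightarrow> (nat \<Rightarrow> real) \<Rightarrow> (nat \<Rightarrow> real \<Rightarrow> real) \<Rightarrow>
     (real \<Rightarrow> state \<Rightarrow> state) \<Rightarrow> state \<Rightarrow> (real \<Rightarrow> state) \<Rightarrow> bool" where
  "mild_solution p N Nd L a b \<alpha> T z0 z \<longleftrightarrow>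
     (\<forall>t\<ge>0. z t \<in> Xp p N L) \<and>
     (\<forall>t\<ge>0. ((\<lambda>s. Xnorm p N L (z s - z t)) \<longlongrightarrow> 0) (at t within {0..})) \<and>
     (\<forall>t\<ge>0. \<exists>w.
        has_X_integral p N L t
          (\<lambda>\<tau>. T (t - \<tau>) (\<Sum>i=1..Nd. scale (\<alpha> i \<tau>) (opB a b i (z \<tau>)))) w \<and>
        Xeq N L (z t) (T t z0 + w))"


section \<open>The coefficients\<close>

text \<open>Multi-indices are functions on \<open>nat\<close> vanishing outside \<open>{1..N}\<close>.\<close>

definition multi_idx :: "nat \<Rightarrow> (nat \<Rightarrow> nat) set" where
  "multi_idx N = {n. \<forall>k. k \<notin> {1..N} \<longrightarrow> n k = 0}"

definition multi_idx0 :: "nat \<Rightarrow> nat \<Rightarrow> (nat \<Rightarrow> nat) set" where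
  "multi_idx0 N j = {n \<in> multi_idx N. n j = 0}"

definition len :: "nat \<Rightarrow> (nat \<Rightarrow> real) \<Rightarrow> (nat \<Rightarrow> nat) \<Rightarrow> real" where
  "len N L n = (\<Sum>i=1..N. real (n i) * L i)"

definition eps ::
    "nat \<Rightarrow> (nat \<Rightarrow> real) \<Rightarrow> (nat \<Rightarrow> real) \<Rightarrow> (nat \<Rightarrow> real) \<Rightarrow> (nat \<Rightarrow> real \<Rightarrow> real) \<Rightarrow>
     nat \<Rightarrow> (nat \<Rightarrow> nat) \<Rightarrow> real \<Rightarrow> real \<Rightarrow> real" where
  "eps N L a b \<alpha> j n x t =
     exp (- (LINT s:{t - len N L n - L j + max x (a j) .. t - len N L n - L j + b j}|lborel. \<alpha> j s))"

text \<open>\<open>theta_end\<close> is the coefficient at \<open>x = L j\<close>; the factor \<open>eps \<dots> * theta_end \<dots>\<close> in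
  its recursion is the coefficient \<open>theta\<close> (defined below from \<open>theta_end\<close>) at \<open>x = 0\<close>, and
  \<open>n(k := n k - 1)\<close> is \<open>n\<close> minus the \<open>k\<close>-th unit vector.\<close>

function theta_end ::
    "nat \<Rightarrow> (nat \<Rightarrow> real) \<Rightarrow> (nat \<Rightarrow> nat \<Rightarrow> real) \<Rightarrow> (nat \<Rightarrow> real) \<Rightarrow> (nat \<Rightarrow> real) \<Rightarrow>
     (nat \<Rightarrow> real \<Rightarrow> real) \<Rightarrow> nat \<Rightarrow> nat \<Rightarrow> (nat \<Rightarrow> nat) \<Rightarrow> real \<Rightarrow> real" where
  "theta_end N L m a b \<alpha> i j n t =
     (if \<forall>k\<in>{1..N}. n k = 0 then m i j
      else \<Sum>k \<in> {k \<in> {1..N}. 1 \<le> n k}.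
        m k j * (eps N L a b \<alpha> k (n(k := n k - 1)) 0 t *
                 theta_end N L m a b \<alpha> i k (n(k := n k - 1)) t))"
  by pat_completeness auto
termination
proof (relation "Wellfounded.measure (\<lambda>(N, L, m, a, b, \<alpha>, i, j, n, t). \<Sum>k=1..N. n k)", goal_cases)
  case (2 N L m a b \<alpha> i j n t k)
  then have "k \<in> {1..N}" "1 \<le> n k" by auto
  then have "(\<Sum>l=1..N. (n(k := n k - 1)) l) < (\<Sum>l=1..N. n l)"
    by (intro sum_strict_mono_ex1) (auto intro!: bexI[of _ k])
  then show ?case by simp
qed simp

declare theta_end.simps [simp del]

definition theta ::
    "nat \<Rightarrow> (nat \<Rightarrow> real) \<Rightarrow> (nat \<Rightarrow> nat \<Rightarrow> real) \<Rightarrow> (nat \<Rightarrow> real) \<Rightarrow> (nat \<Rightarrow> real) \<Rightarrow>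
     (nat \<Rightarrow> real \<Rightarrow> real) \<Rightarrow> nat \<Rightarrow> nat \<Rightarrow> (nat \<Rightarrow> nat) \<Rightarrow> real \<Rightarrow> real \<Rightarrow> real" where
  "theta N L m a b \<alpha> i j n x t = eps N L a b \<alpha> j n x t * theta_end N L m a b \<alpha> i j n t"

lemma theta_end_rec:
  assumes "n \<in> multi_idx N"
  shows "theta_end N L m a b \<alpha> i j n t =
     (if n = (\<lambda>_. 0) then m i j
      else \<Sum>k | k \<in> {1..N} \<and> 1 \<le> n k. m k j * theta N L m a b \<alpha> i k (n(k := n k - 1)) 0 t)"
proof -
  have "(\<forall>k\<in>{1..N}. n k = 0) \<longleftrightarrow> n = (\<lambda>_. 0)"
    using assms by (auto simp: multi_idx_def fun_eq_iff)
  then show ?thesis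
    by (subst theta_end.simps) (simp add: theta_def)
qed

lemma theta_at_end:
  assumes "b j \<le> L j"
  shows "theta N L m a b \<alpha> i j n (L j) t = theta_end N L m a b \<alpha> i j n t"
proof -
  let ?c = "t - len N L n - L j"
  have "{?c + max (L j) (a j) .. ?c + b j} \<subseteq> {?c + L j}"
    using assms by auto
  then have "{?c + max (L j) (a j) .. ?c + b j} \<in> null_sets lborel"
    by (meson finite.emptyI finite_imp_null_set_lborel finite_insert finite_subset)
  then have "AE x in lborel. indicator {?c + max (L j) (a j) .. ?c + b j} x *\<^sub>R \<alpha> j x = 0"
    by (rule AE_I') (auto simp: indicator_def)
  then have "(LINT s:{?c + max (L j) (a j) .. ?c + b j}|lborel. \<alpha> j s) = 0"
    unfolding set_lebesgue_integral_def by (rule integral_eq_zero_AE)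
  then show ?thesis
    by (simp add: theta_def eps_def)
qed

end

theory Submission
  imports Defs
begin

text \<open>
  Test functions are propagated backwards by the adjoint of the uncontrolled flow. Differentiating
  the pairing of \<open>T t u\<close> with this evolution, for \<open>u\<close> in the domain of the generator, shows that
  on a short time interval the abstract semigroup is the explicit transport semigroup tested against smooth
  functions; the local bound on the operator norms needed for this comes from a gliding hump
  argument, and density extends the identity to the whole space. Pairing the variation of constants
  formula with test functions gives a scalar Duhamel formula, which the function obtained by
  integrating along characteristics satisfies as well, by Fubini's theorem. As the formula is a contraction in
  \<open>L\<^sup>1\<close> on short intervals, the two agree there. The explicit expression is a primitive of an
  \<open>L\<^sup>p\<close> function and satisfies the boundary conditions, so it lies in the domain again and the argument can be
  iterated. Finally the traces at the ends of the edges satisfy a delay equation, and unrolling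
  it until all delays exceed the time gives the sum over multi-indices.
\<close>

section \<open>Test functions\<close>

text \<open>\<open>T\<close> is known only through its generator, and its laws hold only up to
  \<open>Xeq\<close>, as states are representatives; pairing with test functions turns these laws
  into exact identities of numbers. \<open>c0_semigroup\<close> bounds each \<open>T t\<close>
  separately, with no uniformity in \<open>t\<close>, while differentiating the pairing needs one
  bound near time 0: this forces the gliding hump. The adjoint flow has the closed form
  \<open>psi\<close> only up to time \<open>Lmin\<close>, before mass can cross two vertices. To
  stay below it, the variation of constants formula is restarted at \<open>t0\<close>: subtracting
  the formula at \<open>t0\<close> from that at \<open>t0 + h\<close> cancels the history, so
  \<open>T\<close> is identified on a short interval only. A restart needs a state in
  \<open>domA\<close>, as the boundary condition is what makes the candidate continuous across the
  characteristics leaving the vertices at the restart. The limit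
  \<open>\<delta> * (4 * Km) \<le> 1\<close> makes the formula halve L^1 norms: these are tested by
  functions bounded by 2, \<open>psi\<close> costs a factor \<open>Km\<close>, and the other 2 is
  the halving.\<close>

lemma AE_seg_iff: "(AE x in seg l. P x) \<longleftrightarrow> (AE x in lborel. x \<in> {0<..<l} \<longrightarrow> P x)"
  unfolding seg_def by (subst AE_restrict_space_iff) auto

lemma integral_seg: "(\<integral>x. f x \<partial>seg l) = (\<integral>x. indicator {0<..<l} x * f x \<partial>lborel)" for f :: "real \<Rightarrow> real"
  unfolding seg_def by (subst integral_restrict_space) auto

lemma integrable_seg:
  "integrable (seg l) f \<longleftrightarrow> integrable lborel (\<lambda>x. indicator {0<..<l} x * f x)" for f :: "real \<Rightarrow> real"
  unfolding seg_def by (subst integrable_restrict_space) auto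

lemma measurable_seg_iff:
  "f \<in> borel_measurable (seg l) \<longleftrightarrow> (\<lambda>x. indicator {0<..<l} x * f x) \<in> borel_measurable borel"
  for f :: "real \<Rightarrow> real"
  unfolding seg_def by (subst borel_measurable_restrict_space_iff) auto

lemma measurable_seg_borel: "f \<in> borel_measurable borel \<Longrightarrow> f \<in> borel_measurable (seg l)"
  for f :: "real \<Rightarrow> real"
  unfolding seg_def by (rule measurable_restrict_space1) simp

lemma finite_measure_seg: "finite_measure (seg l)"
proof
  have "emeasure (seg l) (space (seg l)) = emeasure lborel {0<..<l}"
    unfolding seg_def by (subst emeasure_restrict_space) (auto simp: space_restrict_space)
  also have "\<dots> \<le> emeasure lborel {0..\<bar>l\<bar>}"
    by (rule emeasure_mono) auto
  also have "\<dots> < \<infinity>"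
    by simp
  finally show "emeasure (seg l) (space (seg l)) \<noteq> \<infinity>"
    by simp
qed

lemma space_seg [simp]: "space (seg l) = {0<..<l}"
  by (simp add: seg_def space_restrict_space)

lemma measure_seg: "0 \<le> l \<Longrightarrow> measure (seg l) {0<..<l} = l"
  unfolding seg_def by (subst measure_restrict_space) auto

lemma integrable_seg_const [simp]: "integrable (seg l) (\<lambda>x. c :: real)"
  by (rule finite_measure.integrable_const[OF finite_measure_seg])

text \<open>Exactly the condition that \<open>weak_deriv\<close> puts on a test function and its
  derivative; with the derivative as an argument it need not be chosen again at each use.\<close>

definition tst :: "real \<Rightarrow> (real \<Rightarrow> real) \<Rightarrow> (real \<Rightarrow> real) \<Rightarrow> bool" where
  "tst l \<phi> \<phi>' \<longleftrightarrow> (\<forall>x. (\<phi> has_real_derivative \<phi>' x) (at x)) \<and> continuous_on UNIV \<phi>' \<and>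
     (\<exists>c d. 0 < c \<and> c \<le> d \<and> d < l \<and> (\<forall>x. x \<notin> {c..d} \<longrightarrow> \<phi> x = 0))"

text \<open>Squaring the positive part removes its kink; the C^1 cutoffs are built from this
  function. Only at 0 is the difference quotient itself considered, where it is at most |h| in
  size.\<close>

lemma max_zero_square_deriv:
  "((\<lambda>x::real. (max 0 x)\<^sup>2) has_real_derivative 2 * max 0 x) (at x)"
proof -
  consider "x > 0" | "x < 0" | "x = 0" by linarith
  then show ?thesis
  proof cases
    case 1
    have "((\<lambda>x::real. x\<^sup>2) has_real_derivative 2 * max 0 x) (at x)"
      using 1 by (auto intro!: derivative_eq_intros)
    then show ?thesis
      by (rule has_field_derivative_transform_within_open[of _ _ _ "{0<..}"]) (use 1 in auto)
  next
    case 2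
    have "((\<lambda>x::real. 0) has_real_derivative 2 * max 0 x) (at x)"
      using 2 by (auto intro!: derivative_eq_intros)
    then show ?thesis
      by (rule has_field_derivative_transform_within_open[of _ _ _ "{..<0}"]) (use 2 in auto)
  next
    case 3
    have "((\<lambda>h. ((max 0 h)\<^sup>2 - (max 0 0)\<^sup>2) / (h - 0)) \<longlongrightarrow> (0::real)) (at 0)"
    proof (rule Lim_null_comparison[where g = "\<lambda>h. \<bar>h\<bar>"])
      show "eventually (\<lambda>h::real. norm (((max 0 h)\<^sup>2 - (max 0 0)\<^sup>2) / (h - 0)) \<le> \<bar>h\<bar>) (at 0)"
        by (intro always_eventually allI) (auto simp: max_def power2_eq_square)
      show "((\<lambda>h. \<bar>h\<bar>) \<longlongrightarrow> (0::real)) (at 0)"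
        using tendsto_rabs[OF tendsto_ident_at, of "0::real" UNIV] by simp
    qed
    then show ?thesis
      using 3 by (simp add: has_field_derivative_iff)
  qed
qed

text \<open>\<open>W k\<close> is positive exactly on an open interval that grows to ]0, l[, and the
  map w / (1 + w) at w = k W k x squeezes it into [0, 1] while pushing it to 1 wherever
  \<open>W k\<close> stays away from 0.\<close>

lemma tst_cutoffs:
  assumes "0 < l"
  obtains \<eta> \<eta>' where "\<And>k. tst l (\<eta> k) (\<eta>' k)" "\<And>k x. 0 \<le> \<eta> k x \<and> \<eta> k x \<le> (1::real)"
    "\<And>x. x \<in> {0<..<l} \<Longrightarrow> (\<lambda>k::nat. \<eta> k x) \<longlonglongrightarrow> 1"
proof -
  \<comment> \<open>The shift by 3 gives \<open>r k \<le> l / 3\<close>, so that the support from r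
    k to l - r k is nonempty already for k = 0.\<close>
  define r where "r k = l / real (k + 3)" for k
  define W where "W k x = (max 0 (x - r k))\<^sup>2 * (max 0 (l - r k - x))\<^sup>2" for k x
  define W' where "W' k x = 2 * max 0 (x - r k) * (max 0 (l - r k - x))\<^sup>2
      - (max 0 (x - r k))\<^sup>2 * (2 * max 0 (l - r k - x))" for k x
  define \<eta> where "\<eta> k x = real k * W k x / (1 + real k * W k x)" for k x
  define \<eta>' where "\<eta>' k x = real k * W' k x / (1 + real k * W k x)\<^sup>2" for k x
  have W0: "0 \<le> W k x" for k x
    by (simp add: W_def)
  have nz: "1 + real k * W k x > 0" for k x
    using W0[of k x] by (simp add: add_pos_nonneg)
  have r: "0 < r k" "r k \<le> l / 3" for k
    using assms by (auto simp: r_def field_simps)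
  have dW: "(W k has_real_derivative W' k x) (at x)" for k x
  proof -
    have 1: "((\<lambda>x. (max 0 (x - r k))\<^sup>2) has_real_derivative (2 * max 0 (x - r k)) * 1) (at x)"
      by (rule DERIV_chain2[OF max_zero_square_deriv]) (auto intro!: derivative_eq_intros)
    have 2: "((\<lambda>x. (max 0 (l - r k - x))\<^sup>2) has_real_derivative (2 * max 0 (l - r k - x)) * (-1)) (at x)"
      by (rule DERIV_chain2[OF max_zero_square_deriv]) (auto intro!: derivative_eq_intros)
    show ?thesis
      using DERIV_mult[OF 1 2] unfolding W_def W'_def by (simp add: algebra_simps)
  qed
  have d\<eta>: "(\<eta> k has_real_derivative \<eta>' k x) (at x)" for k x
  proof -
    have n: "1 + real k * W k x \<noteq> 0" using nz[of k x] by linarith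
    have "((\<lambda>x. real k * W k x / (1 + real k * W k x)) has_real_derivative
        ((real k * W' k x) * (1 + real k * W k x) - (real k * W k x) * (real k * W' k x))
          / ((1 + real k * W k x) * (1 + real k * W k x))) (at x)"
      by (rule DERIV_divide) (use n dW in \<open>auto intro!: derivative_eq_intros\<close>)
    then show ?thesis
      unfolding \<eta>_def \<eta>'_def by (simp add: algebra_simps power2_eq_square)
  qed
  show ?thesis
  proof (rule that[of \<eta> \<eta>'])
    fix k
    have c: "continuous_on UNIV (\<eta>' k)"
      unfolding \<eta>'_def W_def W'_def
      by (intro continuous_intros ballI) (use nz[of k] in \<open>auto simp: W_def add_nonneg_eq_0_iff\<close>)
    have "\<eta> k x = 0" if "x \<notin> {r k..l - r k}" for x
      using that by (auto simp: \<eta>_def W_def max_def)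
    then show "tst l (\<eta> k) (\<eta>' k)"
      unfolding tst_def using d\<eta> c r[of k] assms
      by (intro conjI allI exI[of _ "r k"] exI[of _ "l - r k"] impI) auto
  next
    fix k x show "0 \<le> \<eta> k x \<and> \<eta> k x \<le> 1"
      using W0[of k x] nz[of k x] by (auto simp: \<eta>_def field_simps)
  next
    fix x assume x: "x \<in> {0<..<l}"
    have rl: "r \<longlonglongrightarrow> 0"
      unfolding r_def
      by (rule real_tendsto_divide_at_top[OF tendsto_const])
         (intro filterlim_compose[OF filterlim_real_sequentially] filterlim_add_const_nat_at_top)
    have Wl: "(\<lambda>k. W k x) \<longlonglongrightarrow> (max 0 (x - 0))\<^sup>2 * (max 0 (l - 0 - x))\<^sup>2"
      unfolding W_def by (intro tendsto_intros rl)
    have p: "(max 0 (x - 0))\<^sup>2 * (max 0 (l - 0 - x))\<^sup>2 > 0"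
      using x by auto
    have t: "filterlim (\<lambda>k. W k x * real k) at_top sequentially"
      by (rule filterlim_tendsto_pos_mult_at_top[OF Wl p filterlim_real_sequentially])
    have "filterlim (\<lambda>k. 1 + W k x * real k) at_top sequentially"
      by (rule filterlim_tendsto_add_at_top[OF tendsto_const t])
    then have "(\<lambda>k. 1 - 1 / (1 + W k x * real k)) \<longlonglongrightarrow> 1 - 0"
      by (intro tendsto_diff tendsto_const real_tendsto_divide_at_top[OF tendsto_const])
    moreover have "1 - 1 / (1 + W k x * real k) = \<eta> k x" for k
      using nz[of k x] by (simp add: \<eta>_def field_simps)
    ultimately show "(\<lambda>k. \<eta> k x) \<longlonglongrightarrow> 1"
      by simp
  qed
qed

text \<open>A measurable function is an almost everywhere limit of continuous ones. These are
  truncated at \<open>M\<close>, replaced by polynomials for differentiability, and cut off near the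
  ends. The polynomial error is at most 1, hence the bound \<open>M + 1\<close>.\<close>

lemma tst_approx:
  fixes f :: "real \<Rightarrow> real"
  assumes "0 < l" and f: "f \<in> borel_measurable borel" and M: "\<And>x. \<bar>f x\<bar> \<le> M"
  obtains \<phi> \<phi>' where "\<And>n::nat. tst l (\<phi> n) (\<phi>' n)" "\<And>n x. \<bar>\<phi> n x\<bar> \<le> M + 1"
    "AE x in seg l. (\<lambda>n. \<phi> n x) \<longlonglongrightarrow> f x"
proof -
  have M0: "0 \<le> M" using M[of 0] by linarith
  have "f measurable_on UNIV"
    using f by (intro lebesgue_measurable_imp_measurable_on measurable_completion) auto
  then obtain N g where N: "negligible N" and g: "\<And>n. continuous_on UNIV (g n)"
    and gl: "\<And>x. x \<notin> N \<Longrightarrow> (\<lambda>n. g n x) \<longlonglongrightarrow> f x"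
    unfolding measurable_on_def by auto
  define c where "c n x = max (- M) (min M (g n x))" for n x
  have cont: "continuous_on {0..l} (c n)" for n
    unfolding c_def by (intro continuous_intros continuous_on_subset[OF g]) auto
  have "\<exists>q. real_polynomial_function q \<and> (\<forall>x\<in>{0..l}. \<bar>c n x - q x\<bar> < 1 / real (Suc n))" for n
    by (rule Stone_Weierstrass_real_polynomial_function[OF _ cont, of "1 / real (Suc n)" n]) auto
  then obtain q where q: "\<And>n. real_polynomial_function (q n)"
    and qc: "\<And>n x. x \<in> {0..l} \<Longrightarrow> \<bar>c n x - q n x\<bar> < 1 / real (Suc n)"
    by metis
  have "\<exists>q'. real_polynomial_function q' \<and> (\<forall>x. (q n has_real_derivative q' x) (at x))" for n
    using has_real_derivative_polynomial_function[OF q] by metis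
  then obtain q' where q'c: "\<And>n. real_polynomial_function (q' n)"
    and q'd: "\<And>n x. (q n has_real_derivative q' n x) (at x)"
    by metis
  obtain \<eta> \<eta>' where \<eta>: "\<And>k. tst l (\<eta> k) (\<eta>' k)" "\<And>k x. 0 \<le> \<eta> k x \<and> \<eta> k x \<le> (1::real)"
    and \<eta>l: "\<And>x. x \<in> {0<..<l} \<Longrightarrow> (\<lambda>k::nat. \<eta> k x) \<longlonglongrightarrow> 1"
    using tst_cutoffs[OF \<open>0 < l\<close>] by metis
  define \<phi> where "\<phi> n x = \<eta> n x * q n x" for n x
  define \<phi>' where "\<phi>' n x = \<eta>' n x * q n x + q' n x * \<eta> n x" for n x
  have polyc: "real_polynomial_function r \<Longrightarrow> continuous_on UNIV r" for r :: "real \<Rightarrow> real"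
    by (simp add: continuous_on_polymonial_function real_polynomial_function_eq)
  have qb: "\<bar>q n x\<bar> \<le> M + 1" if "x \<in> {0..l}" for n x
  proof -
    have "1 / real (Suc n) \<le> 1" by simp
    moreover have "\<bar>c n x\<bar> \<le> M" using M0 by (auto simp: c_def)
    ultimately show ?thesis using qc[OF that, of n] by linarith
  qed
  show ?thesis
  proof (rule that[of \<phi> \<phi>'])
    fix n
    have cont_\<eta>: "continuous_on UNIV (\<eta> n)"
      using \<eta>(1)[of n] unfolding tst_def
      by (auto simp: continuous_on_eq_continuous_within intro: DERIV_isCont)
    have "(\<phi> n has_real_derivative \<phi>' n x) (at x)" for x
      unfolding \<phi>_def \<phi>'_def using \<eta>(1)[of n] q'd by (intro DERIV_mult) (auto simp: tst_def)
    moreover have "continuous_on UNIV (\<phi>' n)"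
      unfolding \<phi>'_def using \<eta>(1)[of n] polyc[OF q] polyc[OF q'c]
      by (intro continuous_intros cont_\<eta>) (auto simp: tst_def)
    moreover obtain a b where "0 < a" "a \<le> b" "b < l" "\<forall>x. x \<notin> {a..b} \<longrightarrow> \<eta> n x = 0"
      using \<eta>(1)[of n] unfolding tst_def by metis
    ultimately show "tst l (\<phi> n) (\<phi>' n)"
      unfolding tst_def by (intro conjI allI exI[of _ a] exI[of _ b] impI) (auto simp: \<phi>_def)
  next
    fix n x
    show "\<bar>\<phi> n x\<bar> \<le> M + 1"
    proof (cases "x \<in> {0..l}")
      case True
      have "\<bar>\<eta> n x\<bar> * \<bar>q n x\<bar> \<le> 1 * (M + 1)"
        by (intro mult_mono) (use \<eta>(2)[of n x] qb[OF True] M0 in auto)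
      then show ?thesis by (simp add: \<phi>_def abs_mult)
    next
      case False
      then have "\<eta> n x = 0"
        using \<eta>(1)[of n] unfolding tst_def by force
      then show ?thesis using M0 by (simp add: \<phi>_def)
    qed
  next
    have "AE x in lebesgue. x \<notin> N"
      using N by (simp add: negligible_iff_null_sets AE_not_in)
    then have "AE x in lborel. x \<notin> N"
      by (simp add: AE_completion_iff)
    then show "AE x in seg l. (\<lambda>n. \<phi> n x) \<longlonglongrightarrow> f x"
      unfolding AE_seg_iff
    proof (eventually_elim, intro impI)
      fix x assume x: "x \<notin> N" "x \<in> {0<..<l}"
      have "(\<lambda>n. c n x) \<longlonglongrightarrow> max (- M) (min M (f x))"
        unfolding c_def by (intro tendsto_intros gl x)
      then have cl: "(\<lambda>n. c n x) \<longlonglongrightarrow> f x"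
        using M[of x] by (simp add: min_def max_def abs_le_iff split: if_splits)
      have "(\<lambda>n. c n x - q n x) \<longlonglongrightarrow> 0"
        by (rule Lim_null_comparison[OF _ LIMSEQ_inverse_real_of_nat])
           (use qc[of x] x in \<open>auto intro!: always_eventually less_imp_le simp: inverse_eq_divide\<close>)
      from tendsto_diff[OF cl this] have "(\<lambda>n. q n x) \<longlonglongrightarrow> f x" by simp
      from tendsto_mult[OF \<eta>l[OF x(2)] this] show "(\<lambda>n. \<phi> n x) \<longlonglongrightarrow> f x"
        by (simp add: \<phi>_def)
    qed
  qed
qed

section \<open>\<open>L\<^sup>p\<close> spaces on a segment\<close>

text \<open>Convexity comes from \<open>powr_convex\<close> on the open half-line; when one of the
  points is 0, the claim reduces to s^p <= s for s in [0, 1].\<close>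

lemma powr_convex_combination:
  fixes u v t p :: real
  assumes "1 \<le> p" "0 \<le> u" "0 \<le> v" "0 \<le> t" "t \<le> 1"
  shows "(t * u + (1 - t) * v) powr p \<le> t * u powr p + (1 - t) * v powr p"
proof -
  have *: "s powr p \<le> s" if "0 \<le> s" "s \<le> 1" for s :: real
    using powr_mono'[of 1 p s] that assms by (cases "s = 0") auto
  consider "u = 0" | "v = 0" | "0 < u" "0 < v"
    using assms by linarith
  then show ?thesis
  proof cases
    case 1
    then show ?thesis
      using *[of "1 - t"] assms by (simp add: powr_mult mult_right_mono)
  next
    case 2
    then show ?thesis
      using *[of t] assms by (simp add: powr_mult mult_right_mono)
  next
    case 3
    have "convex_on {0<..} (\<lambda>x::real. x powr p)"
      using assms by (intro powr_convex)
    from convex_onD[OF this, of "1 - t" u v] show ?thesis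
      using 3 assms by auto
  qed
qed

section \<open>Triangle inequality and completeness in L^p\<close>

definition lpn :: "real \<Rightarrow> real \<Rightarrow> (real \<Rightarrow> real) \<Rightarrow> real" where
  "lpn p l f = (\<integral>x. \<bar>f x\<bar> powr p \<partial>seg l) powr (1 / p)"

lemma lpn_nonneg [simp]: "0 \<le> lpn p l f"
  by (simp add: lpn_def)

lemma LpD: "f \<in> Lp p l \<Longrightarrow> f \<in> borel_measurable (seg l)"
  "f \<in> Lp p l \<Longrightarrow> integrable (seg l) (\<lambda>x. \<bar>f x\<bar> powr p)"
  by (auto simp: Lp_def)

lemma lpn_powr: "1 \<le> p \<Longrightarrow> lpn p l f powr p = (\<integral>x. \<bar>f x\<bar> powr p \<partial>seg l)"
  by (simp add: lpn_def powr_powr)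

lemma lpn_leI:
  assumes "1 \<le> p" "0 \<le> c" "(\<integral>x. \<bar>f x\<bar> powr p \<partial>seg l) \<le> c powr p"
  shows "lpn p l f \<le> c"
proof -
  have "lpn p l f \<le> (c powr p) powr (1 / p)"
    unfolding lpn_def using assms by (intro powr_mono2) auto
  then show ?thesis using assms by (simp add: powr_powr)
qed

lemma lpn_cong_AE:
  assumes "f \<in> borel_measurable (seg l)" "g \<in> borel_measurable (seg l)" "AE x in seg l. f x = g x"
  shows "lpn p l f = lpn p l g"
  unfolding lpn_def using assms by (subst integral_cong_AE[of _ _ "\<lambda>x. \<bar>g x\<bar> powr p"]) auto

lemma Lp_cong_AE:
  assumes "f \<in> Lp p l" "g \<in> borel_measurable (seg l)" "AE x in seg l. f x = g x"
  shows "g \<in> Lp p l"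
  using assms unfolding Lp_def
  by (auto intro!: integrable_cong_AE_imp[of "seg l" "\<lambda>x. \<bar>f x\<bar> powr p"])

lemma Lp_bounded:
  assumes "f \<in> borel_measurable (seg l)" "\<And>x. x \<in> {0<..<l} \<Longrightarrow> \<bar>f x\<bar> \<le> B" "1 \<le> p"
  shows "f \<in> Lp p l"
  unfolding Lp_def
proof (safe intro!: assms(1) Bochner_Integration.integrable_bound[OF integrable_seg_const[of _ "B powr p"]])
  show "AE x in seg l. norm (\<bar>f x\<bar> powr p) \<le> norm (B powr p)"
    using assms by (intro AE_I2) (auto intro!: powr_mono2)
qed (use assms in measurable)

lemma Lp_scale: "f \<in> Lp p l \<Longrightarrow> (\<lambda>x. c * f x) \<in> Lp p l"
  by (auto simp: Lp_def abs_mult powr_mult)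

lemma lpn_scale: "1 \<le> p \<Longrightarrow> lpn p l (\<lambda>x. c * f x) = \<bar>c\<bar> * lpn p l f"
  by (auto simp: lpn_def abs_mult powr_mult powr_powr)

text \<open>Minkowski's inequality by convexity: f + g is A + B times the combination of f / A and g
  / B with weights A / (A + B) and B / (A + B). Strictly positive bounds \<open>A\<close> and
  \<open>B\<close> in place of the norms avoid a division by 0 when a norm vanishes.\<close>

lemma Lp_add_bound:
  assumes p: "1 \<le> p" and f: "f \<in> Lp p l" and g: "g \<in> Lp p l" and AB: "0 < A" "0 < B"
    and fA: "lpn p l f \<le> A" and gB: "lpn p l g \<le> B"
  shows "(\<lambda>x. f x + g x) \<in> Lp p l \<and> lpn p l (\<lambda>x. f x + g x) \<le> A + B"
proof -
  define t where "t = A / (A + B)"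
  have t: "0 \<le> t" "t \<le> 1" "1 - t = B / (A + B)"
    using AB by (auto simp: t_def field_simps)
  define h where "h x = (A + B) powr p * (t * (\<bar>f x\<bar> powr p / A powr p) + (1 - t) * (\<bar>g x\<bar> powr p / B powr p))" for x
  have le: "\<bar>f x + g x\<bar> powr p \<le> h x" for x
  proof -
    have "\<bar>f x + g x\<bar> \<le> (A + B) * (t * (\<bar>f x\<bar> / A) + (1 - t) * (\<bar>g x\<bar> / B))"
    proof -
      have "(A + B) * (t * (\<bar>f x\<bar> / A) + (1 - t) * (\<bar>g x\<bar> / B)) = \<bar>f x\<bar> + \<bar>g x\<bar>"
        using AB add_pos_pos[OF AB] unfolding t unfolding t_def by (simp add: distrib_left)
      then show ?thesis
        by (simp only: abs_triangle_ineq)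
    qed
    then have "\<bar>f x + g x\<bar> powr p \<le> ((A + B) * (t * (\<bar>f x\<bar> / A) + (1 - t) * (\<bar>g x\<bar> / B))) powr p"
      using p by (intro powr_mono2) auto
    also have "\<dots> = (A + B) powr p * (t * (\<bar>f x\<bar> / A) + (1 - t) * (\<bar>g x\<bar> / B)) powr p"
      by (rule powr_mult)
    also have "\<dots> \<le> (A + B) powr p * (t * (\<bar>f x\<bar> / A) powr p + (1 - t) * (\<bar>g x\<bar> / B) powr p)"
      using p t AB by (intro mult_left_mono powr_convex_combination) auto
    also have "\<dots> = h x"
      using AB by (simp add: h_def powr_divide)
    finally show ?thesis .
  qed
  have inth: "integrable (seg l) h"
    unfolding h_def by (intro integrable_mult_right Bochner_Integration.integrable_add integrable_divide LpD f g)
  have m: "(\<lambda>x. f x + g x) \<in> borel_measurable (seg l)"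
    by (intro borel_measurable_add LpD(1)[OF f] LpD(1)[OF g])
  have int: "integrable (seg l) (\<lambda>x. \<bar>f x + g x\<bar> powr p)"
    by (rule Bochner_Integration.integrable_bound[OF inth])
       (use m order_trans[OF le abs_ge_self] in \<open>auto intro!: AE_I2\<close>)
  have "(\<integral>x. \<bar>f x\<bar> powr p \<partial>seg l) \<le> A powr p" "(\<integral>x. \<bar>g x\<bar> powr p \<partial>seg l) \<le> B powr p"
    using fA gB p AB by (auto simp: lpn_powr[symmetric] intro!: powr_mono2)
  then have AB1: "(\<integral>x. \<bar>f x\<bar> powr p \<partial>seg l) / A powr p \<le> 1" "(\<integral>x. \<bar>g x\<bar> powr p \<partial>seg l) / B powr p \<le> 1"
    using AB by auto
  have "(\<integral>x. \<bar>f x + g x\<bar> powr p \<partial>seg l) \<le> (\<integral>x. h x \<partial>seg l)"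
    by (rule integral_mono[OF int inth le])
  also have "\<dots> = (A + B) powr p * (t * ((\<integral>x. \<bar>f x\<bar> powr p \<partial>seg l) / A powr p)
      + (1 - t) * ((\<integral>x. \<bar>g x\<bar> powr p \<partial>seg l) / B powr p))"
    unfolding h_def using LpD(2)[OF f] LpD(2)[OF g] by simp
  also have "\<dots> \<le> (A + B) powr p * (t * 1 + (1 - t) * 1)"
    using AB1 t by (intro mult_left_mono add_mono) auto
  finally have "lpn p l (\<lambda>x. f x + g x) \<le> A + B"
    using p AB by (intro lpn_leI) auto
  then show ?thesis
    using m int by (auto simp: Lp_def)
qed

lemma Lp_add:
  assumes "1 \<le> p" "f \<in> Lp p l" "g \<in> Lp p l"
  shows "(\<lambda>x. f x + g x) \<in> Lp p l"
  using Lp_add_bound[OF assms, of "lpn p l f + 1" "lpn p l g + 1"] by (simp add: add_nonneg_pos)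

lemma lpn_triangle:
  assumes "1 \<le> p" "f \<in> Lp p l" "g \<in> Lp p l"
  shows "lpn p l (\<lambda>x. f x + g x) \<le> lpn p l f + lpn p l g"
proof (rule field_le_epsilon)
  fix e :: real assume "0 < e"
  then show "lpn p l (\<lambda>x. f x + g x) \<le> lpn p l f + lpn p l g + e"
    using Lp_add_bound[OF assms, of "lpn p l f + e / 2" "lpn p l g + e / 2"]
    by (simp add: add_nonneg_pos)
qed

lemma Lp_minus: "f \<in> Lp p l \<Longrightarrow> (\<lambda>x. - f x) \<in> Lp p l"
  using Lp_scale[of f p l "-1"] by simp

lemma Lp_diff: "1 \<le> p \<Longrightarrow> f \<in> Lp p l \<Longrightarrow> g \<in> Lp p l \<Longrightarrow> (\<lambda>x. f x - g x) \<in> Lp p l"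
  using Lp_add[OF _ _ Lp_minus, of p f l g] by simp

text \<open>Integrate s <= 1 + s^p at s = |f| / A, with A slightly larger than the norm: the 1
  contributes the length l and the power at most 1.\<close>

lemma Lp_L1:
  assumes p: "1 \<le> p" and l: "0 \<le> l" and f: "f \<in> Lp p l"
  shows "integrable (seg l) f" "(\<integral>x. \<bar>f x\<bar> \<partial>seg l) \<le> (l + 1) * lpn p l f"
proof -
  have le: "\<bar>f x\<bar> \<le> A * (1 + \<bar>f x\<bar> powr p / A powr p)" if "0 < A" for x A
  proof -
    have "\<bar>f x\<bar> / A \<le> 1 + (\<bar>f x\<bar> / A) powr p"
    proof (cases "\<bar>f x\<bar> / A \<le> 1")
      case False
      then have "(\<bar>f x\<bar> / A) powr 1 \<le> (\<bar>f x\<bar> / A) powr p"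
        using p by (intro powr_mono) auto
      then show ?thesis using False that by simp
    qed (simp add: add_increasing2)
    then have "\<bar>f x\<bar> \<le> A * (1 + (\<bar>f x\<bar> / A) powr p)"
      using that by (simp add: pos_divide_le_eq mult.commute)
    then show ?thesis using that by (simp add: powr_divide)
  qed
  have ih: "integrable (seg l) (\<lambda>x. A * (1 + \<bar>f x\<bar> powr p / A powr p))" for A
    using LpD(2)[OF f]
    by (intro integrable_mult_right Bochner_Integration.integrable_add integrable_divide integrable_seg_const)
  show int: "integrable (seg l) f"
    by (rule Bochner_Integration.integrable_bound[OF ih[of 1]])
       (use LpD(1)[OF f] order_trans[OF le[of 1] abs_ge_self] in \<open>auto intro!: AE_I2\<close>)
  have "(\<integral>x. \<bar>f x\<bar> \<partial>seg l) \<le> (l + 1) * (lpn p l f + e)" if "0 < e" for e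
  proof -
    define A where "A = lpn p l f + e"
    have A: "0 < A" using that by (simp add: A_def add_nonneg_pos)
    have "(\<integral>x. \<bar>f x\<bar> powr p \<partial>seg l) \<le> A powr p"
      using p that by (auto simp: lpn_powr[symmetric] A_def intro!: powr_mono2)
    then have q: "(\<integral>x. \<bar>f x\<bar> powr p \<partial>seg l) / A powr p \<le> 1"
      using A by auto
    have "(\<integral>x. \<bar>f x\<bar> \<partial>seg l) \<le> (\<integral>x. A * (1 + \<bar>f x\<bar> powr p / A powr p) \<partial>seg l)"
      by (intro integral_mono ih le A integrable_abs int)
    also have "\<dots> = A * (l + (\<integral>x. \<bar>f x\<bar> powr p \<partial>seg l) / A powr p)"
      using LpD(2)[OF f] l by (simp add: measure_seg)
    also have "\<dots> \<le> A * (l + 1)"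
      using q A by (intro mult_left_mono) auto
    finally show ?thesis by (simp add: A_def mult.commute)
  qed
  note * = this
  show "(\<integral>x. \<bar>f x\<bar> \<partial>seg l) \<le> (l + 1) * lpn p l f"
  proof (rule field_le_epsilon)
    fix e :: real assume "0 < e"
    then show "(\<integral>x. \<bar>f x\<bar> \<partial>seg l) \<le> (l + 1) * lpn p l f + e"
      using *[of "e / (l + 1)"] l by (simp add: distrib_left)
  qed
qed

text \<open>The increments are summable in L^1, so the sequence converges almost everywhere, and
  Fatou's lemma carries the tail bound over to the limit. Halving increments are what the gliding
  hump provides.\<close>

lemma Lp_complete:
  assumes p: "1 \<le> p" and l: "0 \<le> l" and x: "\<And>n. x n \<in> Lp p l"
    and \<epsilon>: "\<And>n. lpn p l (\<lambda>t. x (Suc n) t - x n t) \<le> \<epsilon> n" "\<And>n. \<epsilon> (Suc n) \<le> \<epsilon> n / 2"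
  obtains y where "y \<in> Lp p l" "\<And>n. lpn p l (\<lambda>t. y t - x n t) \<le> 2 * \<epsilon> n"
proof -
  have \<epsilon>0: "0 \<le> \<epsilon> n" for n
    by (rule order_trans[OF lpn_nonneg \<epsilon>(1)])
  have \<epsilon>p: "\<epsilon> (n + k) \<le> \<epsilon> n / 2 ^ k" for n k
  proof (induction k)
    case (Suc k)
    have "\<epsilon> (n + Suc k) \<le> \<epsilon> (n + k) / 2" using \<epsilon>(2)[of "n + k"] by simp
    also have "\<dots> \<le> \<epsilon> n / 2 ^ k / 2" using Suc by simp
    finally show ?case by simp
  qed simp
  \<comment> \<open>The factor \<open>1 - 1 / 2 ^ k\<close> is the partial geometric sum; it closes
    the induction, while the plain bound \<open>2 * \<epsilon> n\<close> would not reproduce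
    itself.\<close>
  have dist: "lpn p l (\<lambda>t. x (n + k) t - x n t) \<le> 2 * \<epsilon> n * (1 - 1 / 2 ^ k)" for n k
  proof (induction k)
    case 0
    then show ?case using p by (simp add: lpn_def)
  next
    case (Suc k)
    have "lpn p l (\<lambda>t. x (n + Suc k) t - x n t)
      = lpn p l (\<lambda>t. (x (Suc (n + k)) t - x (n + k) t) + (x (n + k) t - x n t))"
      by simp
    also have "\<dots> \<le> lpn p l (\<lambda>t. x (Suc (n + k)) t - x (n + k) t) + lpn p l (\<lambda>t. x (n + k) t - x n t)"
      by (intro lpn_triangle p Lp_diff x)
    also have "\<dots> \<le> \<epsilon> n / 2 ^ k + 2 * \<epsilon> n * (1 - 1 / 2 ^ k)"
      using Suc \<epsilon>(1)[of "n + k"] \<epsilon>p[of n k] by linarith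
    also have "\<dots> = 2 * \<epsilon> n * (1 - 1 / 2 ^ Suc k)"
      by (simp add: field_simps)
    finally show ?case .
  qed
  have dist2: "lpn p l (\<lambda>t. x (n + k) t - x n t) \<le> 2 * \<epsilon> n" for n k
  proof -
    have "2 * \<epsilon> n * (1 - 1 / 2 ^ k) \<le> 2 * \<epsilon> n * 1"
      using \<epsilon>0[of n] by (intro mult_left_mono) auto
    then show ?thesis using dist[of n k] by simp
  qed
  have meas: "x n \<in> borel_measurable (seg l)" for n by (rule LpD(1)[OF x])
  have conv: "AE t in seg l. convergent (\<lambda>n. x n t)"
  proof -
    have "(\<integral>\<^sup>+t. (\<Sum>n. ennreal \<bar>x (Suc n) t - x n t\<bar>) \<partial>seg l) = (\<Sum>n. \<integral>\<^sup>+t. ennreal \<bar>x (Suc n) t - x n t\<bar> \<partial>seg l)"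
      using meas by (intro nn_integral_suminf) auto
    also have "\<dots> \<le> (\<Sum>n. ennreal ((l + 1) * \<epsilon> 0 * (1 / 2) ^ n))"
    proof (intro suminf_le allI)
      fix n
      have L: "(\<lambda>t. x (Suc n) t - x n t) \<in> Lp p l" by (intro Lp_diff p x)
      have "(\<integral>\<^sup>+t. ennreal \<bar>x (Suc n) t - x n t\<bar> \<partial>seg l) = ennreal (\<integral>t. \<bar>x (Suc n) t - x n t\<bar> \<partial>seg l)"
        using Lp_L1(1)[OF p l L] by (intro nn_integral_eq_integral) auto
      also have "\<dots> \<le> ennreal ((l + 1) * \<epsilon> 0 * (1 / 2) ^ n)"
      proof (rule ennreal_leI)
        have "(\<integral>t. \<bar>x (Suc n) t - x n t\<bar> \<partial>seg l) \<le> (l + 1) * lpn p l (\<lambda>t. x (Suc n) t - x n t)"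
          by (rule Lp_L1(2)[OF p l L])
        also have "\<dots> \<le> (l + 1) * (\<epsilon> 0 / 2 ^ n)"
          using order_trans[OF \<epsilon>(1)[of n]] \<epsilon>p[of 0 n] l by (intro mult_left_mono) auto
        finally show "(\<integral>t. \<bar>x (Suc n) t - x n t\<bar> \<partial>seg l) \<le> (l + 1) * \<epsilon> 0 * (1 / 2) ^ n"
          by (simp add: power_divide)
      qed
      finally show "(\<integral>\<^sup>+t. ennreal \<bar>x (Suc n) t - x n t\<bar> \<partial>seg l) \<le> ennreal ((l + 1) * \<epsilon> 0 * (1 / 2) ^ n)" .
    qed auto
    also have "\<dots> = ennreal (\<Sum>n. (l + 1) * \<epsilon> 0 * (1 / 2) ^ n)"
      using \<epsilon>0 l by (intro suminf_ennreal2) (auto intro!: summable_mult summable_geometric)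
    also have "\<dots> < \<infinity>" by simp
    finally have "AE t in seg l. (\<Sum>n. ennreal \<bar>x (Suc n) t - x n t\<bar>) \<noteq> \<infinity>"
      using meas by (intro nn_integral_PInf_AE) auto
    then show ?thesis
    proof eventually_elim
      case (elim t)
      have "summable (\<lambda>n. \<bar>x (Suc n) t - x n t\<bar>)"
        by (rule summable_suminf_not_top) (use elim in auto)
      then have "summable (\<lambda>n. x (Suc n) t - x n t)"
        by (rule summable_rabs_cancel)
      then have "(\<lambda>n. \<Sum>i<n. x (Suc i) t - x i t) \<longlonglongrightarrow> (\<Sum>n. x (Suc n) t - x n t)"
        by (rule summable_LIMSEQ)
      then have "(\<lambda>n. (\<Sum>i<n. x (Suc i) t - x i t) + x 0 t) \<longlonglongrightarrow> (\<Sum>n. x (Suc n) t - x n t) + x 0 t"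
        by (intro tendsto_intros)
      moreover have "(\<lambda>n. (\<Sum>i<n. x (Suc i) t - x i t) + x 0 t) = (\<lambda>n. x n t)"
        by (simp add: sum_lessThan_telescope[of "\<lambda>i. x i t"] fun_eq_iff)
      ultimately have "(\<lambda>n. x n t) \<longlonglongrightarrow> (\<Sum>n. x (Suc n) t - x n t) + x 0 t"
        by (simp only:)
      then show ?case
        by (rule convergentI)
    qed
  qed
  define y where "y t = lim (\<lambda>n. x n t)" for t
  have ym: "y \<in> borel_measurable (seg l)"
    unfolding y_def using meas by (intro borel_measurable_lim_metric)
  have bound: "(\<integral>\<^sup>+t. ennreal (\<bar>y t - x n t\<bar> powr p) \<partial>seg l) \<le> ennreal ((2 * \<epsilon> n) powr p)" for n
  proof -
    have "(\<integral>\<^sup>+t. ennreal (\<bar>y t - x n t\<bar> powr p) \<partial>seg l)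
      = (\<integral>\<^sup>+t. liminf (\<lambda>k. ennreal (\<bar>x (n + k) t - x n t\<bar> powr p)) \<partial>seg l)"
    proof (rule nn_integral_cong_AE)
      show "AE t in seg l. ennreal (\<bar>y t - x n t\<bar> powr p)
          = liminf (\<lambda>k. ennreal (\<bar>x (n + k) t - x n t\<bar> powr p))"
        using conv
      proof eventually_elim
        case (elim t)
        then have "(\<lambda>k. x k t) \<longlonglongrightarrow> y t" by (simp add: y_def convergent_LIMSEQ_iff)
        then have "(\<lambda>k. x (k + n) t) \<longlonglongrightarrow> y t" by (rule LIMSEQ_ignore_initial_segment)
        then have "(\<lambda>k. x (n + k) t) \<longlonglongrightarrow> y t" by (simp add: add.commute)
        then have "(\<lambda>k. ennreal (\<bar>x (n + k) t - x n t\<bar> powr p)) \<longlonglongrightarrow> ennreal (\<bar>y t - x n t\<bar> powr p)"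
          using p by (intro tendsto_ennrealI tendsto_powr' tendsto_intros) auto
        then show ?case
          by (intro lim_imp_Liminf[symmetric]) auto
      qed
    qed
    also have "\<dots> \<le> liminf (\<lambda>k. \<integral>\<^sup>+t. ennreal (\<bar>x (n + k) t - x n t\<bar> powr p) \<partial>seg l)"
      using meas by (intro nn_integral_liminf) measurable
    also have "\<dots> \<le> liminf (\<lambda>k. ennreal ((2 * \<epsilon> n) powr p))"
    proof (intro Liminf_mono always_eventually allI)
      fix k
      have L: "(\<lambda>t. x (n + k) t - x n t) \<in> Lp p l" by (intro Lp_diff p x)
      have "(\<integral>\<^sup>+t. ennreal (\<bar>x (n + k) t - x n t\<bar> powr p) \<partial>seg l)
        = ennreal (\<integral>t. \<bar>x (n + k) t - x n t\<bar> powr p \<partial>seg l)"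
        using LpD(2)[OF L] by (intro nn_integral_eq_integral) auto
      also have "\<dots> = ennreal (lpn p l (\<lambda>t. x (n + k) t - x n t) powr p)"
        using p by (simp add: lpn_powr)
      also have "\<dots> \<le> ennreal ((2 * \<epsilon> n) powr p)"
        using dist2 p by (intro ennreal_leI powr_mono2) auto
      finally show "(\<integral>\<^sup>+t. ennreal (\<bar>x (n + k) t - x n t\<bar> powr p) \<partial>seg l) \<le> ennreal ((2 * \<epsilon> n) powr p)" .
    qed
    finally show ?thesis by (simp add: Liminf_const)
  qed
  have diff: "(\<lambda>t. y t - x n t) \<in> Lp p l \<and> lpn p l (\<lambda>t. y t - x n t) \<le> 2 * \<epsilon> n" for n
  proof -
    have m: "(\<lambda>t. \<bar>y t - x n t\<bar> powr p) \<in> borel_measurable (seg l)"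
      using ym meas by measurable
    have int: "integrable (seg l) (\<lambda>t. \<bar>y t - x n t\<bar> powr p)"
      by (rule integrableI_bounded[OF m]) (use bound[of n] in \<open>auto simp: le_less_trans\<close>)
    have "ennreal (\<integral>t. \<bar>y t - x n t\<bar> powr p \<partial>seg l) \<le> ennreal ((2 * \<epsilon> n) powr p)"
      using bound[of n] nn_integral_eq_integral[OF int] by simp
    then have "(\<integral>t. \<bar>y t - x n t\<bar> powr p \<partial>seg l) \<le> (2 * \<epsilon> n) powr p"
      by (simp add: ennreal_le_iff)
    then show ?thesis
      using ym meas int p \<epsilon>0[of n] by (auto simp: Lp_def intro!: lpn_leI)
  qed
  have "y \<in> Lp p l"
    using Lp_add[OF p conjunct1[OF diff[of 0]] x[of 0]] by simp
  with diff show ?thesis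
    by (intro that[of y]) auto
qed

section \<open>The state space\<close>

lemma tstD:
  assumes "tst l \<phi> \<phi>'"
  shows "\<And>x. (\<phi> has_real_derivative \<phi>' x) (at x)" "continuous_on UNIV \<phi>'" "continuous_on UNIV \<phi>"
    "\<And>x. x \<notin> {0<..<l} \<Longrightarrow> \<phi> x = 0" "\<phi> \<in> borel_measurable borel" "\<phi>' \<in> borel_measurable borel"
proof -
  show *: "\<And>x. (\<phi> has_real_derivative \<phi>' x) (at x)" "continuous_on UNIV \<phi>'"
    "\<And>x. x \<notin> {0<..<l} \<Longrightarrow> \<phi> x = 0"
    using assms unfolding tst_def by force+
  show "continuous_on UNIV \<phi>"
    using *(1) by (auto simp: continuous_on_eq_continuous_within intro: DERIV_isCont)
  then show "\<phi> \<in> borel_measurable borel" "\<phi>' \<in> borel_measurable borel"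
    using *(2) by (auto intro: borel_measurable_continuous_onI)
qed

lemma tst_deriv_outside:
  assumes "tst l \<phi> \<phi>'" "x \<notin> {0<..<l}"
  shows "\<phi>' x = 0"
proof -
  obtain c d where cd: "0 < c" "c \<le> d" "d < l" "\<forall>x. x \<notin> {c..d} \<longrightarrow> \<phi> x = 0"
    using assms unfolding tst_def by auto
  have "((\<lambda>x. 0) has_real_derivative \<phi>' x) (at x)"
    by (rule has_field_derivative_transform_within_open[OF tstD(1)[OF assms(1)], of "- {c..d}"])
       (use cd assms in auto)
  then show ?thesis
    by (rule DERIV_unique) simp
qed

lemma tst_bounded:
  assumes "tst l \<phi> \<phi>'"
  obtains B where "0 < B" "\<And>x. \<bar>\<phi> x\<bar> \<le> B" "\<And>x. \<bar>\<phi>' x\<bar> \<le> B"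
proof -
  have "bounded (\<phi> ` {0..l})" "bounded (\<phi>' ` {0..l})"
    using tstD(2,3)[OF assms]
    by (auto intro!: compact_imp_bounded compact_continuous_image continuous_on_subset[of UNIV])
  then obtain B1 B2 where B: "\<forall>x\<in>{0..l}. \<bar>\<phi> x\<bar> \<le> B1" "\<forall>x\<in>{0..l}. \<bar>\<phi>' x\<bar> \<le> B2"
    unfolding bounded_iff by (metis image_eqI real_norm_def)
  show ?thesis
  proof (rule that[of "\<bar>B1\<bar> + \<bar>B2\<bar> + 1"])
    fix x
    have "\<bar>\<phi> x\<bar> \<le> B1 \<and> \<bar>\<phi>' x\<bar> \<le> B2 \<or> \<phi> x = 0 \<and> \<phi>' x = 0"
      using B tstD(4)[OF assms, of x] tst_deriv_outside[OF assms, of x]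
      by (cases "x \<in> {0<..<l}") auto
    then show "\<bar>\<phi> x\<bar> \<le> \<bar>B1\<bar> + \<bar>B2\<bar> + 1" "\<bar>\<phi>' x\<bar> \<le> \<bar>B1\<bar> + \<bar>B2\<bar> + 1"
      by linarith+
  qed simp
qed

lemma integrable_mult_bounded:
  fixes f g :: "'a \<Rightarrow> real"
  assumes "integrable M f" "g \<in> borel_measurable M" "\<And>x. x \<in> space M \<Longrightarrow> \<bar>g x\<bar> \<le> B"
  shows "integrable M (\<lambda>x. f x * g x)"
proof (rule Bochner_Integration.integrable_bound[of M "\<lambda>x. \<bar>B\<bar> * f x"])
  show "AE x in M. norm (f x * g x) \<le> norm (\<bar>B\<bar> * f x)"
  proof (rule AE_I2)
    fix x assume "x \<in> space M"
    then have "\<bar>g x\<bar> * \<bar>f x\<bar> \<le> \<bar>B\<bar> * \<bar>f x\<bar>"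
      using assms(3)[of x] by (intro mult_right_mono) auto
    then show "norm (f x * g x) \<le> norm (\<bar>B\<bar> * f x)"
      by (simp add: abs_mult mult.commute)
  qed
qed (use assms in auto)

text \<open>The L^1 norm is the pairing with the sign of f, which \<open>tst_approx\<close> replaces
  by test functions. Its bound \<open>M + 1\<close> with M = 1 is the 2 that reappears in
  \<open>L1n_le\<close> and in the contraction estimate of \<open>z_eq_y\<close>.\<close>

lemma sgn_dual_approx:
  assumes l: "0 < l" and f: "integrable (seg l) f"
  obtains \<phi> \<phi>' where "\<And>n::nat. tst l (\<phi> n) (\<phi>' n)" "\<And>n x. \<bar>\<phi> n x\<bar> \<le> 2"
    "(\<lambda>n. \<integral>x. f x * \<phi> n x \<partial>seg l) \<longlonglongrightarrow> (\<integral>x. \<bar>f x\<bar> \<partial>seg l)"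
proof -
  let ?s = "\<lambda>x. sgn (indicator {0<..<l} x * f x)"
  have "(\<lambda>x. indicator {0<..<l} x * f x) \<in> borel_measurable borel"
    using f borel_measurable_integrable measurable_seg_iff by blast
  then have m: "?s \<in> borel_measurable borel" by measurable
  obtain \<phi> \<phi>' where \<phi>: "\<And>n::nat. tst l (\<phi> n) (\<phi>' n)" "\<And>n x. \<bar>\<phi> n x\<bar> \<le> 1 + 1"
    "AE x in seg l. (\<lambda>n. \<phi> n x) \<longlonglongrightarrow> ?s x"
    by (rule tst_approx[OF l m, of 1]) (auto simp: sgn_if)
  have "(\<lambda>n. \<integral>x. f x * \<phi> n x \<partial>seg l) \<longlonglongrightarrow> (\<integral>x. f x * ?s x \<partial>seg l)"
  proof (rule integral_dominated_convergence[where w = "\<lambda>x. 2 * \<bar>f x\<bar>"])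
    show "AE x in seg l. (\<lambda>n. f x * \<phi> n x) \<longlonglongrightarrow> f x * ?s x"
      using \<phi>(3) by eventually_elim (intro tendsto_intros)
    fix n
    show "AE x in seg l. norm (f x * \<phi> n x) \<le> 2 * \<bar>f x\<bar>"
      using \<phi>(2)[of n] by (intro AE_I2) (auto simp: abs_mult mult.commute[of 2] intro!: mult_left_mono)
    show "(\<lambda>x. f x * \<phi> n x) \<in> borel_measurable (seg l)"
      using borel_measurable_integrable[OF f] measurable_seg_borel[OF tstD(5)[OF \<phi>(1)[of n]]]
      by (rule borel_measurable_times)
  next
    show "(\<lambda>x. f x * ?s x) \<in> borel_measurable (seg l)"
      using borel_measurable_integrable[OF f] measurable_seg_borel[OF m]
      by (rule borel_measurable_times)
  qed (use f in auto)
  also have "(\<integral>x. f x * ?s x \<partial>seg l) = (\<integral>x. \<bar>f x\<bar> \<partial>seg l)"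
    by (rule Bochner_Integration.integral_cong) (auto simp: sgn_if)
  finally show ?thesis
    using \<phi> by (intro that) auto
qed

text \<open>The pairings that approximate the L^1 norm all vanish, hence so does the norm.\<close>

lemma fundamental_lemma:
  assumes l: "0 < l" and f: "integrable (seg l) f"
    and z: "\<And>\<phi> \<phi>'. tst l \<phi> \<phi>' \<Longrightarrow> (\<integral>x. f x * \<phi> x \<partial>seg l) = 0"
  shows "AE x in seg l. f x = 0"
proof -
  obtain \<phi> \<phi>' where \<phi>: "\<And>n::nat. tst l (\<phi> n) (\<phi>' n)"
    "(\<lambda>n. \<integral>x. f x * \<phi> n x \<partial>seg l) \<longlonglongrightarrow> (\<integral>x. \<bar>f x\<bar> \<partial>seg l)"
    using sgn_dual_approx[OF l f] by metis
  then have "(\<integral>x. \<bar>f x\<bar> \<partial>seg l) = 0"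
    using z[OF \<phi>(1)] by (simp add: LIMSEQ_const_iff)
  then show ?thesis
    using f by (subst (asm) integral_nonneg_eq_0_iff_AE) auto
qed

lemma lpn_tendsto_0:
  assumes "1 \<le> p" "(\<lambda>n. \<integral>x. \<bar>f n x\<bar> powr p \<partial>seg l) \<longlonglongrightarrow> 0"
  shows "(\<lambda>n. lpn p l (f n)) \<longlonglongrightarrow> 0"
proof -
  have "(\<lambda>n. (\<integral>x. \<bar>f n x\<bar> powr p \<partial>seg l) powr (1 / p)) \<longlonglongrightarrow> 0 powr (1 / p)"
    using assms by (intro tendsto_powr') auto
  then show ?thesis by (simp add: lpn_def)
qed

lemma tst_Lp:
  assumes "1 \<le> p" "tst l \<phi> \<phi>'"
  shows "\<phi> \<in> Lp p l" "\<phi>' \<in> Lp p l"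
proof -
  obtain B where "\<And>x. \<bar>\<phi> x\<bar> \<le> B" "\<And>x. \<bar>\<phi>' x\<bar> \<le> B"
    using tst_bounded[OF assms(2)] by metis
  then show "\<phi> \<in> Lp p l" "\<phi>' \<in> Lp p l"
    using tstD[OF assms(2)] assms(1) by (auto intro!: Lp_bounded[where B = B] measurable_seg_borel)
qed

text \<open>Two approximations of half the error each: truncation at height n, dominated by |f|^p,
  and then \<open>tst_approx\<close> for the truncated function, dominated by a constant because the
  segment has finite measure.\<close>

lemma tst_dense:
  assumes p: "1 \<le> p" and l: "0 < l" and f: "f \<in> Lp p l" and e: "0 < e"
  obtains \<phi> \<phi>' where "tst l \<phi> \<phi>'" "lpn p l (\<lambda>x. f x - \<phi> x) < e"
proof -
  let ?f = "\<lambda>x. indicator {0<..<l} x * f x"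
  have mf: "?f \<in> borel_measurable borel"
    using LpD(1)[OF f] measurable_seg_iff by blast
  define c where "c n x = max (- real n) (min (real n) (?f x))" for n x
  have cm: "c n \<in> borel_measurable borel" for n
    unfolding c_def using mf by measurable
  have cb: "\<bar>c n x\<bar> \<le> real n" for n x
    by (auto simp: c_def)
  have cL: "c n \<in> Lp p l" for n
    using cm cb p by (auto intro!: Lp_bounded[where B = "real n"] measurable_seg_borel)
  have "(\<lambda>n. \<integral>x. \<bar>f x - c n x\<bar> powr p \<partial>seg l) \<longlonglongrightarrow> (\<integral>x. 0 \<partial>seg l)"
  proof (rule integral_dominated_convergence[where w = "\<lambda>x. \<bar>f x\<bar> powr p"])
    show "integrable (seg l) (\<lambda>x. \<bar>f x\<bar> powr p)" by (rule LpD(2)[OF f])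
    show "(\<lambda>x. \<bar>f x - c n x\<bar> powr p) \<in> borel_measurable (seg l)" for n
      using LpD(2)[OF Lp_diff[OF p f cL[of n]]] by auto
    show "AE x in seg l. (\<lambda>n. \<bar>f x - c n x\<bar> powr p) \<longlonglongrightarrow> 0"
    proof (rule AE_I2)
      fix x assume x: "x \<in> space (seg l)"
      obtain k where k: "\<bar>f x\<bar> \<le> real k" using real_arch_simple by blast
      have "f x - c n x = 0" if "k \<le> n" for n
      proof -
        have "\<bar>f x\<bar> \<le> real n" using k that by linarith
        then show ?thesis using x by (auto simp: c_def)
      qed
      then show "(\<lambda>n. \<bar>f x - c n x\<bar> powr p) \<longlonglongrightarrow> 0"
        using p by (intro tendsto_eventually eventually_sequentiallyI[of k]) auto
    qed
    show "AE x in seg l. norm (\<bar>f x - c n x\<bar> powr p) \<le> \<bar>f x\<bar> powr p" for n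
      using p by (intro AE_I2) (auto simp: c_def intro!: powr_mono2)
  qed simp
  then have "(\<lambda>n. lpn p l (\<lambda>x. f x - c n x)) \<longlonglongrightarrow> 0"
    by (intro lpn_tendsto_0 p) simp
  then have "eventually (\<lambda>n. lpn p l (\<lambda>x. f x - c n x) < e / 2) sequentially"
    using e by (intro order_tendstoD(2)[of _ 0]) auto
  then obtain n where n: "lpn p l (\<lambda>x. f x - c n x) < e / 2"
    by (auto simp: eventually_sequentially)
  obtain \<phi> \<phi>' where \<phi>: "\<And>k::nat. tst l (\<phi> k) (\<phi>' k)" "\<And>k x. \<bar>\<phi> k x\<bar> \<le> real n + 1"
    "AE x in seg l. (\<lambda>k. \<phi> k x) \<longlonglongrightarrow> c n x"
    by (rule tst_approx[OF l cm[of n] cb[of n]]) (blast intro: that)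
  have "(\<lambda>k. \<integral>x. \<bar>c n x - \<phi> k x\<bar> powr p \<partial>seg l) \<longlonglongrightarrow> (\<integral>x. 0 \<partial>seg l)"
  proof (rule integral_dominated_convergence[where w = "\<lambda>x. (2 * real n + 1) powr p"])
    show "AE x in seg l. (\<lambda>k. \<bar>c n x - \<phi> k x\<bar> powr p) \<longlonglongrightarrow> 0"
      using \<phi>(3)
    proof eventually_elim
      case (elim x)
      have "(\<lambda>k. \<bar>c n x - \<phi> k x\<bar> powr p) \<longlonglongrightarrow> \<bar>c n x - c n x\<bar> powr p"
        using p by (intro tendsto_powr' tendsto_intros elim) auto
      then show ?case by simp
    qed
    fix k
    show "(\<lambda>x. \<bar>c n x - \<phi> k x\<bar> powr p) \<in> borel_measurable (seg l)"
      using LpD(2)[OF Lp_diff[OF p cL[of n] tst_Lp(1)[OF p \<phi>(1)[of k]]]] by auto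
    have "\<bar>c n x - \<phi> k x\<bar> \<le> 2 * real n + 1" for x
      using cb[of n x] \<phi>(2)[of k x] by linarith
    then show "AE x in seg l. norm (\<bar>c n x - \<phi> k x\<bar> powr p) \<le> (2 * real n + 1) powr p"
      using p by (intro AE_I2) (auto intro!: powr_mono2)
  qed simp_all
  then have "(\<lambda>k. lpn p l (\<lambda>x. c n x - \<phi> k x)) \<longlonglongrightarrow> 0"
    by (intro lpn_tendsto_0 p) simp
  then have "eventually (\<lambda>k. lpn p l (\<lambda>x. c n x - \<phi> k x) < e / 2) sequentially"
    using e by (intro order_tendstoD(2)[of _ 0]) auto
  then obtain k where k: "lpn p l (\<lambda>x. c n x - \<phi> k x) < e / 2"
    by (auto simp: eventually_sequentially)
  have "lpn p l (\<lambda>x. f x - \<phi> k x) = lpn p l (\<lambda>x. (f x - c n x) + (c n x - \<phi> k x))"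
    by simp
  also have "\<dots> \<le> lpn p l (\<lambda>x. f x - c n x) + lpn p l (\<lambda>x. c n x - \<phi> k x)"
    by (intro lpn_triangle p Lp_diff f cL tst_Lp(1)[OF p \<phi>(1)])
  also have "\<dots> < e" using n k by simp
  finally show ?thesis
    using \<phi>(1)[of k] by (intro that)
qed

section \<open>The product space, its norms and its pairing with bounded functions\<close>

locale state_space =
  fixes p :: real and N :: nat and L :: "nat \<Rightarrow> real"
  assumes p: "1 \<le> p" and N: "1 \<le> N" and L: "\<And>i. i \<in> {1..N} \<Longrightarrow> 0 < L i"
begin

abbreviation "X \<equiv> Xp p N L"

text \<open>Takes the place of \<open>Xnorm\<close>, to which it is equivalent by
  \<open>Xnorm_le\<close> and \<open>NX_le\<close>, because the laws of a norm pass to it component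
  by component.\<close>

definition NX :: "state \<Rightarrow> real" where "NX u = (\<Sum>i=1..N. lpn p (L i) (u i))"

definition pair :: "state \<Rightarrow> state \<Rightarrow> real" where
  "pair u \<phi> = (\<Sum>i=1..N. \<integral>x. u i x * \<phi> i x \<partial>seg (L i))"

definition L1n :: "state \<Rightarrow> real" where "L1n u = (\<Sum>i=1..N. \<integral>x. \<bar>u i x\<bar> \<partial>seg (L i))"

text \<open>A constant for the embedding of the state space into L^1 that serves all components; the
  summand \<open>L i + 1\<close> is the constant of \<open>Lp_L1\<close>.\<close>

definition Ctot :: real where "Ctot = (\<Sum>i=1..N. L i + 1)"

lemma Ctot: "i \<in> {1..N} \<Longrightarrow> L i + 1 \<le> Ctot" "1 \<le> Ctot" "0 \<le> Ctot"
proof -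
  show *: "L i + 1 \<le> Ctot" if "i \<in> {1..N}" for i
    unfolding Ctot_def using that L by (intro member_le_sum) (force intro: less_imp_le add_pos_pos)+
  have "L 1 + 1 \<le> Ctot" "0 < L 1"
    using *[of 1] L[of 1] N by auto
  then show "1 \<le> Ctot" "0 \<le> Ctot" by linarith+
qed

lemma XD: "u \<in> X \<Longrightarrow> i \<in> {1..N} \<Longrightarrow> u i \<in> Lp p (L i)"
  by (auto simp: Xp_def)

lemma X_add: "u \<in> X \<Longrightarrow> v \<in> X \<Longrightarrow> u + v \<in> X"
  using Lp_add[OF p] by (auto simp: Xp_def plus_fun_def)

lemma X_diff: "u \<in> X \<Longrightarrow> v \<in> X \<Longrightarrow> u - v \<in> X"
  using Lp_diff[OF p] by (auto simp: Xp_def fun_diff_def)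

lemma X_scale: "u \<in> X \<Longrightarrow> scale c u \<in> X"
  using Lp_scale by (auto simp: Xp_def scale_def)

lemma X_zero: "0 \<in> X"
  using p by (auto simp: Xp_def zero_fun_def intro!: Lp_bounded[where B = 0])

lemma X_sum: "finite I \<Longrightarrow> (\<And>i. i \<in> I \<Longrightarrow> f i \<in> X) \<Longrightarrow> (\<Sum>i\<in>I. f i) \<in> X"
  by (induction I rule: finite_induct) (auto intro: X_add X_zero)

lemma NX_nonneg [simp]: "0 \<le> NX u"
  by (simp add: NX_def sum_nonneg)

lemma NX_triangle: "u \<in> X \<Longrightarrow> v \<in> X \<Longrightarrow> NX (u + v) \<le> NX u + NX v"
  unfolding NX_def plus_fun_def sum.distrib[symmetric]
  by (intro sum_mono lpn_triangle p XD)

lemma NX_scale: "NX (scale c u) = \<bar>c\<bar> * NX u"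
  unfolding NX_def scale_def by (simp add: lpn_scale p sum_distrib_left)

lemma NX_diff_swap: "NX (u - v) = NX (v - u)"
  unfolding NX_def lpn_def fun_diff_def by (simp add: abs_minus_commute)

lemma NX_diff_triangle: "u \<in> X \<Longrightarrow> v \<in> X \<Longrightarrow> NX (u - v) \<le> NX u + NX v"
  using NX_triangle[of u "scale (-1) v"] NX_scale[of "-1" v] X_scale[of v "-1"]
  by (simp add: scale_def plus_fun_def fun_diff_def)

lemma NX_triangle3: "u \<in> X \<Longrightarrow> v \<in> X \<Longrightarrow> w \<in> X \<Longrightarrow> NX (u - w) \<le> NX (u - v) + NX (v - w)"
  using NX_triangle[of "u - v" "v - w"] X_diff by simp

lemma XeqD: "Xeq N L u v \<Longrightarrow> i \<in> {1..N} \<Longrightarrow> AE x in seg (L i). u i x = v i x"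
  by (auto simp: Xeq_def)

lemma Xeq_refl [simp]: "Xeq N L u u"
  by (simp add: Xeq_def)

lemma Xeq_sym: "Xeq N L u v \<Longrightarrow> Xeq N L v u"
  unfolding Xeq_def by (intro ballI) (drule (1) bspec, erule eventually_mono, simp)

lemma Xeq_trans: "Xeq N L u v \<Longrightarrow> Xeq N L v w \<Longrightarrow> Xeq N L u w"
  unfolding Xeq_def
  by (intro ballI) (drule (1) bspec, drule (1) bspec, erule (1) eventually_elim2, simp)

lemma Xeq_add: "Xeq N L u v \<Longrightarrow> Xeq N L u' v' \<Longrightarrow> Xeq N L (u + u') (v + v')"
  unfolding Xeq_def plus_fun_def
  by (intro ballI) (drule (1) bspec, drule (1) bspec, erule (1) eventually_elim2, simp)

lemma Xeq_diff: "Xeq N L u v \<Longrightarrow> Xeq N L u' v' \<Longrightarrow> Xeq N L (u - u') (v - v')"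
  unfolding Xeq_def fun_diff_def
  by (intro ballI) (drule (1) bspec, drule (1) bspec, erule (1) eventually_elim2, simp)

lemma Xeq_scale: "Xeq N L u v \<Longrightarrow> Xeq N L (scale c u) (scale c v)"
  unfolding Xeq_def scale_def by (intro ballI) (drule (1) bspec, erule eventually_mono, simp)

lemma NX_cong: "u \<in> X \<Longrightarrow> v \<in> X \<Longrightarrow> Xeq N L u v \<Longrightarrow> NX u = NX v"
  unfolding NX_def by (intro sum.cong lpn_cong_AE LpD(1)[OF XD] XeqD refl)

lemma NX_zero [simp]: "NX 0 = 0"
  using p by (simp add: NX_def lpn_def zero_fun_def)

lemma Xnorm_eq: "Xnorm p N L u = (\<Sum>i=1..N. lpn p (L i) (u i) powr p) powr (1 / p)"
  by (simp add: Xnorm_def lpn_powr p)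

text \<open>Every component norm is at most \<open>NX u\<close>, so the p-th powers add up to at
  most N times its power, and N <= N^p since p >= 1.\<close>

lemma Xnorm_le: "Xnorm p N L u \<le> real N * NX u"
proof -
  have "lpn p (L i) (u i) \<le> NX u" if "i \<in> {1..N}" for i
    unfolding NX_def using that by (intro member_le_sum) auto
  then have "(\<Sum>i=1..N. lpn p (L i) (u i) powr p) \<le> (\<Sum>i=1..N. NX u powr p)"
    using p by (intro sum_mono powr_mono2) auto
  also have "\<dots> = real N powr 1 * NX u powr p" using N by simp
  also have "\<dots> \<le> real N powr p * NX u powr p"
    using N p by (intro mult_right_mono powr_mono) auto
  finally have "Xnorm p N L u \<le> ((real N * NX u) powr p) powr (1 / p)"
    unfolding Xnorm_eq using p by (intro powr_mono2) (auto simp: powr_mult intro!: sum_nonneg)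
  also have "\<dots> = real N * NX u" using p by (simp add: powr_powr)
  finally show ?thesis .
qed

lemma NX_le: "NX u \<le> real N * Xnorm p N L u"
proof -
  have "lpn p (L i) (u i) \<le> Xnorm p N L u" if "i \<in> {1..N}" for i
  proof -
    have "(lpn p (L i) (u i) powr p) powr (1 / p) \<le> Xnorm p N L u"
      unfolding Xnorm_eq using that p by (intro powr_mono2 member_le_sum) auto
    then show ?thesis using p by (simp add: powr_powr)
  qed
  from sum_mono[of "{1..N}", OF this] show ?thesis
    by (simp add: NX_def)
qed

lemma X_L1:
  assumes "u \<in> X"
  shows "\<And>i. i \<in> {1..N} \<Longrightarrow> integrable (seg (L i)) (u i)" "L1n u \<le> Ctot * NX u"
proof -
  show "\<And>i. i \<in> {1..N} \<Longrightarrow> integrable (seg (L i)) (u i)"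
    using XD[OF assms] p L by (intro Lp_L1(1)[OF p]) (auto intro: less_imp_le)
  have "(\<integral>x. \<bar>u i x\<bar> \<partial>seg (L i)) \<le> Ctot * lpn p (L i) (u i)" if "i \<in> {1..N}" for i
    using Lp_L1(2)[OF p _ XD[OF assms that]] L[OF that] Ctot(1)[OF that]
    by (meson less_imp_le lpn_nonneg mult_right_mono order_trans)
  then show "L1n u \<le> Ctot * NX u"
    unfolding L1n_def NX_def sum_distrib_left by (intro sum_mono)
qed

lemma pair_integrable:
  assumes "\<And>i. i \<in> {1..N} \<Longrightarrow> integrable (seg (L i)) (u i)" "i \<in> {1..N}"
    "\<phi> i \<in> borel_measurable borel" "\<And>x. x \<in> {0<..<L i} \<Longrightarrow> \<bar>\<phi> i x\<bar> \<le> (B::real)"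
  shows "integrable (seg (L i)) (\<lambda>x. u i x * \<phi> i x)"
  using assms by (intro integrable_mult_bounded[where B = B] measurable_seg_borel) auto

lemma pair_L1_bound:
  assumes u: "\<And>i. i \<in> {1..N} \<Longrightarrow> integrable (seg (L i)) (u i)"
    and m: "\<And>i. i \<in> {1..N} \<Longrightarrow> \<phi> i \<in> borel_measurable borel"
    and B: "\<And>i x. i \<in> {1..N} \<Longrightarrow> x \<in> {0<..<L i} \<Longrightarrow> \<bar>\<phi> i x\<bar> \<le> (B::real)"
  shows "\<bar>pair u \<phi>\<bar> \<le> B * L1n u"
proof -
  have "\<bar>pair u \<phi>\<bar> \<le> (\<Sum>i=1..N. \<bar>\<integral>x. u i x * \<phi> i x \<partial>seg (L i)\<bar>)"
    unfolding pair_def by (rule sum_abs)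
  also have "\<dots> \<le> (\<Sum>i=1..N. \<integral>x. B * \<bar>u i x\<bar> \<partial>seg (L i))"
  proof (rule sum_mono)
    fix i assume i: "i \<in> {1..N}"
    show "\<bar>\<integral>x. u i x * \<phi> i x \<partial>seg (L i)\<bar> \<le> (\<integral>x. B * \<bar>u i x\<bar> \<partial>seg (L i))"
    proof (rule integral_abs_bound_integral)
      show "integrable (seg (L i)) (\<lambda>x. u i x * \<phi> i x)"
        by (rule pair_integrable[of u i \<phi> B]) (use u i m B in auto)
      show "integrable (seg (L i)) (\<lambda>x. B * \<bar>u i x\<bar>)"
        using u[OF i] by auto
      show "\<bar>u i x * \<phi> i x\<bar> \<le> B * \<bar>u i x\<bar>" if "x \<in> space (seg (L i))" for x
        using B[OF i, of x] that by (auto simp: abs_mult mult.commute[of B] intro!: mult_left_mono)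
    qed
  qed
  also have "\<dots> = B * L1n u"
    by (simp add: L1n_def sum_distrib_left)
  finally show ?thesis .
qed

lemma pair_bound:
  assumes "u \<in> X" "\<And>i. i \<in> {1..N} \<Longrightarrow> \<phi> i \<in> borel_measurable borel"
    "\<And>i x. i \<in> {1..N} \<Longrightarrow> x \<in> {0<..<L i} \<Longrightarrow> \<bar>\<phi> i x\<bar> \<le> B" "0 \<le> B"
  shows "\<bar>pair u \<phi>\<bar> \<le> B * Ctot * NX u"
  using pair_L1_bound[of u \<phi> B, OF X_L1(1)[OF assms(1)] assms(2,3)]
    mult_left_mono[OF X_L1(2)[OF assms(1)] assms(4)] by (simp add: mult.assoc)

definition bmeas :: "state \<Rightarrow> bool" where
  "bmeas \<phi> \<longleftrightarrow> (\<forall>i\<in>{1..N}. \<phi> i \<in> borel_measurable borel) \<and>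
     (\<exists>B. \<forall>i\<in>{1..N}. \<forall>x\<in>{0<..<L i}. \<bar>\<phi> i x\<bar> \<le> B)"

lemma bmeas_integrable:
  assumes "bmeas \<phi>" "\<And>i. i \<in> {1..N} \<Longrightarrow> integrable (seg (L i)) (u i)" "i \<in> {1..N}"
  shows "integrable (seg (L i)) (\<lambda>x. u i x * \<phi> i x)"
  using assms unfolding bmeas_def by (auto intro!: pair_integrable)

lemma pair_add_left:
  assumes "bmeas \<phi>" "u \<in> X" "v \<in> X"
  shows "pair (u + v) \<phi> = pair u \<phi> + pair v \<phi>"
  unfolding pair_def sum.distrib[symmetric]
  using bmeas_integrable[OF assms(1) X_L1(1)[OF assms(2)]] bmeas_integrable[OF assms(1) X_L1(1)[OF assms(3)]]
  by (intro sum.cong) (auto simp: plus_fun_def distrib_right)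

lemma pair_scale_left: "pair (scale c u) \<phi> = c * pair u \<phi>"
  by (simp add: pair_def scale_def sum_distrib_left mult.assoc)

lemma pair_diff_left:
  assumes "bmeas \<phi>" "u \<in> X" "v \<in> X"
  shows "pair (u - v) \<phi> = pair u \<phi> - pair v \<phi>"
  unfolding pair_def sum_subtractf[symmetric]
  using bmeas_integrable[OF assms(1) X_L1(1)[OF assms(2)]] bmeas_integrable[OF assms(1) X_L1(1)[OF assms(3)]]
  by (intro sum.cong) (auto simp: fun_diff_def left_diff_distrib)

lemma pair_cong:
  assumes "bmeas \<phi>" "u \<in> X" "v \<in> X" "Xeq N L u v"
  shows "pair u \<phi> = pair v \<phi>"
  unfolding pair_def
proof (rule sum.cong[OF refl])
  fix i assume i: "i \<in> {1..N}"
  have \<phi>: "\<phi> i \<in> borel_measurable (seg (L i))"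
    using assms(1) i by (auto simp: bmeas_def intro: measurable_seg_borel)
  show "(\<integral>x. u i x * \<phi> i x \<partial>seg (L i)) = (\<integral>x. v i x * \<phi> i x \<partial>seg (L i))"
    using \<phi> LpD(1)[OF XD[OF assms(2) i]] LpD(1)[OF XD[OF assms(3) i]] XeqD[OF assms(4) i]
    by (intro integral_cong_AE) (auto elim: eventually_mono)
qed

definition tests :: "state \<Rightarrow> state \<Rightarrow> bool" where
  "tests \<phi> \<phi>' \<longleftrightarrow> (\<forall>i\<in>{1..N}. tst (L i) (\<phi> i) (\<phi>' i))"

lemma tests_bounded:
  assumes "tests \<phi> \<phi>'"
  obtains B where "0 < B" "\<And>i x. i \<in> {1..N} \<Longrightarrow> \<bar>\<phi> i x\<bar> \<le> B" "\<And>i x. i \<in> {1..N} \<Longrightarrow> \<bar>\<phi>' i x\<bar> \<le> B"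
proof -
  have "\<exists>B>0. (\<forall>x. \<bar>\<phi> i x\<bar> \<le> B) \<and> (\<forall>x. \<bar>\<phi>' i x\<bar> \<le> B)" if "i \<in> {1..N}" for i
    using tst_bounded[of "L i" "\<phi> i" "\<phi>' i"] assms that unfolding tests_def by metis
  then obtain B where B: "\<And>i. i \<in> {1..N} \<Longrightarrow> 0 < B i"
    "\<And>i x. i \<in> {1..N} \<Longrightarrow> \<bar>\<phi> i x\<bar> \<le> B i" "\<And>i x. i \<in> {1..N} \<Longrightarrow> \<bar>\<phi>' i x\<bar> \<le> B i"
    by metis
  have le: "B i \<le> (\<Sum>i=1..N. B i)" if "i \<in> {1..N}" for i
    using that B(1) by (intro member_le_sum) (auto intro: less_imp_le)
  have "1 \<in> {1..N}" using N by simp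
  from B(1)[OF this] le[OF this] have pos: "0 < (\<Sum>i=1..N. B i)" by (rule less_le_trans)
  show ?thesis
    by (rule that[of "\<Sum>i=1..N. B i", OF pos order_trans[OF B(2) le] order_trans[OF B(3) le]])
qed

text \<open>Estimates the L^1 norm from pairings with test functions, which are the functions the
  adjoint flow acts on. The approximations of the signs of the components share the index n, so that
  together they form one test state bounded by 2.\<close>

lemma L1n_le:
  assumes u: "\<And>i. i \<in> {1..N} \<Longrightarrow> integrable (seg (L i)) (u i)"
    and B: "\<And>\<phi> \<phi>'. tests \<phi> \<phi>' \<Longrightarrow> (\<And>i x. i \<in> {1..N} \<Longrightarrow> \<bar>\<phi> i x\<bar> \<le> 2) \<Longrightarrow> pair u \<phi> \<le> B"
  shows "L1n u \<le> B"
proof -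
  define P where "P i \<phi> \<longleftrightarrow> (\<exists>\<phi>'. \<forall>n::nat. tst (L i) (\<phi> n) (\<phi>' n)) \<and> (\<forall>n x. \<bar>\<phi> n x\<bar> \<le> 2) \<and>
    (\<lambda>n. \<integral>x. u i x * \<phi> n x \<partial>seg (L i)) \<longlonglongrightarrow> (\<integral>x. \<bar>u i x\<bar> \<partial>seg (L i))" for i \<phi>
  have "\<exists>\<phi>. P i \<phi>" if "i \<in> {1..N}" for i
    using sgn_dual_approx[OF L[OF that] u[OF that]] unfolding P_def by metis
  then obtain \<phi> where "\<And>i. i \<in> {1..N} \<Longrightarrow> P i (\<phi> i)"
    by metis
  then have \<phi>: "\<And>i. i \<in> {1..N} \<Longrightarrow> \<exists>\<phi>'. \<forall>n. tst (L i) (\<phi> i n) (\<phi>' n)"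
    "\<And>i n x. i \<in> {1..N} \<Longrightarrow> \<bar>\<phi> i n x\<bar> \<le> 2"
    "\<And>i. i \<in> {1..N} \<Longrightarrow> (\<lambda>n. \<integral>x. u i x * \<phi> i n x \<partial>seg (L i)) \<longlonglongrightarrow> (\<integral>x. \<bar>u i x\<bar> \<partial>seg (L i))"
    by (auto simp: P_def)
  obtain \<phi>' where \<phi>': "\<And>i n. i \<in> {1..N} \<Longrightarrow> tst (L i) (\<phi> i n) (\<phi>' i n)"
    using \<phi>(1) by metis
  have lim: "(\<lambda>n. pair u (\<lambda>i. \<phi> i n)) \<longlonglongrightarrow> L1n u"
    unfolding pair_def L1n_def by (intro tendsto_sum \<phi>(3))
  have "pair u (\<lambda>i. \<phi> i n) \<le> B" for n
    by (rule B[of _ "\<lambda>i. \<phi>' i n"]) (auto simp: tests_def \<phi>(2) \<phi>')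
  then show ?thesis
    using LIMSEQ_le_const2[OF lim] by blast
qed

lemma Xeq_zero_if_L1n_zero:
  assumes u: "\<And>i. i \<in> {1..N} \<Longrightarrow> integrable (seg (L i)) (u i)"
    and "L1n u \<le> 0"
  shows "Xeq N L u 0"
  unfolding Xeq_def
proof
  fix i assume i: "i \<in> {1..N}"
  have nn: "0 \<le> (\<integral>x. \<bar>u j x\<bar> \<partial>seg (L j))" for j by simp
  have "(\<integral>x. \<bar>u i x\<bar> \<partial>seg (L i)) \<le> L1n u"
    unfolding L1n_def using i nn by (intro member_le_sum) auto
  then have "(\<integral>x. \<bar>u i x\<bar> \<partial>seg (L i)) = 0"
    using assms(2) nn[of i] by linarith
  then show "AE x in seg (L i). u i x = (0::state) i x"
    using u[OF i] by (subst (asm) integral_nonneg_eq_0_iff_AE) (auto simp: zero_fun_def)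
qed

lemma tests_X: "tests \<phi> \<phi>' \<Longrightarrow> \<phi> \<in> X" "tests \<phi> \<phi>' \<Longrightarrow> \<phi>' \<in> X"
  using tst_Lp[OF p] by (auto simp: tests_def Xp_def)

lemma tests_dense:
  assumes "u \<in> X" "0 < e"
  obtains \<phi> \<phi>' where "tests \<phi> \<phi>'" "NX (u - \<phi>) < e"
proof -
  have "\<exists>\<phi> \<phi>'. tst (L i) \<phi> \<phi>' \<and> lpn p (L i) (\<lambda>x. u i x - \<phi> x) < e / real N" if "i \<in> {1..N}" for i
  proof -
    have "0 < e / real N" using assms(2) N by simp
    then show ?thesis
      using tst_dense[OF p L[OF that] XD[OF assms(1) that], of "e / real N"] by metis
  qed
  then obtain \<phi> \<phi>' where \<phi>: "\<And>i. i \<in> {1..N} \<Longrightarrow> tst (L i) (\<phi> i) (\<phi>' i)"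
    "\<And>i. i \<in> {1..N} \<Longrightarrow> lpn p (L i) (\<lambda>x. u i x - \<phi> i x) < e / real N"
    by metis
  have "NX (u - \<phi>) < (\<Sum>i=1..N. e / real N)"
    unfolding NX_def fun_diff_def using N by (intro sum_strict_mono \<phi>) auto
  then have "NX (u - \<phi>) < e" using N by simp
  with \<phi>(1) show ?thesis
    by (intro that[of \<phi> \<phi>']) (auto simp: tests_def)
qed

end

section \<open>The semigroup\<close>

context state_space
begin

lemma NX_zero_imp_Xeq:
  assumes "u \<in> X" "NX u = 0"
  shows "Xeq N L u 0"
  using assms X_L1[of u] by (intro Xeq_zero_if_L1n_zero) auto

lemma Xeq_iff_diff: "Xeq N L u v \<longleftrightarrow> Xeq N L (u - v) 0"
  unfolding Xeq_def by (simp add: fun_diff_def zero_fun_def)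

lemma lpn_le_NX: "i \<in> {1..N} \<Longrightarrow> lpn p (L i) (u i) \<le> NX u"
  unfolding NX_def by (intro member_le_sum) auto

lemma X_complete:
  assumes x: "\<And>n. x n \<in> X"
    and \<epsilon>: "\<And>n. NX (x (Suc n) - x n) \<le> \<epsilon> n" "\<And>n. \<epsilon> (Suc n) \<le> \<epsilon> n / 2"
  obtains y where "y \<in> X" "\<And>n. NX (y - x n) \<le> 2 * real N * \<epsilon> n"
proof -
  have "\<exists>y. y \<in> Lp p (L i) \<and> (\<forall>n. lpn p (L i) (\<lambda>t. y t - x n i t) \<le> 2 * \<epsilon> n)" if i: "i \<in> {1..N}" for i
  proof -
    have "lpn p (L i) (\<lambda>t. x (Suc n) i t - x n i t) \<le> \<epsilon> n" for n
      using lpn_le_NX[OF i, of "x (Suc n) - x n"] \<epsilon>(1)[of n] by (simp add: fun_diff_def)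
    then show ?thesis
      using Lp_complete[of p "L i" "\<lambda>n. x n i" \<epsilon>] p L[OF i] XD[OF x i] \<epsilon>(2)
      by (metis less_imp_le)
  qed
  then obtain y where y: "\<And>i. i \<in> {1..N} \<Longrightarrow> y i \<in> Lp p (L i)"
    "\<And>i n. i \<in> {1..N} \<Longrightarrow> lpn p (L i) (\<lambda>t. y i t - x n i t) \<le> 2 * \<epsilon> n"
    by metis
  show ?thesis
  proof (rule that[of y])
    show "y \<in> X" using y(1) by (auto simp: Xp_def)
    fix n
    have "NX (y - x n) \<le> (\<Sum>i=1..N. 2 * \<epsilon> n)"
      unfolding NX_def fun_diff_def by (intro sum_mono y(2))
    then show "NX (y - x n) \<le> 2 * real N * \<epsilon> n" by simp
  qed
qed

end

locale semigroup_on_X = state_space +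
  fixes T :: "real \<Rightarrow> state \<Rightarrow> state"
  assumes c0: "c0_semigroup p N L T"
begin

lemma T_X: "0 \<le> t \<Longrightarrow> u \<in> X \<Longrightarrow> T t u \<in> X"
  using c0 by (auto simp: c0_semigroup_def)

lemma T_lin: "0 \<le> t \<Longrightarrow> u \<in> X \<Longrightarrow> v \<in> X \<Longrightarrow> Xeq N L (T t (scale c u + v)) (scale c (T t u) + T t v)"
  using c0 by (simp only: c0_semigroup_def)

lemma T_0: "u \<in> X \<Longrightarrow> Xeq N L (T 0 u) u"
  using c0 by (auto simp: c0_semigroup_def)

lemma T_sg: "0 \<le> s \<Longrightarrow> 0 \<le> t \<Longrightarrow> u \<in> X \<Longrightarrow> Xeq N L (T (s + t) u) (T s (T t u))"
  using c0 by (simp only: c0_semigroup_def)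

lemma T_bdd:
  assumes "0 \<le> t"
  obtains C where "0 < C" "\<And>u. u \<in> X \<Longrightarrow> NX (T t u) \<le> C * NX u"
proof -
  have "\<forall>t\<ge>0. \<exists>C. \<forall>u\<in>X. Xnorm p N L (T t u) \<le> C * Xnorm p N L u"
    using c0[unfolded c0_semigroup_def] by (elim conjE)
  then obtain C where C: "\<And>u. u \<in> X \<Longrightarrow> Xnorm p N L (T t u) \<le> C * Xnorm p N L u"
    using assms by meson
  \<comment> \<open>One factor N for each passage between \<open>NX\<close> and
    \<open>Xnorm\<close>; the absolute value and the 1 make the constant positive.\<close>
  show ?thesis
  proof (rule that[of "real N * real N * (\<bar>C\<bar> + 1)"])
    show "0 < real N * real N * (\<bar>C\<bar> + 1)" using N by simp
    fix u assume u: "u \<in> X"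
    have nn: "0 \<le> Xnorm p N L u" by (simp add: Xnorm_def)
    have "Xnorm p N L (T t u) \<le> (\<bar>C\<bar> + 1) * Xnorm p N L u"
      using C[OF u] mult_right_mono[OF _ nn, of C "\<bar>C\<bar> + 1"] by linarith
    also have "\<dots> \<le> (\<bar>C\<bar> + 1) * (real N * NX u)"
      by (intro mult_left_mono Xnorm_le) auto
    finally have "real N * Xnorm p N L (T t u) \<le> real N * ((\<bar>C\<bar> + 1) * (real N * NX u))"
      by (intro mult_left_mono) auto
    then show "NX (T t u) \<le> real N * real N * (\<bar>C\<bar> + 1) * NX u"
      using NX_le[of "T t u"] by (simp add: mult_ac)
  qed
qed

lemma Xnorm_lim_iff: "((\<lambda>h. Xnorm p N L (f h)) \<longlongrightarrow> 0) F \<longleftrightarrow> ((\<lambda>h. NX (f h)) \<longlongrightarrow> 0) F"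
proof
  have nn: "0 \<le> Xnorm p N L u" for u by (simp add: Xnorm_def)
  assume "((\<lambda>h. Xnorm p N L (f h)) \<longlongrightarrow> 0) F"
  then have "((\<lambda>h. real N * Xnorm p N L (f h)) \<longlongrightarrow> real N * 0) F" by (intro tendsto_intros)
  then show "((\<lambda>h. NX (f h)) \<longlongrightarrow> 0) F"
    by (intro Lim_null_comparison[of "\<lambda>h. NX (f h)" "\<lambda>h. real N * Xnorm p N L (f h)"])
       (auto intro!: always_eventually NX_le)
next
  have nn: "0 \<le> Xnorm p N L u" for u by (simp add: Xnorm_def)
  assume "((\<lambda>h. NX (f h)) \<longlongrightarrow> 0) F"
  then have "((\<lambda>h. real N * NX (f h)) \<longlongrightarrow> real N * 0) F" by (intro tendsto_intros)
  then show "((\<lambda>h. Xnorm p N L (f h)) \<longlongrightarrow> 0) F"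
    by (intro Lim_null_comparison[of "\<lambda>h. Xnorm p N L (f h)" "\<lambda>h. real N * NX (f h)"])
       (use nn in \<open>auto intro!: always_eventually Xnorm_le\<close>)
qed

lemma T_cont: "u \<in> X \<Longrightarrow> ((\<lambda>t. NX (T t u - u)) \<longlongrightarrow> 0) (at_right 0)"
  using c0 by (simp only: c0_semigroup_def Xnorm_lim_iff)

lemma T_zero: "0 \<le> t \<Longrightarrow> Xeq N L (T t 0) 0"
proof -
  assume t: "0 \<le> t"
  have "scale 1 0 + (0::state) = 0" by (simp add: scale_def fun_eq_iff)
  with T_lin[OF t X_zero X_zero, of 1] have "Xeq N L (T t 0) (scale 1 (T t 0) + T t 0)" by simp
  then show ?thesis
    unfolding Xeq_def
    by (intro ballI) (drule (1) bspec, erule eventually_mono, simp add: scale_def)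
qed

lemma T_scale:
  assumes "0 \<le> t" "u \<in> X"
  shows "Xeq N L (T t (scale c u)) (scale c (T t u))"
proof -
  have "Xeq N L (T t (scale c u)) (scale c (T t u) + T t 0)"
    using T_lin[OF assms X_zero, of c] by simp
  from Xeq_trans[OF this Xeq_add[OF Xeq_refl T_zero[OF assms(1)]]] show ?thesis
    by simp
qed

lemma T_diff: "0 \<le> t \<Longrightarrow> u \<in> X \<Longrightarrow> v \<in> X \<Longrightarrow> Xeq N L (T t (u - v)) (T t u - T t v)"
  using T_lin[of t v u "-1"] by (simp add: scale_def plus_fun_def fun_diff_def)

text \<open>A gliding hump: vectors of rapidly decreasing size on which \<open>T t\<close> is large add up to a vector
  whose orbit is unbounded near time 0.\<close>

lemma T_locally_bounded:
  obtains \<delta> M where "0 < \<delta>" "0 < M" "\<And>t u. 0 \<le> t \<Longrightarrow> t \<le> \<delta> \<Longrightarrow> u \<in> X \<Longrightarrow> NX (T t u) \<le> M * NX u"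
proof (rule ccontr)
  assume neg: "\<not> thesis"
  note witness = that
  have unb: "\<exists>t u. 0 \<le> t \<and> t \<le> \<delta> \<and> u \<in> X \<and> NX (T t u) > M * NX u" if "0 < \<delta>" "0 < M" for \<delta> M
  proof (rule ccontr)
    assume "\<not> (\<exists>t u. 0 \<le> t \<and> t \<le> \<delta> \<and> u \<in> X \<and> NX (T t u) > M * NX u)"
    then have "\<And>t u. 0 \<le> t \<Longrightarrow> t \<le> \<delta> \<Longrightarrow> u \<in> X \<Longrightarrow> NX (T t u) \<le> M * NX u"
      by (meson not_le)
    then show False using neg witness[OF that] by blast
  qed
  \<comment> \<open>A vector that \<open>T t\<close> enlarges by more than (|K| + 1) / \<epsilon> is
    rescaled to norm \<epsilon>. Its norm is positive, since otherwise \<open>T_bdd\<close> for this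
    fixed t would give it an image of norm 0.\<close>
  have hump: "\<exists>t v. 0 \<le> t \<and> t \<le> \<delta> \<and> v \<in> X \<and> NX v \<le> \<epsilon> \<and> K \<le> NX (T t v)" if "0 < \<delta>" "0 < \<epsilon>" for \<delta> \<epsilon> K
  proof -
    obtain t u where tu: "0 \<le> t" "t \<le> \<delta>" "u \<in> X" "NX (T t u) > (\<bar>K\<bar> + 1) / \<epsilon> * NX u"
      using unb[OF \<open>0 < \<delta>\<close>, of "(\<bar>K\<bar> + 1) / \<epsilon>"] \<open>0 < \<epsilon>\<close> by auto
    obtain C where C: "0 < C" "\<And>u. u \<in> X \<Longrightarrow> NX (T t u) \<le> C * NX u"
      using T_bdd[OF tu(1)] by metis
    have pos: "NX u > 0"
    proof (rule ccontr)
      assume "\<not> NX u > 0"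
      then have "NX u = 0" using NX_nonneg[of u] by linarith
      then show False using C(2)[OF tu(3)] tu(4) by simp
    qed
    define v where "v = scale (\<epsilon> / NX u) u"
    have vX: "v \<in> X" unfolding v_def by (intro X_scale tu)
    have "NX v = \<epsilon>" using pos \<open>0 < \<epsilon>\<close> by (simp add: v_def NX_scale)
    moreover have "NX (T t v) = \<epsilon> / NX u * NX (T t u)"
      using NX_cong[OF T_X[OF tu(1) vX] X_scale[OF T_X[OF tu(1,3)]] T_scale[OF tu(1,3), of "\<epsilon> / NX u", folded v_def]]
        pos \<open>0 < \<epsilon>\<close> by (simp add: NX_scale)
    moreover have "\<epsilon> / NX u * ((\<bar>K\<bar> + 1) / \<epsilon> * NX u) = \<bar>K\<bar> + 1"
      using pos \<open>0 < \<epsilon>\<close> by simp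
    moreover have "\<epsilon> / NX u * ((\<bar>K\<bar> + 1) / \<epsilon> * NX u) \<le> \<epsilon> / NX u * NX (T t u)"
      using tu(4) pos \<open>0 < \<epsilon>\<close> by (intro mult_left_mono) auto
    ultimately show ?thesis
      using tu vX by (intro exI[of _ t] exI[of _ v]) auto
  qed
  define P where "P s \<longleftrightarrow> fst s \<in> X \<and> 0 < fst (snd s)" for s :: "state \<times> real \<times> real"
  \<comment> \<open>A stage consists of a vector, a budget for the next change and a time. The
    budget is at least halved, and the last conjunct keeps it below the reciprocal of an operator
    bound at the chosen time: all that is added later moves the image at that time by a bounded
    amount.\<close>
  define Q where "Q n s s' \<longleftrightarrow> fst (snd s') \<le> fst (snd s) / 2 \<and> NX (fst s' - fst s) \<le> fst (snd s) \<and>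
      0 \<le> snd (snd s') \<and> snd (snd s') \<le> 1 / real (Suc n) \<and> real n \<le> NX (T (snd (snd s')) (fst s')) \<and>
      (\<forall>u\<in>X. NX (T (snd (snd s')) u) * fst (snd s') \<le> NX u)" for n :: nat and s s' :: "state \<times> real \<times> real"
  have "\<exists>f. \<forall>n. P (f n) \<and> Q n (f n) (f (Suc n))"
  proof (rule dependent_nat_choice[where P = "\<lambda>_. P" and Q = Q])
    show "\<exists>s. P s" by (rule exI[of _ "(0, 1, 0)"]) (simp add: P_def X_zero)
    fix s n assume "P s"
    obtain x \<epsilon> t0 where s: "s = (x, \<epsilon>, t0)" by (cases s) auto
    have x: "x \<in> X" "0 < \<epsilon>" using \<open>P s\<close> by (auto simp: P_def s)
    obtain t v where tv: "0 \<le> t" "t \<le> 1 / real (Suc n)" "v \<in> X" "NX v \<le> \<epsilon>" "2 * real n \<le> NX (T t v)"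
      using hump[of "1 / real (Suc n)" \<epsilon> "2 * real n"] x(2) by auto
    \<comment> \<open>The image of v has norm at least 2 n, so x or x + v has an image of norm at
      least n. Taking the better of the two copes with the unknown image of x.\<close>
    have "NX (T t v) \<le> NX (T t (x + v)) + NX (T t x)"
    proof -
      have "Xeq N L (T t v) (T t (x + v) - T t x)"
        using T_diff[OF tv(1) X_add[OF x(1) tv(3)] x(1)] by simp
      then show ?thesis
        using NX_cong[OF T_X[OF tv(1,3)] X_diff[OF T_X[OF tv(1) X_add[OF x(1) tv(3)]] T_X[OF tv(1) x(1)]]]
          NX_diff_triangle[OF T_X[OF tv(1) X_add[OF x(1) tv(3)]] T_X[OF tv(1) x(1)]] by simp
    qed
    then have "real n \<le> NX (T t (x + v)) \<or> real n \<le> NX (T t x)"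
      using tv(5) by linarith
    then obtain x' where x': "x' \<in> X" "NX (x' - x) \<le> \<epsilon>" "real n \<le> NX (T t x')"
    proof
      assume "real n \<le> NX (T t (x + v))"
      then show ?thesis using that[of "x + v"] X_add[OF x(1) tv(3)] tv(4) by simp
    next
      assume "real n \<le> NX (T t x)"
      then show ?thesis using that[of x] x by simp
    qed
    obtain C where C: "0 < C" "\<And>u. u \<in> X \<Longrightarrow> NX (T t u) \<le> C * NX u"
      using T_bdd[OF tv(1)] by metis
    define \<epsilon>' where "\<epsilon>' = min (\<epsilon> / 2) (1 / C)"
    have \<epsilon>': "0 < \<epsilon>'" "\<epsilon>' \<le> \<epsilon> / 2" "\<epsilon>' \<le> 1 / C" using x(2) C(1) by (auto simp: \<epsilon>'_def)
    have "NX (T t u) * \<epsilon>' \<le> NX u" if "u \<in> X" for u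
    proof -
      have "NX (T t u) * \<epsilon>' \<le> (C * NX u) * (1 / C)"
        using C that \<epsilon>' by (intro mult_mono) auto
      then show ?thesis using C(1) by simp
    qed
    then show "\<exists>s'. P s' \<and> Q n s s'"
      using x' \<epsilon>' tv by (intro exI[of _ "(x', \<epsilon>', t)"]) (auto simp: P_def Q_def s)
  qed
  then obtain f where f: "\<And>n. P (f n)" "\<And>n. Q n (f n) (f (Suc n))" by blast
  define x where "x n = fst (f n)" for n
  define \<epsilon> where "\<epsilon> n = fst (snd (f n))" for n
  define t where "t n = snd (snd (f (Suc n)))" for n
  have x: "x n \<in> X" "0 < \<epsilon> n" for n using f(1)[of n] by (auto simp: P_def x_def \<epsilon>_def)
  have q: "\<epsilon> (Suc n) \<le> \<epsilon> n / 2" "NX (x (Suc n) - x n) \<le> \<epsilon> n" "0 \<le> t n" "t n \<le> 1 / real (Suc n)"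
    "real n \<le> NX (T (t n) (x (Suc n)))" "\<And>u. u \<in> X \<Longrightarrow> NX (T (t n) u) * \<epsilon> (Suc n) \<le> NX u" for n
    using f(2)[of n] by (auto simp: Q_def x_def \<epsilon>_def t_def)
  obtain y where y: "y \<in> X" "\<And>n. NX (y - x n) \<le> 2 * real N * \<epsilon> n"
    using X_complete[of x \<epsilon>, OF x(1) q(2) q(1)] by metis
  \<comment> \<open>The later corrections have total norm at most
    \<open>2 * real N * \<epsilon> (Suc n)\<close>, and \<open>T (t n)\<close> enlarges them by at
    most \<open>1 / \<epsilon> (Suc n)\<close>; the image of the limit thus stays within
    \<open>2 * real N\<close> of the large one.\<close>
  have big: "real n - 2 * real N \<le> NX (T (t n) y)" for n
  proof -
    have "NX (T (t n) (y - x (Suc n))) * \<epsilon> (Suc n) \<le> 2 * real N * \<epsilon> (Suc n)"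
      using q(6)[OF X_diff[OF y(1) x(1)]] y(2) by (rule order_trans)
    then have 1: "NX (T (t n) (y - x (Suc n))) \<le> 2 * real N"
      using x(2)[of "Suc n"] by simp
    have "Xeq N L (T (t n) (x (Suc n))) (T (t n) y - T (t n) (y - x (Suc n)))"
      using T_diff[OF q(3) y(1) X_diff[OF y(1) x(1)], of n "Suc n"] by simp
    then have "NX (T (t n) (x (Suc n))) \<le> NX (T (t n) y) + NX (T (t n) (y - x (Suc n)))"
      using NX_cong[OF T_X[OF q(3) x(1)] X_diff[OF T_X[OF q(3) y(1)] T_X[OF q(3) X_diff[OF y(1) x(1)]]]]
        NX_diff_triangle[OF T_X[OF q(3) y(1)] T_X[OF q(3) X_diff[OF y(1) x(1)]]] by simp
    then show ?thesis using 1 q(5)[of n] by linarith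
  qed
  have "eventually (\<lambda>s. NX (T s y - y) < 1) (at_right 0)"
    using T_cont[OF y(1)] by (rule order_tendstoD) simp
  then obtain d where d: "0 < d" "\<And>s. 0 < s \<Longrightarrow> s < d \<Longrightarrow> NX (T s y - y) < 1"
    by (auto simp: eventually_at_right_field)
  have small: "NX (T s y) \<le> NX y + 1" if s: "0 \<le> s" "s < d" for s
  proof (cases "s = 0")
    case True
    then show ?thesis using NX_cong[OF T_X[OF order_refl y(1)] y(1) T_0[OF y(1)]] by simp
  next
    case False
    then have "NX (T s y - y) < 1" using d(2)[of s] s by simp
    moreover have "NX (T s y) \<le> NX (T s y - y) + NX y"
      using NX_triangle[OF X_diff[OF T_X[OF s(1) y(1)] y(1)] y(1)] by simp
    ultimately show ?thesis by linarith
  qed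
  obtain n1 where n1: "1 / d < real n1" using reals_Archimedean2 by blast
  obtain n2 where n2: "NX y + 1 + 2 * real N < real n2" using reals_Archimedean2 by blast
  define n where "n = max n1 n2"
  have "1 / d < real (Suc n)" using n1 by (simp add: n_def)
  then have "1 / real (Suc n) < d" using d(1) by (simp add: divide_less_eq mult.commute)
  then have "t n < d" using q(4)[of n] by linarith
  then have "NX (T (t n) y) \<le> NX y + 1" by (intro small q(3))
  moreover have "NX y + 1 + 2 * real N < real n" using n2 by (simp add: n_def)
  ultimately show False using big[of n] by linarith
qed

end

section \<open>Invariance of the domain of the generator\<close>

locale generated = semigroup_on_X +
  fixes m :: "nat \<Rightarrow> nat \<Rightarrow> real"
  assumes gen: "semigroup_of_A p N L m T"
begin

abbreviation "D \<equiv> domA p N L m"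

lemma DX: "u \<in> D \<Longrightarrow> u \<in> X"
  by (auto simp: domA_def Xp_def W1p_def)

lemma wderivI:
  assumes "u \<in> W1p p l"
  shows "wderiv p l u \<in> Lp p l" "weak_deriv l u (wderiv p l u)"
proof -
  have "\<exists>g. g \<in> Lp p l \<and> weak_deriv l u g" using assms by (auto simp: W1p_def)
  from someI_ex[OF this] show "wderiv p l u \<in> Lp p l" "weak_deriv l u (wderiv p l u)"
    by (auto simp: wderiv_def)
qed

lemma opA_X: "u \<in> D \<Longrightarrow> opA p L u \<in> X"
  using Lp_minus wderivI(1) unfolding domA_def Xp_def opA_def by blast

definition rd :: "state \<Rightarrow> state \<Rightarrow> bool" where
  "rd u w \<longleftrightarrow> ((\<lambda>h. NX (scale (1 / h) (T h u - u) - w)) \<longlongrightarrow> 0) (at_right 0)"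

lemma rd_iff: "is_right_deriv0 p N L T u w \<longleftrightarrow> rd u w"
  unfolding is_right_deriv0_def rd_def Xnorm_lim_iff ..

lemma rd_opA: "u \<in> D \<Longrightarrow> rd u (opA p L u)"
  using gen by (simp only: semigroup_of_A_def rd_iff)

lemma rd_D: "u \<in> X \<Longrightarrow> w \<in> X \<Longrightarrow> rd u w \<Longrightarrow> u \<in> D"
  using gen unfolding semigroup_of_A_def rd_iff by blast

lemma rd_unique:
  assumes "u \<in> X" "w \<in> X" "w' \<in> X" "rd u w" "rd u w'"
  shows "Xeq N L w w'"
proof -
  have le: "NX (w - w') \<le> NX (scale (1 / h) (T h u - u) - w) + NX (scale (1 / h) (T h u - u) - w')" if "0 < h" for h
  proof -
    let ?q = "scale (1 / h) (T h u - u)"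
    have q: "?q \<in> X" using that assms by (intro X_scale X_diff T_X) auto
    show ?thesis using NX_triangle3[OF assms(2) q assms(3)] NX_diff_swap[of w ?q] by simp
  qed
  have "((\<lambda>h. NX (scale (1 / h) (T h u - u) - w) + NX (scale (1 / h) (T h u - u) - w')) \<longlongrightarrow> 0 + 0) (at_right 0)"
    using assms(4,5) unfolding rd_def by (rule tendsto_add)
  then have "NX (w - w') \<le> 0 + 0"
    by (rule tendsto_lowerbound) (auto simp: eventually_at_right_field intro!: exI[of _ 1] le)
  then have "NX (w - w') = 0" using NX_nonneg[of "w - w'"] by simp
  then show ?thesis using assms by (subst Xeq_iff_diff) (intro NX_zero_imp_Xeq X_diff)
qed

text \<open>\<open>T s\<close> commutes with \<open>T h\<close> and is linear, but each law holds
  only almost everywhere, hence the chain of \<open>Xeq\<close>. Together with the boundedness of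
  \<open>T s\<close> this yields the right derivative of the orbit at \<open>T s u\<close>.\<close>

lemma T_difference_quotient:
  assumes "0 \<le> s" "0 < h" "u \<in> D"
  shows "Xeq N L (scale (1 / h) (T h (T s u) - T s u) - T s (opA p L u))
    (T s (scale (1 / h) (T h u - u) - opA p L u))"
proof -
  have u: "u \<in> X" "opA p L u \<in> X" using assms by (auto intro: DX opA_X)
  have h: "0 \<le> h" using assms by simp
  have Th: "T h u \<in> X" "T h u - u \<in> X" "scale (1 / h) (T h u - u) \<in> X"
    using u h by (auto intro!: X_scale X_diff T_X)
  have 1: "Xeq N L (T s (scale (1 / h) (T h u - u) - opA p L u))
      (scale (1 / h) (T s (T h u) - T s u) - T s (opA p L u))"
    by (rule Xeq_trans[OF T_diff[OF assms(1) Th(3) u(2)]])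
       (intro Xeq_diff Xeq_refl Xeq_trans[OF T_scale[OF assms(1) Th(2)]] Xeq_scale T_diff assms Th u)
  have "Xeq N L (T s (T h u)) (T h (T s u))"
    using Xeq_trans[OF Xeq_sym[OF T_sg[OF assms(1) h u(1)]]] T_sg[OF h assms(1) u(1)]
    by (simp add: add.commute)
  then have "Xeq N L (scale (1 / h) (T s (T h u) - T s u) - T s (opA p L u))
      (scale (1 / h) (T h (T s u) - T s u) - T s (opA p L u))"
    by (intro Xeq_diff Xeq_refl Xeq_scale)
  from Xeq_sym[OF Xeq_trans[OF 1 this]] show ?thesis .
qed

lemma T_D:
  assumes "0 \<le> s" "u \<in> D"
  shows "T s u \<in> D" "Xeq N L (opA p L (T s u)) (T s (opA p L u))"
proof -
  have u: "u \<in> X" "opA p L u \<in> X" "T s u \<in> X" "T s (opA p L u) \<in> X"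
    using assms(1) DX[OF assms(2)] opA_X[OF assms(2)] by (auto intro: T_X)
  obtain C where C: "0 < C" "\<And>u. u \<in> X \<Longrightarrow> NX (T s u) \<le> C * NX u"
    using T_bdd[OF assms(1)] by metis
  have lim: "((\<lambda>h. C * NX (scale (1 / h) (T h u - u) - opA p L u)) \<longlongrightarrow> 0) (at_right 0)"
    using rd_opA[OF assms(2)] unfolding rd_def by (rule tendsto_mult_right_zero)
  have "norm (NX (scale (1 / h) (T h (T s u) - T s u) - T s (opA p L u)))
      \<le> C * NX (scale (1 / h) (T h u - u) - opA p L u)" if "0 < h" for h
  proof -
    have q: "scale (1 / h) (T h u - u) - opA p L u \<in> X"
      using u that by (intro X_diff X_scale T_X) auto
    have "NX (scale (1 / h) (T h (T s u) - T s u) - T s (opA p L u))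
      = NX (T s (scale (1 / h) (T h u - u) - opA p L u))"
      using u that assms(1) q
      by (intro NX_cong T_difference_quotient assms X_diff X_scale T_X) auto
    with C(2)[OF q] show ?thesis by simp
  qed
  note quot = this
  have r: "rd (T s u) (T s (opA p L u))"
    unfolding rd_def
    by (rule Lim_null_comparison[OF eventually_mono[OF eventually_at_right_less[of 0] quot]])
       (simp, rule lim)
  show D: "T s u \<in> D" by (rule rd_D[OF u(3,4) r])
  show "Xeq N L (opA p L (T s u)) (T s (opA p L u))"
    by (rule rd_unique[OF u(3) opA_X[OF D] u(4) rd_opA[OF D] r])
qed

end

section \<open>Primitives of locally integrable functions\<close>

text \<open>Sum the increments over a fine partition.\<close>

lemma constant_if_small_increments:
  fixes f :: "real \<Rightarrow> real"
  assumes "x \<le> y"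
    and small: "\<And>e. 0 < e \<Longrightarrow> \<exists>d>0. \<forall>u v. x \<le> u \<longrightarrow> u \<le> v \<longrightarrow> v \<le> y \<longrightarrow> v - u < d \<longrightarrow> \<bar>f v - f u\<bar> \<le> e * (v - u)"
  shows "f y = f x"
proof -
  have "\<bar>f y - f x\<bar> \<le> e" if "0 < e" for e
  proof -
    have "0 < e / (y - x + 1)" using that \<open>x \<le> y\<close> by simp
    from small[OF this] obtain d where d: "0 < d"
      "\<And>u v. x \<le> u \<Longrightarrow> u \<le> v \<Longrightarrow> v \<le> y \<Longrightarrow> v - u < d \<Longrightarrow> \<bar>f v - f u\<bar> \<le> e / (y - x + 1) * (v - u)"
      by blast
    obtain n where n: "(y - x) / d < real n" using reals_Archimedean2 by blast
    have n0: "0 < real n" using n d(1) \<open>x \<le> y\<close> by (meson diff_ge_0_iff_ge divide_nonneg_pos le_less_trans)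
    define h where "h = (y - x) / real n"
    have h: "0 \<le> h" "h < d" "real n * h = y - x"
      using n n0 d(1) \<open>x \<le> y\<close> by (auto simp: h_def field_simps)
    have "\<bar>f (x + real k * h) - f x\<bar> \<le> e / (y - x + 1) * (real k * h)" if "k \<le> n" for k
      using that
    proof (induction k)
      case (Suc k)
      have le: "x \<le> x + real k * h" "x + real k * h \<le> x + real (Suc k) * h" using h by (auto simp: distrib_right)
      have "real (Suc k) * h \<le> real n * h" using Suc.prems h(1) by (intro mult_right_mono) auto
      then have "x + real (Suc k) * h \<le> y" using h(3) by linarith
      moreover have "x + real (Suc k) * h - (x + real k * h) = h" by (simp add: algebra_simps)
      ultimately have "\<bar>f (x + real (Suc k) * h) - f (x + real k * h)\<bar> \<le> e / (y - x + 1) * h"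
        using d(2)[OF le] h(2) by simp
      moreover have "\<bar>f (x + real k * h) - f x\<bar> \<le> e / (y - x + 1) * (real k * h)"
        using Suc by simp
      moreover have "e / (y - x + 1) * (real (Suc k) * h) = e / (y - x + 1) * (real k * h) + e / (y - x + 1) * h"
        by (simp add: algebra_simps add_divide_distrib)
      ultimately show ?case by linarith
    qed simp
    from this[of n] have "\<bar>f y - f x\<bar> \<le> e / (y - x + 1) * (y - x)" using h(3) by simp
    also have "\<dots> \<le> e" using that \<open>x \<le> y\<close> by (simp add: field_simps)
    finally show ?thesis .
  qed
  then have "\<bar>f y - f x\<bar> \<le> 0" by (rule field_le_epsilon) simp
  then show ?thesis by simp
qed

text \<open>On the whole line and not on one segment, because densities get shifted and reflected
  along characteristics, which leave any fixed segment.\<close>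

definition Lloc :: "real \<Rightarrow> (real \<Rightarrow> real) \<Rightarrow> bool" where
  "Lloc p g \<longleftrightarrow> g \<in> borel_measurable borel \<and> (\<forall>a b. set_integrable lborel {a..b} (\<lambda>x. \<bar>g x\<bar> powr p))"

lemma set_integrable_bound_real:
  fixes f g :: "real \<Rightarrow> real"
  assumes "set_integrable lborel {a..b} f" "g \<in> borel_measurable borel"
    "\<And>x. x \<in> {a..b} \<Longrightarrow> \<bar>g x\<bar> \<le> f x"
  shows "set_integrable lborel {a..b} g"
  unfolding set_integrable_def
proof (rule Bochner_Integration.integrable_bound[OF assms(1)[unfolded set_integrable_def]])
  show "(\<lambda>x. indicator {a..b} x *\<^sub>R g x) \<in> borel_measurable lborel"
    using assms(2) by measurable
  show "AE x in lborel. norm (indicator {a..b} x *\<^sub>R g x) \<le> norm (indicator {a..b} x *\<^sub>R f x)"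
    using order_trans[OF assms(3) abs_ge_self] by (intro AE_I2) (simp add: indicator_def)
qed

lemma set_integrable_const_real [simp]: "set_integrable lborel {a..b::real} (\<lambda>x. c :: real)"
  by (rule borel_integrable_atLeastAtMost'[OF continuous_on_const])

lemma Lloc_L1:
  assumes "1 \<le> p" "Lloc p g"
  shows "set_integrable lborel {a..b} g"
proof (rule set_integrable_bound_real[of _ _ "\<lambda>x. 1 + \<bar>g x\<bar> powr p"])
  show "set_integrable lborel {a..b} (\<lambda>x. 1 + \<bar>g x\<bar> powr p)"
    using assms(2) by (intro set_integral_add(1)) (auto simp: Lloc_def)
  fix x
  show "\<bar>g x\<bar> \<le> 1 + \<bar>g x\<bar> powr p"
  proof (cases "\<bar>g x\<bar> \<le> 1")
    case False
    then have "\<bar>g x\<bar> powr 1 \<le> \<bar>g x\<bar> powr p"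
      using assms by (intro powr_mono) auto
    then show ?thesis using False by simp
  qed (simp add: add_increasing2)
qed (use assms in \<open>auto simp: Lloc_def\<close>)

lemma Lloc_locally_bounded:
  assumes "0 \<le> p" "g \<in> borel_measurable borel" "\<And>a b. \<exists>B. \<forall>x\<in>{a..b}. \<bar>g x\<bar> \<le> B"
  shows "Lloc p g"
  unfolding Lloc_def
proof (intro conjI allI assms)
  fix a b :: real
  obtain B where B: "\<forall>x\<in>{a..b}. \<bar>g x\<bar> \<le> B" using assms(3) by blast
  show "set_integrable lborel {a..b} (\<lambda>x. \<bar>g x\<bar> powr p)"
    by (rule set_integrable_bound_real[of _ _ "\<lambda>x. B powr p"])
       (use B assms(1,2) in \<open>auto intro!: powr_mono2\<close>)
qed

lemma continuous_locally_bounded: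
  fixes g :: "real \<Rightarrow> real"
  assumes "continuous_on UNIV g"
  shows "\<exists>B. \<forall>x\<in>{a..b}. \<bar>g x\<bar> \<le> B"
proof -
  have "continuous_on {a..b} g"
    using continuous_on_subset[OF assms] by simp
  then have "bounded (g ` {a..b})"
    by (rule compact_imp_bounded[OF compact_continuous_image]) simp
  then obtain B where "\<forall>y\<in>g ` {a..b}. norm y \<le> B"
    unfolding bounded_iff by blast
  then show ?thesis by (intro exI[of _ B] ballI) simp
qed

lemma Lloc_continuous: "0 \<le> p \<Longrightarrow> continuous_on UNIV g \<Longrightarrow> Lloc p g"
  by (intro Lloc_locally_bounded continuous_locally_bounded) (auto intro: borel_measurable_continuous_onI)

lemma Lloc_mult_bounded:
  assumes "0 \<le> p" "Lloc p g" "f \<in> borel_measurable borel" "\<And>a b. \<exists>B. \<forall>x\<in>{a..b}. \<bar>f x\<bar> \<le> B"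
  shows "Lloc p (\<lambda>x. g x * f x)"
  unfolding Lloc_def
proof (intro conjI allI)
  show m: "(\<lambda>x. g x * f x) \<in> borel_measurable borel" using assms by (auto simp: Lloc_def)
  fix a b :: real
  obtain B where B: "\<forall>x\<in>{a..b}. \<bar>f x\<bar> \<le> B" using assms(4) by blast
  show "set_integrable lborel {a..b} (\<lambda>x. \<bar>g x * f x\<bar> powr p)"
  proof (rule set_integrable_bound_real[of _ _ "\<lambda>x. B powr p * \<bar>g x\<bar> powr p"])
    show "set_integrable lborel {a..b} (\<lambda>x. B powr p * \<bar>g x\<bar> powr p)"
      using assms(2) by (auto simp: Lloc_def)
    show "(\<lambda>x. \<bar>g x * f x\<bar> powr p) \<in> borel_measurable borel" using m by measurable
    fix x assume "x \<in> {a..b}"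
    then have "\<bar>f x\<bar> powr p * \<bar>g x\<bar> powr p \<le> B powr p * \<bar>g x\<bar> powr p"
      using B assms(1) by (intro mult_right_mono powr_mono2) auto
    then show "\<bar>\<bar>g x * f x\<bar> powr p\<bar> \<le> B powr p * \<bar>g x\<bar> powr p"
      by (simp add: abs_mult powr_mult mult.commute)
  qed
qed

lemma Lloc_add:
  assumes "1 \<le> p" "Lloc p f" "Lloc p g"
  shows "Lloc p (\<lambda>x. f x + g x)"
  unfolding Lloc_def
proof (intro conjI allI)
  show m: "(\<lambda>x. f x + g x) \<in> borel_measurable borel" using assms by (auto simp: Lloc_def)
  fix a b :: real
  show "set_integrable lborel {a..b} (\<lambda>x. \<bar>f x + g x\<bar> powr p)"
  proof (rule set_integrable_bound_real[of _ _ "\<lambda>x. 2 powr p * (\<bar>f x\<bar> powr p + \<bar>g x\<bar> powr p)"])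
    show "set_integrable lborel {a..b} (\<lambda>x. 2 powr p * (\<bar>f x\<bar> powr p + \<bar>g x\<bar> powr p))"
      using assms by (intro set_integrable_mult_right set_integral_add(1)) (auto simp: Lloc_def)
    show "(\<lambda>x. \<bar>f x + g x\<bar> powr p) \<in> borel_measurable borel" using m by measurable
    fix x
    have "\<bar>f x + g x\<bar> powr p \<le> (2 * max \<bar>f x\<bar> \<bar>g x\<bar>) powr p"
      using assms(1) by (intro powr_mono2) auto
    also have "\<dots> = 2 powr p * (max \<bar>f x\<bar> \<bar>g x\<bar>) powr p" by (rule powr_mult)
    also have "\<dots> \<le> 2 powr p * (\<bar>f x\<bar> powr p + \<bar>g x\<bar> powr p)"
      by (intro mult_left_mono) (auto simp: max_def)
    finally show "\<bar>\<bar>f x + g x\<bar> powr p\<bar> \<le> 2 powr p * (\<bar>f x\<bar> powr p + \<bar>g x\<bar> powr p)" by simp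
  qed
qed

lemma set_integrable_affine:
  fixes f :: "real \<Rightarrow> real"
  assumes "c = 1 \<or> c = -1" "\<And>a b. set_integrable lborel {a..b} f"
  shows "set_integrable lborel {a..b} (\<lambda>x. f (d + c * x))"
proof -
  have *: "integrable lborel (\<lambda>x. indicator {min (d + c * a) (d + c * b)..max (d + c * a) (d + c * b)} x *\<^sub>R f x)"
    using assms(2) by (simp add: set_integrable_def)
  have "integrable lborel (\<lambda>x. indicator {min (d + c * a) (d + c * b)..max (d + c * a) (d + c * b)} (d + c * x) *\<^sub>R f (d + c * x))"
    using assms(1) by (intro lborel_integrable_real_affine[OF *]) auto
  then have "set_integrable lborel {a..b} (\<lambda>x. indicator {min (d + c * a) (d + c * b)..max (d + c * a) (d + c * b)} (d + c * x) *\<^sub>R f (d + c * x))"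
    unfolding set_integrable_def by (rule integrable_mult_indicator[rotated]) simp
  then show ?thesis
    unfolding set_integrable_def
    by (rule Bochner_Integration.integrable_cong[THEN iffD1, rotated -1])
       (use assms(1) in \<open>auto simp: indicator_def\<close>)
qed

lemma set_integral_affine:
  fixes f :: "real \<Rightarrow> real"
  assumes "c = 1 \<or> c = -1"
  shows "(LINT x:{a..b}|lborel. f (d + c * x)) =
    (LINT x:(if c = 1 then {d + a..d + b} else {d - b..d - a})|lborel. f x)"
proof -
  have "(LINT x|lborel. indicator (if c = 1 then {d + a..d + b} else {d - b..d - a}) x *\<^sub>R f x)
    = \<bar>c\<bar> *\<^sub>R (LINT x|lborel. indicator (if c = 1 then {d + a..d + b} else {d - b..d - a}) (d + c * x) *\<^sub>R f (d + c * x))"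
    using assms by (intro lborel_integral_real_affine) auto
  also have "\<dots> = (LINT x|lborel. indicator {a..b} x *\<^sub>R f (d + c * x))"
    using assms by (auto simp: indicator_def intro!: Bochner_Integration.integral_cong)
  finally show ?thesis by (simp add: set_lebesgue_integral_def)
qed

text \<open>\<open>F\<close> belongs to the local Sobolev space W^(1,p) with derivative
  \<open>g\<close>. Expressing this through increments gives product, exponential and substitution
  rules without differentiating almost everywhere.\<close>

definition prim :: "real \<Rightarrow> (real \<Rightarrow> real) \<Rightarrow> (real \<Rightarrow> real) \<Rightarrow> bool" where
  "prim p F g \<longleftrightarrow> Lloc p g \<and> (\<forall>x y. x \<le> y \<longrightarrow> F y - F x = (LINT s:{x..y}|lborel. g s))"

lemma primD:
  assumes "prim p F g" "1 \<le> p"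
  shows "Lloc p g" "g \<in> borel_measurable borel" "set_integrable lborel {a..b} g"
    "x \<le> y \<Longrightarrow> F y = F x + (LINT s:{x..y}|lborel. g s)"
proof -
  show *: "Lloc p g" using assms(1) by (simp add: prim_def)
  show "set_integrable lborel {a..b} g" using Lloc_L1[OF assms(2) *] .
  show "g \<in> borel_measurable borel" using * by (simp add: Lloc_def)
  show "x \<le> y \<Longrightarrow> F y = F x + (LINT s:{x..y}|lborel. g s)"
    using assms(1) by (simp add: prim_def algebra_simps)
qed

lemma prim_indefinite_integral:
  assumes Ll: "Lloc p g" and gi: "integrable lborel g"
  shows "prim p (\<lambda>x. \<integral>r. g r * indicator {..x} r \<partial>lborel) g"
  unfolding prim_def
proof (intro conjI allI impI Ll)
  have [measurable]: "g \<in> borel_measurable borel" using Ll by (simp add: Lloc_def)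
  have gx: "integrable lborel (\<lambda>s. g s * indicator {..x} s)" for x
    using integrable_mult_indicator[of "{..x}" lborel g] gi by (simp add: mult.commute)
  fix x y :: real assume "x \<le> y"
  have "(\<integral>r. g r * indicator {..y} r \<partial>lborel) - (\<integral>r. g r * indicator {..x} r \<partial>lborel)
      = (\<integral>s. g s * indicator {..y} s - g s * indicator {..x} s \<partial>lborel)"
    using gx by simp
  also have "\<dots> = (LINT s:{x..y}|lborel. g s)"
    unfolding set_lebesgue_integral_def
  proof (rule integral_cong_AE)
    show "AE s in lborel. g s * indicator {..y} s - g s * indicator {..x} s = indicator {x..y} s *\<^sub>R g s"
      using AE_lborel_singleton[of x] by eventually_elim (use \<open>x \<le> y\<close> in \<open>auto simp: indicator_def\<close>)
  qed measurable
  finally show "(\<integral>r. g r * indicator {..y} r \<partial>lborel) - (\<integral>r. g r * indicator {..x} r \<partial>lborel) = (LINT s:{x..y}|lborel. g s)" .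
qed

lemma prim_continuous:
  assumes "prim p F g" "1 \<le> p"
  shows "continuous_on UNIV F"
proof -
  have c: "continuous_on {a..b} F" for a b
  proof -
    have "g integrable_on {a..b}"
      using set_borel_integral_eq_integral(1)[OF primD(3)[OF assms]] .
    then have "continuous_on {a..b} (\<lambda>x. F a + integral {a..x} g)"
      by (intro continuous_intros indefinite_integral_continuous_1)
    moreover have "F a + integral {a..x} g = F x" if "x \<in> {a..b}" for x
      using primD(4)[OF assms, of a x] set_borel_integral_eq_integral(2)[OF primD(3)[OF assms], of a x] that
      by simp
    ultimately show ?thesis
      by (rule continuous_on_eq)
  qed
  have "isCont F x" for x
    using c[of "x - 1" "x + 1"] by (rule continuous_on_interior) simp
  then show ?thesis by (simp add: continuous_on_eq_continuous_within)
qed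

lemma prim_const: "0 \<le> p \<Longrightarrow> prim p (\<lambda>_. c) (\<lambda>_. 0)"
  by (auto simp: prim_def set_lebesgue_integral_def intro: Lloc_continuous)

lemma prim_add:
  assumes "1 \<le> p" "prim p F f" "prim p G g"
  shows "prim p (\<lambda>x. F x + G x) (\<lambda>x. f x + g x)"
  using primD[OF assms(2,1)] primD[OF assms(3,1)] unfolding prim_def[of _ "\<lambda>x. F x + G x"]
  by (auto intro!: Lloc_add assms)

lemma prim_cmult:
  assumes "1 \<le> p" "prim p F f"
  shows "prim p (\<lambda>x. c * F x) (\<lambda>x. c * f x)"
proof -
  have "Lloc p (\<lambda>x. f x * c)"
    by (rule Lloc_mult_bounded) (use assms primD(1)[OF assms(2,1)] in auto)
  then show ?thesis
    using assms(2) unfolding prim_def by (auto simp: mult.commute[of c] left_diff_distrib[symmetric])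
qed

lemma prim_sum:
  assumes "1 \<le> p" "finite I" "\<And>i. i \<in> I \<Longrightarrow> prim p (F i) (f i)"
  shows "prim p (\<lambda>x. \<Sum>i\<in>I. F i x) (\<lambda>x. \<Sum>i\<in>I. f i x)"
  using assms(2,3)
proof (induction I rule: finite_induct)
  case empty
  then show ?case using prim_const[of p 0] assms(1) by simp
next
  case (insert i I)
  then have "prim p (\<lambda>x. F i x + (\<Sum>i\<in>I. F i x)) (\<lambda>x. f i x + (\<Sum>i\<in>I. f i x))"
    by (intro prim_add assms(1)) auto
  with insert show ?case by simp
qed

lemma prim_affine:
  assumes "1 \<le> p" "prim p F f" "c = 1 \<or> c = -1"
  shows "prim p (\<lambda>x. F (d + c * x)) (\<lambda>x. c * f (d + c * x))"
  unfolding prim_def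
proof (intro conjI allI impI)
  have a: "\<bar>c * f (d + c * x)\<bar> = \<bar>f (d + c * x)\<bar>" for x using assms(3) by auto
  have m: "f \<in> borel_measurable borel" by (rule primD(2)[OF assms(2,1)])
  show "Lloc p (\<lambda>x. c * f (d + c * x))"
    unfolding Lloc_def a
    using primD(1)[OF assms(2,1)] m assms(3)
    by (auto intro!: set_integrable_affine[where f = "\<lambda>x. \<bar>f x\<bar> powr p"] simp: Lloc_def)
  fix x y :: real assume "x \<le> y"
  have "(LINT s:{x..y}|lborel. c * f (d + c * s)) = c * (LINT s:{x..y}|lborel. f (d + c * s))"
    by simp
  also have "\<dots> = F (d + c * y) - F (d + c * x)"
    unfolding set_integral_affine[OF assms(3)]
    using assms(3) \<open>x \<le> y\<close> primD(4)[OF assms(2,1), of "d + x" "d + y"] primD(4)[OF assms(2,1), of "d - y" "d - x"]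
    by auto
  finally show "F (d + c * y) - F (d + c * x) = (LINT s:{x..y}|lborel. c * f (d + c * s))" by simp
qed

lemma prim_C1:
  assumes "1 \<le> p" "\<And>x. (F has_real_derivative f x) (at x)" "continuous_on UNIV f"
  shows "prim p F f"
  unfolding prim_def
proof (intro conjI allI impI)
  show "Lloc p f" using assms by (intro Lloc_continuous) auto
  fix x y :: real assume "x \<le> y"
  then have "(\<integral>s. indicator {x..y} s *\<^sub>R f s \<partial>lborel) = F y - F x"
    using assms(2,3)
    by (intro integral_FTC_atLeastAtMost)
       (auto simp: has_real_derivative_iff_has_vector_derivative[symmetric]
         intro: has_field_derivative_at_within continuous_on_subset)
  then show "F y - F x = (LINT s:{x..y}|lborel. f s)"
    by (simp add: set_lebesgue_integral_def)
qed

section \<open>Product rule for primitives\<close>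

lemma integrable_product_bounded:
  fixes u v :: "real \<Rightarrow> real" and w :: "real \<Rightarrow> real \<Rightarrow> real"
  assumes u: "integrable lborel u" and v: "integrable lborel v"
    and m: "(\<lambda>(s, r). w s r) \<in> borel_measurable (lborel \<Otimes>\<^sub>M lborel)" and w: "\<And>s r. \<bar>w s r\<bar> \<le> 1"
  shows "integrable (lborel \<Otimes>\<^sub>M lborel) (\<lambda>(s, r). u s * v r * w s r)"
proof -
  have [measurable]: "u \<in> borel_measurable borel" "v \<in> borel_measurable borel" using u v by auto
  have uv: "integrable (lborel \<Otimes>\<^sub>M lborel) (\<lambda>(s, r). u s * v r)"
  proof (rule lborel_pair.Fubini_integrable)
    show "(\<lambda>(s, r). u s * v r) \<in> borel_measurable (lborel \<Otimes>\<^sub>M lborel)" by measurable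
    show "integrable lborel (\<lambda>s. \<integral>r. norm (case (s, r) of (s, r) \<Rightarrow> u s * v r) \<partial>lborel)"
      using u by (simp add: abs_mult)
    show "AE s in lborel. integrable lborel (\<lambda>r. case (s, r) of (s, r) \<Rightarrow> u s * v r)"
      using v by simp
  qed
  show ?thesis
  proof (rule Bochner_Integration.integrable_bound[OF uv])
    show "(\<lambda>(s, r). u s * v r * w s r) \<in> borel_measurable (lborel \<Otimes>\<^sub>M lborel)"
      using m by (simp add: split_beta') measurable
    show "AE x in lborel \<Otimes>\<^sub>M lborel. norm (case x of (s, r) \<Rightarrow> u s * v r * w s r) \<le> norm (case x of (s, r) \<Rightarrow> u s * v r)"
      using w by (intro AE_I2) (auto simp: abs_mult intro!: mult_left_le)
  qed
qed

text \<open>The product on the right is an integral over the plane, which the diagonal cuts into r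
  <= s and r > s. Fubini's theorem on the second part gives the second summand; each slice meets the
  diagonal in a null set.\<close>

lemma indefinite_integrals_product:
  fixes a b :: "real \<Rightarrow> real"
  assumes a: "integrable lborel a" and b: "integrable lborel b"
  shows "(\<integral>s. a s * (\<integral>r. b r * indicator {..s} r \<partial>lborel) \<partial>lborel)
    + (\<integral>s. b s * (\<integral>r. a r * indicator {..s} r \<partial>lborel) \<partial>lborel)
    = (\<integral>s. a s \<partial>lborel) * (\<integral>s. b s \<partial>lborel)"
    and "integrable lborel (\<lambda>s. a s * (\<integral>r. b r * indicator {..s} r \<partial>lborel))"
proof -
  have ma[measurable]: "a \<in> borel_measurable borel" and mb[measurable]: "b \<in> borel_measurable borel"
    using a b by auto
  have m1: "(\<lambda>(s::real, r::real). indicator {..s} r :: real) \<in> borel_measurable (lborel \<Otimes>\<^sub>M lborel)"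
  proof -
    have eq: "(\<lambda>(s::real, r::real). indicator {..s} r :: real) = indicator {x. snd x \<le> fst x}"
      by (auto simp: indicator_def fun_eq_iff)
    have "{x \<in> space (lborel \<Otimes>\<^sub>M lborel). snd x \<le> (fst x :: real)} \<in> sets (lborel \<Otimes>\<^sub>M lborel)"
      by measurable
    then have set: "{x::real \<times> real. snd x \<le> fst x} \<in> sets (lborel \<Otimes>\<^sub>M lborel)"
      by (simp add: space_pair_measure)
    show ?thesis unfolding eq by (rule borel_measurable_indicator[OF set])
  qed
  have m2: "(\<lambda>(s::real, r::real). 1 - indicator {..s} r :: real) \<in> borel_measurable (lborel \<Otimes>\<^sub>M lborel)"
    using borel_measurable_diff[OF borel_measurable_const m1, of 1] by (simp add: split_beta')
  have i1: "integrable (lborel \<Otimes>\<^sub>M lborel) (\<lambda>(s, r). a s * b r * indicator {..s} r)"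
    by (rule integrable_product_bounded[OF a b m1]) (auto simp: indicator_def)
  have i2: "integrable (lborel \<Otimes>\<^sub>M lborel) (\<lambda>(s, r). a s * b r * (1 - indicator {..s} r))"
    by (rule integrable_product_bounded[OF a b m2]) (auto simp: indicator_def)
  have j1: "integrable lborel (\<lambda>s. \<integral>r. a s * b r * indicator {..s} r \<partial>lborel)"
    using lborel_pair.integrable_fst'[OF i1] by simp
  then show "integrable lborel (\<lambda>s. a s * (\<integral>r. b r * indicator {..s} r \<partial>lborel))"
    by (simp add: mult.assoc)
  have j2: "integrable lborel (\<lambda>s. \<integral>r. a s * b r * (1 - indicator {..s} r) \<partial>lborel)"
    using lborel_pair.integrable_fst'[OF i2] by simp
  have bi: "integrable lborel (\<lambda>r. b r * indicator {..s} r)" for s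
    using integrable_mult_indicator[of "{..s}" lborel b] b by (simp add: mult.commute)
  have bi': "integrable lborel (\<lambda>r. b r * (1 - indicator {..s} r))" for s
    using Bochner_Integration.integrable_diff[OF b bi[of s]] by (simp add: right_diff_distrib)
  have "(\<integral>s. b s * (\<integral>r. a r * indicator {..s} r \<partial>lborel) \<partial>lborel)
      = (\<integral>r. (\<integral>s. a s * b r * (1 - indicator {..s} r) \<partial>lborel) \<partial>lborel)"
  proof (rule Bochner_Integration.integral_cong[OF refl])
    fix r :: real
    have "(\<integral>s. a s * b r * (1 - indicator {..s} r) \<partial>lborel) = (\<integral>s. b r * (a s * indicator {..r} s) \<partial>lborel)"
    proof (rule integral_cong_AE)
      show "AE s in lborel. a s * b r * (1 - indicator {..s} r) = b r * (a s * indicator {..r} s)"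
        using AE_lborel_singleton[of r] by eventually_elim (auto simp: indicator_def)
      have "(\<lambda>s. a s * b r * (1 - indicator {r..} s)) \<in> borel_measurable lborel" by measurable
      then show "(\<lambda>s. a s * b r * (1 - indicator {..s} r)) \<in> borel_measurable lborel"
        by (simp add: indicator_def)
    qed measurable
    then show "b r * (\<integral>s. a s * indicator {..r} s \<partial>lborel) = (\<integral>s. a s * b r * (1 - indicator {..s} r) \<partial>lborel)"
      by simp
  qed
  also have "\<dots> = (\<integral>s. (\<integral>r. a s * b r * (1 - indicator {..s} r) \<partial>lborel) \<partial>lborel)"
    by (rule lborel_pair.Fubini_integral[OF i2])
  finally have "(\<integral>s. a s * (\<integral>r. b r * indicator {..s} r \<partial>lborel) \<partial>lborel)
    + (\<integral>s. b s * (\<integral>r. a r * indicator {..s} r \<partial>lborel) \<partial>lborel)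
    = (\<integral>s. (\<integral>r. a s * b r * indicator {..s} r \<partial>lborel) + (\<integral>r. a s * b r * (1 - indicator {..s} r) \<partial>lborel) \<partial>lborel)"
    using j1 j2 by (simp add: mult.assoc)
  also have "\<dots> = (\<integral>s. a s * (\<integral>r. b r \<partial>lborel) \<partial>lborel)"
  proof (rule Bochner_Integration.integral_cong[OF refl])
    fix s :: real
    have "(\<integral>r. a s * b r * indicator {..s} r \<partial>lborel) + (\<integral>r. a s * b r * (1 - indicator {..s} r) \<partial>lborel)
      = a s * ((\<integral>r. b r * indicator {..s} r \<partial>lborel) + (\<integral>r. b r * (1 - indicator {..s} r) \<partial>lborel))"
      by (simp add: mult.assoc distrib_left)
    also have "(\<integral>r. b r * indicator {..s} r \<partial>lborel) + (\<integral>r. b r * (1 - indicator {..s} r) \<partial>lborel)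
      = (\<integral>r. b r * indicator {..s} r + b r * (1 - indicator {..s} r) \<partial>lborel)"
      using bi bi' by simp
    also have "\<dots> = (\<integral>r. b r \<partial>lborel)"
      by (rule Bochner_Integration.integral_cong) (auto simp: algebra_simps)
    finally show "(\<integral>r. a s * b r * indicator {..s} r \<partial>lborel) + (\<integral>r. a s * b r * (1 - indicator {..s} r) \<partial>lborel)
      = a s * (\<integral>r. b r \<partial>lborel)" .
  qed
  finally show "(\<integral>s. a s * (\<integral>r. b r * indicator {..s} r \<partial>lborel) \<partial>lborel)
    + (\<integral>s. b s * (\<integral>r. a r * indicator {..s} r \<partial>lborel) \<partial>lborel)
    = (\<integral>s. a s \<partial>lborel) * (\<integral>s. b s \<partial>lborel)"
    by simp
qed

text \<open>Restrict both densities to [x, y]: their indefinite integrals are F - F x and G - G x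
  there, and \<open>indefinite_integrals_product\<close> is integration by parts for them.\<close>

lemma prim_mult:
  assumes p: "1 \<le> p" and F: "prim p F f" and G: "prim p G g"
  shows "prim p (\<lambda>x. F x * G x) (\<lambda>x. f x * G x + g x * F x)"
  unfolding prim_def
proof (intro conjI allI impI)
  note cF = prim_continuous[OF F p] and cG = prim_continuous[OF G p]
  show "Lloc p (\<lambda>x. f x * G x + g x * F x)"
    using primD(1)[OF F p] primD(1)[OF G p] p cF cG
    by (intro Lloc_add Lloc_mult_bounded continuous_locally_bounded) (auto intro: borel_measurable_continuous_onI)
  fix x y :: real assume xy: "x \<le> y"
  define a where "a s = indicator {x..y} s * f s" for s
  define b where "b s = indicator {x..y} s * g s" for s
  have ab: "integrable lborel a" "integrable lborel b"
    using primD(3)[OF F p, of x y] primD(3)[OF G p, of x y] by (auto simp: set_integrable_def a_def[abs_def] b_def[abs_def])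
  have A: "(\<integral>s. a s \<partial>lborel) = F y - F x" "(\<integral>s. b s \<partial>lborel) = G y - G x"
    using primD(4)[OF F p xy] primD(4)[OF G p xy] by (auto simp: set_lebesgue_integral_def a_def b_def)
  have As: "(\<integral>r. a r * indicator {..s} r \<partial>lborel) = F s - F x" "(\<integral>r. b r * indicator {..s} r \<partial>lborel) = G s - G x"
    if s: "s \<in> {x..y}" for s
  proof -
    have "(\<integral>r. a r * indicator {..s} r \<partial>lborel) = (LINT r:{x..s}|lborel. f r)"
      "(\<integral>r. b r * indicator {..s} r \<partial>lborel) = (LINT r:{x..s}|lborel. g r)"
      unfolding set_lebesgue_integral_def a_def b_def
      using s by (auto intro!: Bochner_Integration.integral_cong simp: indicator_def)
    then show "(\<integral>r. a r * indicator {..s} r \<partial>lborel) = F s - F x" "(\<integral>r. b r * indicator {..s} r \<partial>lborel) = G s - G x"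
      using primD(4)[OF F p, of x s] primD(4)[OF G p, of x s] s by auto
  qed
  have "(LINT s:{x..y}|lborel. f s * G s + g s * F s)
    = (\<integral>s. (G x * a s + a s * (\<integral>r. b r * indicator {..s} r \<partial>lborel))
      + (F x * b s + b s * (\<integral>r. a r * indicator {..s} r \<partial>lborel)) \<partial>lborel)"
    unfolding set_lebesgue_integral_def
  proof (rule Bochner_Integration.integral_cong[OF refl])
    fix s
    show "indicator {x..y} s *\<^sub>R (f s * G s + g s * F s) = (G x * a s + a s * (\<integral>r. b r * indicator {..s} r \<partial>lborel))
      + (F x * b s + b s * (\<integral>r. a r * indicator {..s} r \<partial>lborel))"
      by (cases "s \<in> {x..y}") (auto simp: As a_def[of s] b_def[of s] algebra_simps)
  qed
  also have "\<dots> = G x * (F y - F x) + F x * (G y - G x) + ((\<integral>s. a s * (\<integral>r. b r * indicator {..s} r \<partial>lborel) \<partial>lborel)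
    + (\<integral>s. b s * (\<integral>r. a r * indicator {..s} r \<partial>lborel) \<partial>lborel))"
    using ab indefinite_integrals_product(2)[OF ab] indefinite_integrals_product(2)[OF ab(2,1)] by (simp add: A)
  also have "\<dots> = F y * G y - F x * G x"
    unfolding indefinite_integrals_product(1)[OF ab] A by (simp add: algebra_simps)
  finally show "F y * G y - F x * G x = (LINT s:{x..y}|lborel. f s * G s + g s * F s)" by simp
qed

section \<open>Sobolev functions\<close>

lemma set_integral_split_Icc:
  fixes g :: "real \<Rightarrow> real"
  assumes "set_integrable lborel {x..y} g" "x \<le> c" "c \<le> y"
  shows "(LINT s:{x..y}|lborel. g s) = (LINT s:{x..c}|lborel. g s) + (LINT s:{c..y}|lborel. g s)"
proof -
  have "set_integrable lborel {x..c} g" "set_integrable lborel {c..y} g"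
    using assms by (auto intro!: set_integrable_subset[OF assms(1)])
  then show ?thesis
    using Henstock_Kurzweil_Integration.integral_combine[OF assms(2,3) set_borel_integral_eq_integral(1)[OF assms(1)]] assms(1)
    by (simp add: set_borel_integral_eq_integral(2))
qed

lemma set_integral_cong_Icc:
  fixes f g :: "real \<Rightarrow> real"
  assumes [measurable]: "f \<in> borel_measurable borel" "g \<in> borel_measurable borel"
    and "\<And>s. s \<in> {x<..<y} \<Longrightarrow> f s = g s"
  shows "(LINT s:{x..y}|lborel. f s) = (LINT s:{x..y}|lborel. g s)"
  unfolding set_lebesgue_integral_def
proof (rule integral_cong_AE)
  show "AE s in lborel. indicator {x..y} s *\<^sub>R f s = indicator {x..y} s *\<^sub>R g s"
    using AE_lborel_singleton[of x] AE_lborel_singleton[of y]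
    by eventually_elim (use assms(3) in \<open>auto simp: indicator_def\<close>)
qed measurable

lemma integral_seg_Icc:
  fixes f :: "real \<Rightarrow> real"
  assumes [measurable]: "f \<in> borel_measurable borel"
  shows "(\<integral>x. f x \<partial>seg l) = (LINT s:{0..l}|lborel. f s)"
  unfolding integral_seg set_lebesgue_integral_def
proof (rule integral_cong_AE)
  show "AE s in lborel. indicator {0<..<l} s * f s = indicator {0..l} s *\<^sub>R f s"
    using AE_lborel_singleton[of 0] AE_lborel_singleton[of l]
    by eventually_elim (auto simp: indicator_def)
qed measurable

lemma Lloc_if:
  assumes p: "1 \<le> p" and f: "Lloc p f" and g: "Lloc p g"
  shows "Lloc p (\<lambda>x. if x \<le> c then f x else g x)"
  unfolding Lloc_def
proof (intro conjI allI)
  have [measurable]: "f \<in> borel_measurable borel" "g \<in> borel_measurable borel"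
    using f g by (auto simp: Lloc_def)
  show m: "(\<lambda>x. if x \<le> c then f x else g x) \<in> borel_measurable borel" by measurable
  fix a b :: real
  show "set_integrable lborel {a..b} (\<lambda>x. \<bar>if x \<le> c then f x else g x\<bar> powr p)"
  proof (rule set_integrable_bound_real[of _ _ "\<lambda>x. \<bar>f x\<bar> powr p + \<bar>g x\<bar> powr p"])
    show "set_integrable lborel {a..b} (\<lambda>x. \<bar>f x\<bar> powr p + \<bar>g x\<bar> powr p)"
      using f g by (intro set_integral_add(1)) (auto simp: Lloc_def)
    show "(\<lambda>x. \<bar>if x \<le> c then f x else g x\<bar> powr p) \<in> borel_measurable borel" using m by measurable
  qed auto
qed

lemma prim_glue:
  assumes p: "1 \<le> p" and F: "prim p F f" and G: "prim p G g" and eq: "F c = G c"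
  shows "prim p (\<lambda>x. if x \<le> c then F x else G x) (\<lambda>x. if x \<le> c then f x else g x)"
    (is "prim p ?H ?h")
  unfolding prim_def
proof (intro conjI allI impI)
  have [measurable]: "f \<in> borel_measurable borel" "g \<in> borel_measurable borel"
    using primD(2)[OF F p] primD(2)[OF G p] by auto
  show L: "Lloc p ?h" by (intro Lloc_if p primD(1)[OF F p] primD(1)[OF G p])
  then have m: "?h \<in> borel_measurable borel" by (simp add: Lloc_def)
  have left: "?H y - ?H x = (LINT s:{x..y}|lborel. ?h s)" if "x \<le> y" "y \<le> c" for x y
  proof -
    have "(LINT s:{x..y}|lborel. ?h s) = (LINT s:{x..y}|lborel. f s)"
      by (rule set_integral_cong_Icc) (use that m in auto)
    then show ?thesis using primD(4)[OF F p that(1)] that by simp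
  qed
  have right: "?H y - ?H x = (LINT s:{x..y}|lborel. ?h s)" if "x \<le> y" "c \<le> x" for x y
  proof -
    have "(LINT s:{x..y}|lborel. ?h s) = (LINT s:{x..y}|lborel. g s)"
      by (rule set_integral_cong_Icc) (use that m in auto)
    moreover have "?H x = G x" "?H y = G y"
      using that eq by (cases "x = c"; cases "y = c"; simp)+
    ultimately show ?thesis using primD(4)[OF G p that(1)] by simp
  qed
  fix x y :: real assume xy: "x \<le> y"
  consider "y \<le> c" | "c \<le> x" | "x \<le> c" "c \<le> y" by linarith
  then show "?H y - ?H x = (LINT s:{x..y}|lborel. ?h s)"
  proof cases
    case 3
    have "(LINT s:{x..y}|lborel. ?h s) = (LINT s:{x..c}|lborel. ?h s) + (LINT s:{c..y}|lborel. ?h s)"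
      by (rule set_integral_split_Icc[OF Lloc_L1[OF p L] 3])
    then show ?thesis using left[OF 3(1) order_refl] right[OF 3(2) order_refl] by linarith
  qed (use left right xy in auto)
qed

text \<open>All bounds come from the tangent inequality 1 + x <= exp x, used once from each of the
  two points.\<close>

lemma exp_second_order:
  fixes a b E :: real
  assumes "exp a \<le> E" "exp b \<le> E"
  shows "\<bar>exp b - exp a\<bar> \<le> E * \<bar>b - a\<bar>" "\<bar>exp b - exp a - exp a * (b - a)\<bar> \<le> E * (b - a)\<^sup>2"
proof -
  have 1: "exp b - exp a \<ge> exp a * (b - a)"
  proof -
    have "exp a * (1 + (b - a)) \<le> exp a * exp (b - a)"
      by (intro mult_left_mono exp_ge_add_one_self) simp
    then show ?thesis by (simp add: exp_diff algebra_simps)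
  qed
  have 2: "exp b - exp a \<le> exp b * (b - a)"
  proof -
    have "exp b * (1 + (a - b)) \<le> exp b * exp (a - b)"
      by (intro mult_left_mono exp_ge_add_one_self) simp
    then show ?thesis by (simp add: exp_diff algebra_simps)
  qed
  show A: "\<bar>exp b - exp a\<bar> \<le> E * \<bar>b - a\<bar>"
  proof (cases "a \<le> b")
    case True
    have "exp b * (b - a) \<le> E * (b - a)" using True assms by (intro mult_right_mono) auto
    moreover have "exp a \<le> exp b" using True by simp
    ultimately show ?thesis using 2 True by simp
  next
    case False
    have "exp a * (a - b) \<le> E * (a - b)" using False assms by (intro mult_right_mono) auto
    moreover have "exp b \<le> exp a" "exp a * (b - a) = - (exp a * (a - b))" using False by (auto simp: algebra_simps)
    ultimately have "\<bar>exp b - exp a\<bar> \<le> E * (a - b)" using 1 by linarith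
    moreover have "\<bar>b - a\<bar> = a - b" using False by simp
    ultimately show ?thesis by (simp only:)
  qed
  have "exp b - exp a - exp a * (b - a) \<le> (exp b - exp a) * (b - a)"
    using 2 by (simp add: algebra_simps)
  also have "\<dots> \<le> \<bar>exp b - exp a\<bar> * \<bar>b - a\<bar>" by (metis abs_ge_self abs_mult)
  also have "\<dots> \<le> E * \<bar>b - a\<bar> * \<bar>b - a\<bar>" by (rule mult_right_mono[OF A]) simp
  finally show "\<bar>exp b - exp a - exp a * (b - a)\<bar> \<le> E * (b - a)\<^sup>2"
    using 1 by (simp add: power2_eq_square mult.assoc)
qed

text \<open>As \<open>g\<close> is bounded, F is Lipschitz, so the difference of exp F and the
  integral of g exp F changes by O((v - u)^2) over [u, v]; such a function is constant.\<close>

lemma prim_exp: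
  assumes p: "1 \<le> p" and F: "prim p F g" and M: "\<And>x. \<bar>g x\<bar> \<le> M"
  shows "prim p (\<lambda>x. exp (F x)) (\<lambda>x. g x * exp (F x))"
proof -
  have cF: "continuous_on UNIV F" by (rule prim_continuous[OF F p])
  have ce: "continuous_on UNIV (\<lambda>x. exp (F x))" by (intro continuous_intros cF)
  have [measurable]: "g \<in> borel_measurable borel" "F \<in> borel_measurable borel"
    using primD(2)[OF F p] cF by (auto intro: borel_measurable_continuous_onI)
  have M0: "0 \<le> M" using M[of 0] by linarith
  have L: "Lloc p (\<lambda>x. g x * exp (F x))"
    using p by (intro Lloc_mult_bounded primD(1)[OF F p] continuous_locally_bounded ce) auto
  have "exp (F y) - exp (F x) = (LINT s:{x..y}|lborel. g s * exp (F s))" if xy: "x \<le> y" for x y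
  proof -
    define D where "D u = exp (F u) - (LINT s:{x..u}|lborel. g s * exp (F s))" for u
    obtain E where E: "\<And>s. s \<in> {x..y} \<Longrightarrow> \<bar>exp (F s)\<bar> \<le> E"
      using continuous_locally_bounded[OF ce, of x y] by blast
    have E0: "0 \<le> E" using E[of x] xy by (metis abs_ge_zero atLeastAtMost_iff order_refl order_trans)
    \<comment> \<open>Two errors, each at most E M^2 (v - u)^2: the second order remainder of exp,
      and the replacement of exp (F s) by exp (F u) under the integral.\<close>
    have incr: "\<bar>D v - D u\<bar> \<le> 2 * E * M\<^sup>2 * (v - u)\<^sup>2" if uv: "x \<le> u" "u \<le> v" "v \<le> y" for u v
    proof -
      have Fd: "\<bar>F s - F u\<bar> \<le> M * (v - u)" if s: "u \<le> s" "s \<le> v" for s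
      proof -
        have "\<bar>F s - F u\<bar> = \<bar>LINT r:{u..s}|lborel. g r\<bar>" using primD(4)[OF F p s(1)] by simp
        also have "\<dots> \<le> (LINT r:{u..s}|lborel. M)"
          unfolding set_lebesgue_integral_def
        proof (rule integral_abs_bound_integral)
          show "integrable lborel (\<lambda>r. indicator {u..s} r *\<^sub>R g r)" "integrable lborel (\<lambda>r. indicator {u..s} r *\<^sub>R M)"
            using primD(3)[OF F p] set_integrable_const_real[of u s M] by (simp_all add: set_integrable_def)
          show "\<bar>indicator {u..s} r *\<^sub>R g r\<bar> \<le> indicator {u..s} r *\<^sub>R M" for r
            using M by (auto simp: indicator_def)
        qed
        also have "\<dots> = M * (s - u)" using s by (simp add: set_lebesgue_integral_def)
        also have "\<dots> \<le> M * (v - u)" using s M0 by (intro mult_left_mono) auto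
        finally show ?thesis .
      qed
      have i1: "set_integrable lborel {u..v} (\<lambda>s. g s * exp (F s))" by (rule Lloc_L1[OF p L])
      have i2: "set_integrable lborel {u..v} (\<lambda>s. g s * exp (F u))"
        using primD(3)[OF F p] by (intro set_integrable_mult_left) auto
      have c1: "(LINT s:{x..v}|lborel. g s * exp (F s)) = (LINT s:{x..u}|lborel. g s * exp (F s)) + (LINT s:{u..v}|lborel. g s * exp (F s))"
        using uv by (intro set_integral_split_Icc Lloc_L1[OF p L]) auto
      have c2: "(LINT s:{u..v}|lborel. g s * exp (F s)) = (LINT s:{u..v}|lborel. g s * exp (F s) - g s * exp (F u)) + (LINT s:{u..v}|lborel. g s * exp (F u))"
        using i1 i2 by (simp add: set_integral_diff(2))
      have c3: "(LINT s:{u..v}|lborel. g s * exp (F u)) = exp (F u) * (F v - F u)"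
        using primD(4)[OF F p uv(2)] by (simp add: mult.commute)
      have c4: "\<bar>exp (F v) - exp (F u) - exp (F u) * (F v - F u)\<bar> \<le> E * (F v - F u)\<^sup>2"
        using E[of u] E[of v] uv by (intro exp_second_order) auto
      have c5: "E * (F v - F u)\<^sup>2 \<le> E * (M * (v - u))\<^sup>2"
        using mult_left_mono[OF power_mono[OF Fd[OF uv(2) order_refl] abs_ge_zero, of 2] E0] by simp
      have c6: "\<bar>LINT s:{u..v}|lborel. g s * exp (F s) - g s * exp (F u)\<bar> \<le> (LINT s:{u..v}|lborel. M * (E * (M * (v - u))))"
        unfolding set_lebesgue_integral_def
      proof (rule integral_abs_bound_integral)
        show "integrable lborel (\<lambda>s. indicator {u..v} s *\<^sub>R (g s * exp (F s) - g s * exp (F u)))"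
          using set_integral_diff(1)[OF i1 i2] by (simp add: set_integrable_def)
        show "integrable lborel (\<lambda>s. indicator {u..v} s *\<^sub>R (M * (E * (M * (v - u)))))"
          by (rule set_integrable_const_real[unfolded set_integrable_def])
        fix s
        show "\<bar>indicator {u..v} s *\<^sub>R (g s * exp (F s) - g s * exp (F u))\<bar> \<le> indicator {u..v} s *\<^sub>R (M * (E * (M * (v - u))))"
        proof (cases "s \<in> {u..v}")
          case True
          have "\<bar>exp (F s) - exp (F u)\<bar> \<le> E * \<bar>F s - F u\<bar>"
            using E[of u] E[of s] uv True by (intro exp_second_order) auto
          also have "\<dots> \<le> E * (M * (v - u))" using Fd[of s] True E0 by (intro mult_left_mono) auto
          finally have "\<bar>g s\<bar> * \<bar>exp (F s) - exp (F u)\<bar> \<le> M * (E * (M * (v - u)))"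
            using M M0 by (intro mult_mono) auto
          then show ?thesis using True by (simp add: abs_mult[symmetric] right_diff_distrib)
        qed simp
      qed
      have c7: "(LINT s:{u..v}|lborel. M * (E * (M * (v - u)))) = E * M\<^sup>2 * (v - u)\<^sup>2"
        using uv by (simp add: set_lebesgue_integral_def power2_eq_square)
      have c8: "E * (M * (v - u))\<^sup>2 = E * M\<^sup>2 * (v - u)\<^sup>2"
        by (simp add: power_mult_distrib)
      have "2 * E * M\<^sup>2 * (v - u)\<^sup>2 = E * M\<^sup>2 * (v - u)\<^sup>2 + E * M\<^sup>2 * (v - u)\<^sup>2"
        by simp
      then show ?thesis
        unfolding D_def using c1 c2 c3 c4 order_trans[OF c5 eq_refl[OF c8]] order_trans[OF c6 eq_refl[OF c7]]
        by linarith
    qed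
    have "D y = D x"
    proof (rule constant_if_small_increments[OF xy])
      fix e :: real assume e: "0 < e"
      define d where "d = e / (2 * E * M\<^sup>2 + 1)"
      have K0: "0 \<le> 2 * E * M\<^sup>2" using E0 by simp
      have d: "0 < d" using e K0 by (simp add: d_def)
      have "\<bar>D v - D u\<bar> \<le> e * (v - u)" if "x \<le> u" "u \<le> v" "v \<le> y" "v - u < d" for u v
      proof -
        have "2 * E * M\<^sup>2 * (v - u) \<le> (2 * E * M\<^sup>2 + 1) * d"
          using that K0 by (intro mult_mono) auto
        also have "\<dots> = e" using K0 by (simp add: d_def)
        finally have "2 * E * M\<^sup>2 * (v - u) * (v - u) \<le> e * (v - u)"
          using that by (intro mult_right_mono) auto
        then show ?thesis using incr[OF that(1-3)] by (simp add: power2_eq_square mult.assoc)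
      qed
      then show "\<exists>d>0. \<forall>u v. x \<le> u \<longrightarrow> u \<le> v \<longrightarrow> v \<le> y \<longrightarrow> v - u < d \<longrightarrow> \<bar>D v - D u\<bar> \<le> e * (v - u)"
        using d by blast
    qed
    moreover have "(LINT s:{x..x}|lborel. g s * exp (F s)) = 0"
      using set_integral_cong_Icc[of "\<lambda>s. g s * exp (F s)" "\<lambda>_. 0" x x] by (simp add: set_lebesgue_integral_def)
    ultimately show ?thesis by (simp add: D_def)
  qed
  then show ?thesis using L by (auto simp: prim_def)
qed

lemma integral_by_parts_seg:
  assumes p: "1 \<le> p" and l: "0 \<le> l" and F: "prim p F f" and G: "prim p G g"
  shows "(\<integral>x. F x * g x \<partial>seg l) = F l * G l - F 0 * G 0 - (\<integral>x. f x * G x \<partial>seg l)"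
proof -
  have [measurable]: "f \<in> borel_measurable borel" "g \<in> borel_measurable borel"
    "F \<in> borel_measurable borel" "G \<in> borel_measurable borel"
    using primD(2)[OF F p] primD(2)[OF G p] prim_continuous[OF F p] prim_continuous[OF G p]
    by (auto intro: borel_measurable_continuous_onI)
  have i1: "set_integrable lborel {0..l} (\<lambda>x. f x * G x)"
    using p by (intro Lloc_L1[OF p] Lloc_mult_bounded primD(1)[OF F p] continuous_locally_bounded prim_continuous[OF G p]) auto
  have i2: "set_integrable lborel {0..l} (\<lambda>x. g x * F x)"
    using p by (intro Lloc_L1[OF p] Lloc_mult_bounded primD(1)[OF G p] continuous_locally_bounded prim_continuous[OF F p]) auto
  have "F l * G l - F 0 * G 0 = (LINT x:{0..l}|lborel. f x * G x + g x * F x)"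
    using primD(4)[OF prim_mult[OF p F G] p l] by simp
  also have "\<dots> = (LINT x:{0..l}|lborel. f x * G x) + (LINT x:{0..l}|lborel. g x * F x)"
    by (rule set_integral_add(2)[OF i1 i2])
  also have "\<dots> = (\<integral>x. f x * G x \<partial>seg l) + (\<integral>x. F x * g x \<partial>seg l)"
    by (simp add: integral_seg_Icc mult.commute)
  finally show ?thesis by simp
qed

text \<open>A point of disagreement inside brings a whole interval of them, which is not null; the
  end points follow by closure.\<close>

lemma continuous_eq_if_AE_eq:
  fixes F G :: "real \<Rightarrow> real"
  assumes l: "0 < l" and F: "continuous_on {0..l} F" and G: "continuous_on {0..l} G"
    and ae: "AE x in seg l. F x = G x" and x: "x \<in> {0..l}"
  shows "F x = G x"
proof -
  have in_open: "F y - G y = 0" if y: "y \<in> {0<..<l}" for y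
  proof (rule ccontr)
    assume ne: "F y - G y \<noteq> 0"
    have c: "continuous_on {0<..<l} (\<lambda>y. F y - G y)"
      by (intro continuous_intros continuous_on_subset[OF F] continuous_on_subset[OF G]) auto
    have "open ({0<..<l} \<inter> (\<lambda>y. F y - G y) -` (- {0}))"
      by (rule continuous_open_preimage[OF c]) auto
    moreover have "y \<in> {0<..<l} \<inter> (\<lambda>y. F y - G y) -` (- {0})" using y ne by simp
    ultimately obtain e where e: "0 < e" "ball y e \<subseteq> {0<..<l} \<inter> (\<lambda>y. F y - G y) -` (- {0})"
      by (meson open_contains_ball)
    have "AE z in lborel. z \<in> {0<..<l} \<longrightarrow> F z = G z" using ae by (simp add: AE_seg_iff)
    then have "AE z in lborel. z \<notin> {y - e<..<y + e}"
    proof eventually_elim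
      case (elim z)
      show ?case
      proof
        assume "z \<in> {y - e<..<y + e}"
        then have "z \<in> ball y e" by (auto simp: dist_real_def)
        then show False using e(2) elim by auto
      qed
    qed
    then have "{y - e<..<y + e} \<in> null_sets lborel" by (subst (asm) AE_iff_null_sets[symmetric]) auto
    then have "emeasure lborel {y - e<..<y + e} = 0" by auto
    then show False using e(1) by simp
  qed
  have "F x - G x = 0"
  proof (rule continuous_constant_on_closure[of "{0<..<l}" "\<lambda>y. F y - G y" 0])
    show "continuous_on (closure {0<..<l}) (\<lambda>y. F y - G y)"
      using l F G by (auto intro!: continuous_intros)
  qed (use in_open x l in auto)
  then show ?thesis by simp
qed

text \<open>\<open>crep\<close> is a choice, so its values become known only through the uniqueness
  of continuous representatives.\<close>

lemma crep_eq:
  assumes l: "0 < l" and F: "continuous_on {0..l} F" and ae: "AE x in seg l. F x = f x" and x: "x \<in> {0..l}"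
  shows "crep l f x = F x"
proof -
  have "continuous_on {0..l} (crep l f) \<and> (AE x in seg l. crep l f x = f x)"
    unfolding crep_def by (rule someI[of _ F]) (use F ae in auto)
  then have c: "continuous_on {0..l} (crep l f)" and a: "AE x in seg l. crep l f x = f x" by auto
  from a ae have "AE x in seg l. crep l f x = F x" by eventually_elim simp
  from continuous_eq_if_AE_eq[OF l c F this x] show ?thesis .
qed

text \<open>A test function of integral 0 is the derivative of a test function. Subtracting from
  \<eta> the multiple of a fixed \<phi>1 that has the same integral produces such a derivative; the
  constant \<open>k\<close> is the mean of w weighted by \<phi>1.\<close>

lemma du_Bois_Reymond:
  assumes l: "0 < l" and w: "integrable (seg l) w"
    and z: "\<And>\<phi> \<phi>'. tst l \<phi> \<phi>' \<Longrightarrow> (\<integral>x. w x * \<phi>' x \<partial>seg l) = 0"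
  obtains k where "AE x in seg l. w x = k"
proof -
  have tst_int: "integrable (seg l) (\<lambda>x. f x * \<phi> x)" if t: "tst l \<phi> \<phi>'" and f: "integrable (seg l) f" for f \<phi> \<phi>'
  proof -
    obtain B where "\<And>x. \<bar>\<phi> x\<bar> \<le> B" using tst_bounded[OF t] by metis
    then show ?thesis
      using f tstD(5)[OF t] by (intro integrable_mult_bounded[where B = B] measurable_seg_borel) auto
  qed
  \<comment> \<open>If all test functions had integral 0, \<open>fundamental_lemma\<close> would
    make the constant 1 vanish almost everywhere.\<close>
  have "\<exists>\<phi> \<phi>'. tst l \<phi> \<phi>' \<and> (\<integral>x. 1 * \<phi> x \<partial>seg l) \<noteq> 0"
  proof (rule ccontr)
    assume "\<not> ?thesis"
    then have "AE x in seg l. (1::real) = 0"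
      by (intro fundamental_lemma[OF l]) auto
    then have "AE x in lborel. x \<notin> {0<..<l}" by (simp add: AE_seg_iff)
    then have "{0<..<l} \<in> null_sets lborel" by (subst (asm) AE_iff_null_sets[symmetric]) auto
    then have "emeasure lborel {0<..<l} = 0" by auto
    then show False using l by simp
  qed
  then obtain \<phi>1 \<phi>1' where \<phi>1: "tst l \<phi>1 \<phi>1'" "(\<integral>x. \<phi>1 x \<partial>seg l) \<noteq> 0" by auto
  define J where "J = (\<integral>x. \<phi>1 x \<partial>seg l)"
  define k where "k = (\<integral>x. w x * \<phi>1 x \<partial>seg l) / J"
  have J: "J \<noteq> 0" using \<phi>1(2) by (simp add: J_def)
  have i1: "integrable (seg l) \<phi>1" using tst_int[OF \<phi>1(1) integrable_seg_const[of _ 1]] by simp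
  have "AE x in seg l. w x - k = 0"
  proof (rule fundamental_lemma[OF l])
    show "integrable (seg l) (\<lambda>x. w x - k)" using w by (intro Bochner_Integration.integrable_diff) auto
    fix \<eta> \<eta>' assume \<eta>: "tst l \<eta> \<eta>'"
    have i2: "integrable (seg l) \<eta>" using tst_int[OF \<eta> integrable_seg_const[of _ 1]] by simp
    define I where "I = (\<integral>x. \<eta> x \<partial>seg l)"
    define \<zeta> where "\<zeta> x = \<eta> x - I / J * \<phi>1 x" for x
    obtain c1 d1 where cd1: "0 < c1" "c1 \<le> d1" "d1 < l" "\<forall>x. x \<notin> {c1..d1} \<longrightarrow> \<phi>1 x = 0"
      using \<phi>1(1) unfolding tst_def by auto
    obtain c2 d2 where cd2: "0 < c2" "c2 \<le> d2" "d2 < l" "\<forall>x. x \<notin> {c2..d2} \<longrightarrow> \<eta> x = 0"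
      using \<eta> unfolding tst_def by auto
    define c where "c = min c1 c2"
    define d where "d = max d1 d2"
    have cd: "0 < c" "c \<le> d" "d < l" using cd1 cd2 by (auto simp: c_def d_def)
    have \<zeta>0: "\<zeta> x = 0" if "x \<notin> {c..d}" for x
    proof -
      have "x \<notin> {c1..d1}" "x \<notin> {c2..d2}" using that by (auto simp: c_def d_def)
      then show ?thesis using cd1 cd2 by (simp add: \<zeta>_def)
    qed
    have \<zeta>c: "continuous_on S \<zeta>" for S
      unfolding \<zeta>_def
      by (intro continuous_intros continuous_on_subset[OF tstD(3)[OF \<eta>]] continuous_on_subset[OF tstD(3)[OF \<phi>1(1)]]) auto
    have \<zeta>I: "(\<integral>x. \<zeta> x \<partial>seg l) = 0"
      unfolding \<zeta>_def using i1 i2 J by (simp add: I_def[symmetric] J_def[symmetric])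
    \<comment> \<open>The base point -1 lies to the left of the support, so every x >= c is interior
      to the interval from -1 to x + 1 and the derivative within that interval is a full one; for x
      < c the function is locally 0.\<close>
    define \<Phi> where "\<Phi> x = integral {-1..x} \<zeta>" for x
    have \<Phi>left: "\<Phi> x = 0" if "x < c" for x
      unfolding \<Phi>_def using that \<zeta>0 by (intro integral_unique has_integral_is_0) auto
    have \<Phi>d: "(\<Phi> has_real_derivative \<zeta> x) (at x)" for x
    proof (cases "x < c")
      case True
      have "((\<lambda>x. 0) has_real_derivative \<zeta> x) (at x)" using True \<zeta>0[of x] by simp
      then show ?thesis
        by (rule has_field_derivative_transform_within_open[of _ _ _ "{..<c}"]) (use \<Phi>left True in auto)
    next
      case False
      have "(\<Phi> has_real_derivative \<zeta> x) (at x within {-1..x + 1})"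
        unfolding \<Phi>_def[abs_def] using False cd by (intro integral_has_real_derivative \<zeta>c) auto
      moreover have "at x within {-1..x + 1} = at x"
        using False cd by (intro at_within_Icc_at) auto
      ultimately show ?thesis by simp
    qed
    have \<Phi>0: "\<Phi> x = 0" if "x \<notin> {c..d}" for x
    proof (cases "x < c")
      case False
      then have x: "d < x" using that by auto
      have "\<Phi> x = (LINT s:{-1..x}|lborel. \<zeta> s)"
        unfolding \<Phi>_def using set_borel_integral_eq_integral(2)[OF borel_integrable_atLeastAtMost'[OF \<zeta>c]] by simp
      also have "\<dots> = (\<integral>x. \<zeta> x \<partial>seg l)"
        unfolding integral_seg set_lebesgue_integral_def
      proof (rule Bochner_Integration.integral_cong[OF refl])
        fix s
        show "indicator {- 1..x} s *\<^sub>R \<zeta> s = indicator {0<..<l} s * \<zeta> s"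
          using \<zeta>0[of s] x cd by (cases "s \<in> {c..d}") (auto simp: indicator_def)
      qed
      finally show ?thesis using \<zeta>I by simp
    qed (rule \<Phi>left)
    have "tst l \<Phi> \<zeta>"
      unfolding tst_def using \<Phi>d \<zeta>c \<Phi>0 cd by blast
    then have "0 = (\<integral>x. w x * \<zeta> x \<partial>seg l)" using z by simp
    also have "\<dots> = (\<integral>x. w x * \<eta> x - I / J * (w x * \<phi>1 x) \<partial>seg l)"
      by (rule Bochner_Integration.integral_cong) (auto simp: \<zeta>_def algebra_simps)
    also have "\<dots> = (\<integral>x. w x * \<eta> x \<partial>seg l) - I * k"
      using tst_int[OF \<eta> w] tst_int[OF \<phi>1(1) w] by (simp add: k_def)
    also have "\<dots> = (\<integral>x. (w x - k) * \<eta> x \<partial>seg l)"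
      using tst_int[OF \<eta> w] i2 by (simp add: left_diff_distrib I_def)
    finally show "(\<integral>x. (w x - k) * \<eta> x \<partial>seg l) = 0" by simp
  qed
  then show ?thesis by (intro that[of k]) simp
qed

text \<open>The primitive of the weak derivative, extended by 0 outside the segment, differs from f
  by a function orthogonal to all derivatives of test functions, hence by a constant.\<close>

lemma W1p_representative:
  assumes p: "1 \<le> p" and l: "0 < l" and f: "f \<in> W1p p l" and g: "g \<in> Lp p l" "weak_deriv l f g"
  obtains F where "prim p F (\<lambda>x. indicator {0<..<l} x * g x)" "AE x in seg l. F x = f x"
proof -
  let ?g = "\<lambda>x. indicator {0<..<l} x * g x"
  have fL: "f \<in> Lp p l" using f by (simp add: W1p_def)
  have mg[measurable]: "?g \<in> borel_measurable borel"
    using LpD(1)[OF g(1)] measurable_seg_iff by blast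
  have gi: "integrable lborel ?g"
    using Lp_L1(1)[OF p _ g(1)] l by (simp add: integrable_seg)
  have gp: "integrable lborel (\<lambda>x. \<bar>?g x\<bar> powr p)"
  proof -
    have "(\<lambda>x. \<bar>?g x\<bar> powr p) = (\<lambda>x. indicator {0<..<l} x * \<bar>g x\<bar> powr p)"
      by (auto simp: indicator_def fun_eq_iff)
    then show ?thesis using LpD(2)[OF g(1)] by (simp add: integrable_seg)
  qed
  have Ll: "Lloc p ?g"
    unfolding Lloc_def set_integrable_def
    by (intro conjI allI mg integrable_mult_indicator[OF _ gp]) simp
  define G where "G x = (\<integral>s. ?g s * indicator {..x} s \<partial>lborel)" for x
  have G: "prim p G ?g" unfolding G_def by (rule prim_indefinite_integral[OF Ll gi])
  have cG: "continuous_on UNIV G" by (rule prim_continuous[OF G p])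
  obtain B where B: "\<And>x. x \<in> {0..l} \<Longrightarrow> \<bar>G x\<bar> \<le> B" using continuous_locally_bounded[OF cG] by metis
  have Gi: "integrable (seg l) G"
  proof -
    have "integrable (seg l) (\<lambda>x. 1 * G x)"
    proof (rule integrable_mult_bounded)
      show "G \<in> borel_measurable (seg l)"
        by (intro measurable_seg_borel borel_measurable_continuous_onI cG)
      show "\<bar>G x\<bar> \<le> B" if "x \<in> space (seg l)" for x using B[of x] that by simp
    qed simp
    then show ?thesis by simp
  qed
  have fi: "integrable (seg l) f" using Lp_L1(1)[OF p _ fL] l by simp
  obtain k where k: "AE x in seg l. f x - G x = k"
  proof (rule du_Bois_Reymond[OF l, of "\<lambda>x. f x - G x"])
    show "integrable (seg l) (\<lambda>x. f x - G x)" using fi Gi by simp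
    fix \<phi> \<phi>' assume \<phi>: "tst l \<phi> \<phi>'"
    obtain C where C: "\<And>x. \<bar>\<phi>' x\<bar> \<le> C" using tst_bounded[OF \<phi>] by metis
    have ii: "integrable (seg l) (\<lambda>x. h x * \<phi>' x)" if "integrable (seg l) h" for h
      using that tstD(6)[OF \<phi>] C by (intro integrable_mult_bounded[where B = C] measurable_seg_borel) auto
    have "(\<integral>x. f x * \<phi>' x \<partial>seg l) = - (\<integral>x. g x * \<phi> x \<partial>seg l)"
      using g(2) \<phi> unfolding weak_deriv_def tst_def by blast
    moreover have "(\<integral>x. G x * \<phi>' x \<partial>seg l) = - (\<integral>x. ?g x * \<phi> x \<partial>seg l)"
      using integral_by_parts_seg[OF p _ G prim_C1[OF p tstD(1,2)[OF \<phi>]], of l] l tstD(4)[OF \<phi>] by simp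
    moreover have "(\<integral>x. ?g x * \<phi> x \<partial>seg l) = (\<integral>x. g x * \<phi> x \<partial>seg l)"
      by (rule Bochner_Integration.integral_cong) auto
    ultimately show "(\<integral>x. (f x - G x) * \<phi>' x \<partial>seg l) = 0"
      using ii[OF fi] ii[OF Gi] by (simp add: left_diff_distrib)
  qed (rule that)
  show ?thesis
  proof (rule that[of "\<lambda>x. G x + k"])
    show "prim p (\<lambda>x. G x + k) ?g"
      using prim_add[OF p G prim_const[of p k]] p by simp
    show "AE x in seg l. G x + k = f x" using k by eventually_elim simp
  qed
qed

lemma W1p_if_prim:
  assumes p: "1 \<le> p" and l: "0 < l" and F: "prim p F g"
    and f: "f \<in> borel_measurable (seg l)" "AE x in seg l. F x = f x"
  shows "f \<in> W1p p l" "x \<in> {0..l} \<Longrightarrow> crep l f x = F x"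
proof -
  have cF: "continuous_on UNIV F" by (rule prim_continuous[OF F p])
  show "x \<in> {0..l} \<Longrightarrow> crep l f x = F x"
    by (rule crep_eq[OF l continuous_on_subset[OF cF] f(2)]) auto
  obtain B where B: "\<And>x. x \<in> {0..l} \<Longrightarrow> \<bar>F x\<bar> \<le> B" using continuous_locally_bounded[OF cF] by metis
  have mF: "F \<in> borel_measurable (seg l)"
    using cF by (intro measurable_seg_borel borel_measurable_continuous_onI)
  have FL: "F \<in> Lp p l"
    using mF B p by (intro Lp_bounded[where B = B]) auto
  have fL: "f \<in> Lp p l" by (rule Lp_cong_AE[OF FL f])
  have mg: "g \<in> borel_measurable borel" by (rule primD(2)[OF F p])
  have "g \<in> Lp p l"
    unfolding Lp_def
  proof (safe intro!: measurable_seg_borel mg)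
    have s: "set_integrable lborel {0<..<l} (\<lambda>x. \<bar>g x\<bar> powr p)"
      by (rule set_integrable_subset[of lborel "{0..l}"]) (use primD(1)[OF F p] in \<open>auto simp: Lloc_def\<close>)
    then show "integrable (seg l) (\<lambda>x. \<bar>g x\<bar> powr p)"
      by (simp add: integrable_seg set_integrable_def)
  qed
  moreover have "weak_deriv l f g"
    unfolding weak_deriv_def
  proof (intro allI impI)
    fix \<phi> \<phi>' assume "\<forall>x. (\<phi> has_real_derivative \<phi>' x) (at x)" "continuous_on UNIV \<phi>'"
      "\<exists>c d. 0 < c \<and> c \<le> d \<and> d < l \<and> (\<forall>x. x \<notin> {c..d} \<longrightarrow> \<phi> x = 0)"
    then have \<phi>: "tst l \<phi> \<phi>'" by (simp add: tst_def)
    have "(\<integral>x. f x * \<phi>' x \<partial>seg l) = (\<integral>x. F x * \<phi>' x \<partial>seg l)"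
    proof (rule integral_cong_AE)
      show "AE x in seg l. f x * \<phi>' x = F x * \<phi>' x" using f(2) by eventually_elim simp
    qed (use f(1) mF measurable_seg_borel[OF tstD(6)[OF \<phi>]] in measurable)
    also have "\<dots> = - (\<integral>x. g x * \<phi> x \<partial>seg l)"
      using integral_by_parts_seg[OF p _ F prim_C1[OF p tstD(1,2)[OF \<phi>]], of l] l tstD(4)[OF \<phi>] by simp
    finally show "(\<integral>x. f x * \<phi>' x \<partial>seg l) = - (\<integral>x. g x * \<phi> x \<partial>seg l)" .
  qed
  ultimately show "f \<in> W1p p l" using fL by (auto simp: W1p_def)
qed

context generated
begin

lemma D_representative:
  assumes "v \<in> D"
  shows "\<exists>F. \<forall>i\<in>{1..N}. prim p (F i) (\<lambda>x. indicator {0<..<L i} x * wderiv p (L i) (v i) x) \<and>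
    (AE x in seg (L i). F i x = v i x) \<and> (\<forall>x\<in>{0..L i}. crep (L i) (v i) x = F i x) \<and>
    F i 0 = (\<Sum>j=1..N. m i j * F j (L j))"
proof -
  have W: "v i \<in> W1p p (L i)" if "i \<in> {1..N}" for i using assms that by (auto simp: domA_def)
  have "\<exists>F. prim p F (\<lambda>x. indicator {0<..<L i} x * wderiv p (L i) (v i) x) \<and> (AE x in seg (L i). F x = v i x)"
    if i: "i \<in> {1..N}" for i
    using W1p_representative[OF p L[OF i] W[OF i] wderivI[OF W[OF i]]] by metis
  then obtain F where F: "\<And>i. i \<in> {1..N} \<Longrightarrow> prim p (F i) (\<lambda>x. indicator {0<..<L i} x * wderiv p (L i) (v i) x)"
    "\<And>i. i \<in> {1..N} \<Longrightarrow> AE x in seg (L i). F i x = v i x"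
    by metis
  have cr: "crep (L i) (v i) x = F i x" if i: "i \<in> {1..N}" and x: "x \<in> {0..L i}" for i x
    by (rule crep_eq[OF L[OF i] continuous_on_subset[OF prim_continuous[OF F(1)[OF i] p]] F(2)[OF i] x]) simp
  have "F i 0 = (\<Sum>j=1..N. m i j * F j (L j))" if i: "i \<in> {1..N}" for i
  proof -
    have "F i 0 = crep (L i) (v i) 0" using cr[OF i, of 0] L[OF i] by simp
    also have "\<dots> = (\<Sum>j=1..N. m i j * crep (L j) (v j) (L j))" using assms i by (simp add: domA_def)
    also have "\<dots> = (\<Sum>j=1..N. m i j * F j (L j))"
      using cr L by (intro sum.cong refl arg_cong2[where f = "(*)"]) (auto simp: less_imp_le)
    finally show ?thesis .
  qed
  then show ?thesis using F cr by (intro exI[of _ F] ballI conjI)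
qed

text \<open>Integration by parts on each edge leaves the fluxes at both ends. They cancel in the sum
  over the edges because \<open>bc\<close>, with the transposed matrix and the ends exchanged, is
  the adjoint of the boundary condition of \<open>domA\<close>.\<close>

lemma opA_duality:
  assumes v: "v \<in> D"
    and \<psi>: "\<And>i x. i \<in> {1..N} \<Longrightarrow> (\<psi> i has_real_derivative \<psi>' i x) (at x)"
      "\<And>i. i \<in> {1..N} \<Longrightarrow> continuous_on UNIV (\<psi>' i)"
    and bc: "\<And>j. j \<in> {1..N} \<Longrightarrow> \<psi> j (L j) = (\<Sum>i=1..N. m i j * \<psi> i 0)"
  shows "pair (opA p L v) \<psi> = pair v \<psi>'"
proof -
  obtain F where F0: "\<forall>i\<in>{1..N}. prim p (F i) (\<lambda>x. indicator {0<..<L i} x * wderiv p (L i) (v i) x) \<and>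
    (AE x in seg (L i). F i x = v i x) \<and> (\<forall>x\<in>{0..L i}. crep (L i) (v i) x = F i x) \<and>
    F i 0 = (\<Sum>j=1..N. m i j * F j (L j))"
    using D_representative[OF v] ..
  have F: "\<And>i. i \<in> {1..N} \<Longrightarrow> prim p (F i) (\<lambda>x. indicator {0<..<L i} x * wderiv p (L i) (v i) x)"
    "\<And>i. i \<in> {1..N} \<Longrightarrow> AE x in seg (L i). F i x = v i x"
    "\<And>i. i \<in> {1..N} \<Longrightarrow> F i 0 = (\<Sum>j=1..N. m i j * F j (L j))"
    by (drule bspec[OF F0], elim conjE, assumption)+
  have each: "(\<integral>x. opA p L v i x * \<psi> i x \<partial>seg (L i)) = (\<integral>x. v i x * \<psi>' i x \<partial>seg (L i)) - F i (L i) * \<psi> i (L i) + F i 0 * \<psi> i 0"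
    if i: "i \<in> {1..N}" for i
  proof -
    have "(\<integral>x. opA p L v i x * \<psi> i x \<partial>seg (L i)) = - (\<integral>x. indicator {0<..<L i} x * wderiv p (L i) (v i) x * \<psi> i x \<partial>seg (L i))"
      by (subst Bochner_Integration.integral_minus[symmetric]) (rule Bochner_Integration.integral_cong, auto simp: opA_def)
    also have "\<dots> = (\<integral>x. F i x * \<psi>' i x \<partial>seg (L i)) - F i (L i) * \<psi> i (L i) + F i 0 * \<psi> i 0"
      using integral_by_parts_seg[OF p less_imp_le[OF L[OF i]] F(1)[OF i] prim_C1[OF p \<psi>[OF i]]] by simp
    also have "(\<integral>x. F i x * \<psi>' i x \<partial>seg (L i)) = (\<integral>x. v i x * \<psi>' i x \<partial>seg (L i))"
    proof (rule integral_cong_AE)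
      show "AE x in seg (L i). F i x * \<psi>' i x = v i x * \<psi>' i x" using F(2)[OF i] by eventually_elim simp
      have m: "\<psi>' i \<in> borel_measurable (seg (L i))"
        using \<psi>(2)[OF i] by (intro measurable_seg_borel borel_measurable_continuous_onI)
      have mF: "F i \<in> borel_measurable (seg (L i))"
        using prim_continuous[OF F(1)[OF i] p] by (intro measurable_seg_borel borel_measurable_continuous_onI)
      show "(\<lambda>x. F i x * \<psi>' i x) \<in> borel_measurable (seg (L i))" "(\<lambda>x. v i x * \<psi>' i x) \<in> borel_measurable (seg (L i))"
        using m mF LpD(1)[OF XD[OF DX[OF v] i]] by auto
    qed
    finally show ?thesis .
  qed
  have "(\<Sum>i=1..N. F i 0 * \<psi> i 0) = (\<Sum>i=1..N. \<Sum>j=1..N. m i j * F j (L j) * \<psi> i 0)"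
    by (intro sum.cong refl) (simp add: F(3) sum_distrib_right)
  also have "\<dots> = (\<Sum>j=1..N. \<Sum>i=1..N. m i j * F j (L j) * \<psi> i 0)" by (rule sum.swap)
  also have "\<dots> = (\<Sum>j=1..N. F j (L j) * \<psi> j (L j))"
    by (intro sum.cong refl) (simp add: bc sum_distrib_left mult_ac)
  finally have bdry: "(\<Sum>i=1..N. F i 0 * \<psi> i 0) = (\<Sum>j=1..N. F j (L j) * \<psi> j (L j))" .
  have "pair (opA p L v) \<psi> = (\<Sum>i=1..N. (\<integral>x. v i x * \<psi>' i x \<partial>seg (L i)) - F i (L i) * \<psi> i (L i) + F i 0 * \<psi> i 0)"
    unfolding pair_def by (intro sum.cong refl each)
  also have "\<dots> = pair v \<psi>'"
    unfolding pair_def using bdry by (simp add: sum.distrib sum_subtractf)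
  finally show ?thesis .
qed

end

section \<open>Short-time duality\<close>

lemma tst_uniform_taylor:
  assumes t: "tst l \<phi> \<phi>'" and w: "0 < w"
  obtains d where "0 < d" "\<And>y h. 0 \<le> h \<Longrightarrow> h < d \<Longrightarrow> \<bar>\<phi> (y + h) - \<phi> y - h * \<phi>' y\<bar> \<le> w * h"
proof -
  \<comment> \<open>With a margin of 1 on each side, two points closer than 1 either both lie in
    this compact interval or both lie outside ]0, l[, where \<phi>' vanishes.\<close>
  have "uniformly_continuous_on {-1..l + 1} \<phi>'"
    by (rule compact_uniformly_continuous[OF continuous_on_subset[OF tstD(2)[OF t]]]) auto
  then obtain d where d: "0 < d" "\<And>x y. x \<in> {-1..l + 1} \<Longrightarrow> y \<in> {-1..l + 1} \<Longrightarrow> dist y x < d \<Longrightarrow> dist (\<phi>' y) (\<phi>' x) < w"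
    unfolding uniformly_continuous_on_def using w by blast
  have uc: "\<bar>\<phi>' y - \<phi>' x\<bar> \<le> w" if "\<bar>y - x\<bar> < min d 1" for x y
  proof (cases "x \<in> {-1..l + 1} \<and> y \<in> {-1..l + 1}")
    case True
    then show ?thesis using d(2)[of x y] that by (simp add: dist_real_def)
  next
    case False
    then have "x \<notin> {0<..<l}" "y \<notin> {0<..<l}" using that by auto
    then show ?thesis using tst_deriv_outside[OF t] w by simp
  qed
  show ?thesis
  proof (rule that[of "min d 1"])
    show "0 < min d 1" using d(1) by simp
    fix y h :: real assume h: "0 \<le> h" "h < min d 1"
    show "\<bar>\<phi> (y + h) - \<phi> y - h * \<phi>' y\<bar> \<le> w * h"
    proof (cases "h = 0")
      case False
      then have "y < y + h" using h by simp
      from MVT2[OF this, of \<phi> \<phi>'] tstD(1)[OF t] obtain z where z: "y < z" "z < y + h" "\<phi> (y + h) - \<phi> y = (y + h - y) * \<phi>' z"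
        by blast
      have "\<bar>\<phi>' z - \<phi>' y\<bar> \<le> w" by (rule uc) (use z h in auto)
      then have "h * \<bar>\<phi>' z - \<phi>' y\<bar> \<le> h * w" using h by (intro mult_left_mono) auto
      moreover have "\<phi> (y + h) - \<phi> y - h * \<phi>' y = h * (\<phi>' z - \<phi>' y)"
        using z(3) by (simp add: right_diff_distrib)
      ultimately show ?thesis using h by (simp add: abs_mult mult.commute)
    qed simp
  qed
qed

context generated
begin

text \<open>For \<open>h \<le> Lmin\<close>, \<open>psi h\<close> is the action of the adjoint of \<open>T h\<close> on test functions, which are
  extended by zero outside their interval: transport to the left, and mass leaving edge \<open>k\<close> at its
  start re-enters edge \<open>j\<close> at its end with weight \<open>m k j\<close>.\<close>

definition psi :: "real \<Rightarrow> state \<Rightarrow> state" where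
  "psi h \<phi> = (\<lambda>j x. \<phi> j (x + h) + (\<Sum>k=1..N. m k j * \<phi> k (x + h - L j)))"

text \<open>A bound for \<open>psi h\<close> in the supremum norm, see \<open>psi_bound\<close>: the
  1 is for the transported part, and the double sum dominates every column of the matrix.\<close>

definition Km :: real where "Km = 1 + (\<Sum>j=1..N. \<Sum>k=1..N. \<bar>m k j\<bar>)"

definition Lmin :: real where "Lmin = Min (L ` {1..N})"

lemma Lmin: "0 < Lmin" "\<And>i. i \<in> {1..N} \<Longrightarrow> Lmin \<le> L i"
proof -
  have ne: "L ` {1..N} \<noteq> {}" using N by auto
  show "0 < Lmin" unfolding Lmin_def using ne L by (subst Min_gr_iff) auto
  show "\<And>i. i \<in> {1..N} \<Longrightarrow> Lmin \<le> L i" unfolding Lmin_def by (intro Min_le) auto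
qed

lemma Km: "1 \<le> Km" by (simp add: Km_def sum_nonneg)

lemma psi_bound:
  assumes B: "\<And>i x. i \<in> {1..N} \<Longrightarrow> \<bar>\<phi> i x\<bar> \<le> B" and j: "j \<in> {1..N}"
  shows "\<bar>psi h \<phi> j x\<bar> \<le> Km * B"
proof -
  have B0: "0 \<le> B" using B[OF j, of 0] by linarith
  have "\<bar>psi h \<phi> j x\<bar> \<le> \<bar>\<phi> j (x + h)\<bar> + (\<Sum>k=1..N. \<bar>m k j * \<phi> k (x + h - L j)\<bar>)"
    unfolding psi_def by (intro order_trans[OF abs_triangle_ineq] add_mono sum_abs order_refl)
  also have "\<dots> \<le> B + (\<Sum>k=1..N. \<bar>m k j\<bar> * B)"
    using B j by (intro add_mono sum_mono) (auto simp: abs_mult intro!: mult_left_mono)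
  also have "(\<Sum>k=1..N. \<bar>m k j\<bar> * B) = (\<Sum>k=1..N. \<bar>m k j\<bar>) * B" by (simp add: sum_distrib_right)
  also have "\<dots> \<le> (\<Sum>j=1..N. \<Sum>k=1..N. \<bar>m k j\<bar>) * B"
    using j B0 by (intro mult_right_mono member_le_sum sum_nonneg) auto
  finally show ?thesis by (simp add: Km_def distrib_right)
qed

lemma psi_measurable:
  assumes "\<And>i. i \<in> {1..N} \<Longrightarrow> \<phi> i \<in> borel_measurable borel" "j \<in> {1..N}"
  shows "psi h \<phi> j \<in> borel_measurable borel"
proof -
  have [measurable]: "(\<lambda>x. \<phi> k (x + c)) \<in> borel_measurable borel" if "k \<in> {1..N}" for k c
    using assms(1)[OF that] by measurable
  have "(\<lambda>x. \<phi> k (x + h - L j)) \<in> borel_measurable borel" if "k \<in> {1..N}" for k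
    using assms(1)[OF that] by measurable
  then show ?thesis
    unfolding psi_def using assms(2) by (intro borel_measurable_add borel_measurable_sum borel_measurable_times) auto
qed

lemma bmeas_tests: "tests \<phi> \<phi>' \<Longrightarrow> bmeas \<phi>" "tests \<phi> \<phi>' \<Longrightarrow> bmeas \<phi>'"
proof -
  have "bmeas \<phi> \<and> bmeas \<phi>'" if ts: "tests \<phi> \<phi>'"
  proof -
    obtain B where B: "0 < B" "\<And>i x. i \<in> {1..N} \<Longrightarrow> \<bar>\<phi> i x\<bar> \<le> B" "\<And>i x. i \<in> {1..N} \<Longrightarrow> \<bar>\<phi>' i x\<bar> \<le> B"
      using tests_bounded[OF ts] by blast
    have "\<phi> i \<in> borel_measurable borel \<and> \<phi>' i \<in> borel_measurable borel" if "i \<in> {1..N}" for i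
      using ts that tstD(5,6)[of "L i" "\<phi> i" "\<phi>' i"] by (simp add: tests_def)
    then show ?thesis
      unfolding bmeas_def using B(2,3) by blast
  qed
  then show "tests \<phi> \<phi>' \<Longrightarrow> bmeas \<phi>" "tests \<phi> \<phi>' \<Longrightarrow> bmeas \<phi>'" by auto
qed

lemma bmeas_psi:
  assumes "tests \<phi> \<phi>'"
  shows "bmeas (psi h \<phi>)" "bmeas (psi h \<phi>')"
proof -
  obtain B where B0: "0 < B" and B: "\<And>i x. i \<in> {1..N} \<Longrightarrow> \<bar>\<phi> i x\<bar> \<le> B" "\<And>i x. i \<in> {1..N} \<Longrightarrow> \<bar>\<phi>' i x\<bar> \<le> B"
    using tests_bounded[OF assms] by blast
  have m: "\<And>i. i \<in> {1..N} \<Longrightarrow> \<phi> i \<in> borel_measurable borel" "\<And>i. i \<in> {1..N} \<Longrightarrow> \<phi>' i \<in> borel_measurable borel"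
    using bmeas_tests[OF assms] by (auto simp: bmeas_def)
  show "bmeas (psi h \<phi>)" "bmeas (psi h \<phi>')"
    unfolding bmeas_def
    using psi_measurable[of \<phi>, OF m(1)] psi_measurable[of \<phi>', OF m(2)] psi_bound[of \<phi>, OF B(1)] psi_bound[of \<phi>', OF B(2)]
    by blast+
qed

lemma psi_deriv:
  assumes "tests \<phi> \<phi>'" "j \<in> {1..N}"
  shows "(psi h \<phi> j has_real_derivative psi h \<phi>' j x) (at x)" "continuous_on UNIV (psi h \<phi>' j)"
proof -
  have t: "tst (L k) (\<phi> k) (\<phi>' k)" if "k \<in> {1..N}" for k using assms(1) that by (simp add: tests_def)
  have d: "((\<lambda>x. \<phi> k (x + c)) has_real_derivative \<phi>' k (x + c)) (at x)" if "k \<in> {1..N}" for k c x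
  proof -
    have "((\<lambda>x. x + c) has_real_derivative 1) (at x)" by (auto intro!: derivative_eq_intros)
    from DERIV_chain2[OF tstD(1)[OF t[OF that]] this] show ?thesis by simp
  qed
  have "((\<lambda>x. \<phi> j (x + h) + (\<Sum>k=1..N. m k j * \<phi> k (x + (h - L j)))) has_real_derivative
      \<phi>' j (x + h) + (\<Sum>k=1..N. m k j * \<phi>' k (x + (h - L j)))) (at x)"
    by (intro DERIV_add DERIV_sum DERIV_cmult d assms)
  then show "(psi h \<phi> j has_real_derivative psi h \<phi>' j x) (at x)"
    unfolding psi_def by (simp add: add_diff_eq)
  have c: "continuous_on UNIV (\<lambda>x. \<phi>' k (x + c))" if "k \<in> {1..N}" for k c
    by (rule continuous_on_compose2[OF tstD(2)[OF t[OF that]]]) (auto intro!: continuous_intros)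
  have "continuous_on UNIV (\<lambda>x. \<phi>' j (x + h) + (\<Sum>k=1..N. m k j * \<phi>' k (x + (h - L j))))"
    by (intro continuous_intros c assms)
  then show "continuous_on UNIV (psi h \<phi>' j)"
    unfolding psi_def by (simp add: add_diff_eq)
qed

text \<open>Here \<open>h \<le> Lmin\<close> enters: \<phi> vanishes at h - L i <= 0 and at L j + h,
  so the value at 0 is pure transport and the value at L j is pure re-entry. This makes
  \<open>psi h \<phi>\<close> admissible in \<open>opA_duality\<close>.\<close>

lemma psi_boundary:
  assumes t: "tests \<phi> \<phi>'" and h: "0 \<le> h" "h \<le> Lmin" and j: "j \<in> {1..N}"
  shows "psi h \<phi> j (L j) = (\<Sum>i=1..N. m i j * psi h \<phi> i 0)"
proof -
  have z: "\<phi> k x = 0" if "k \<in> {1..N}" "x \<notin> {0<..<L k}" for k x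
  proof -
    have "tst (L k) (\<phi> k) (\<phi>' k)" using t that(1) by (simp add: tests_def)
    from tstD(4)[OF this that(2)] show ?thesis .
  qed
  have "psi h \<phi> i 0 = \<phi> i h" if i: "i \<in> {1..N}" for i
    unfolding psi_def using Lmin(2)[OF i] h z by (auto intro!: sum.neutral)
  then show ?thesis
    using z[OF j, of "L j + h"] h by (simp add: psi_def)
qed

text \<open>Both traces of a test function are 0, which satisfies the boundary condition trivially;
  with \<open>tests_dense\<close> the domain is dense.\<close>

lemma tests_D:
  assumes "tests \<phi> \<phi>'"
  shows "\<phi> \<in> D"
proof -
  have t: "tst (L k) (\<phi> k) (\<phi>' k)" if "k \<in> {1..N}" for k using assms(1) that by (simp add: tests_def)
  have W: "\<phi> k \<in> W1p p (L k) \<and> (\<forall>x\<in>{0..L k}. crep (L k) (\<phi> k) x = \<phi> k x)" if k: "k \<in> {1..N}" for k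
    using W1p_if_prim[OF p L[OF k] prim_C1[OF p tstD(1,2)[OF t[OF k]]] measurable_seg_borel[OF tstD(5)[OF t[OF k]]]]
    by auto
  have cr: "crep (L k) (\<phi> k) 0 = 0" "crep (L k) (\<phi> k) (L k) = 0" if k: "k \<in> {1..N}" for k
    using W[OF k] L[OF k] tstD(4)[OF t[OF k]] by auto
  show ?thesis
    unfolding domA_def using W cr by simp
qed

text \<open>Time is moved from the semigroup to its adjoint:
  \<open>pair (T s u) (psi (t - s) \<phi>)\<close> does not depend on s. Since the generator
  supplies right derivatives only, this is shown through increments, and the bound \<open>M\<close>
  makes the errors small uniformly in s.\<close>

lemma T_duality_D:
  assumes \<delta>: "\<delta> \<le> Lmin" and M: "0 < M" "\<And>t u. 0 \<le> t \<Longrightarrow> t \<le> \<delta> \<Longrightarrow> u \<in> X \<Longrightarrow> NX (T t u) \<le> M * NX u"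
    and u: "u \<in> D" and ts: "tests \<phi> \<phi>'" and t: "0 \<le> t" "t \<le> \<delta>"
  shows "pair (T t u) \<phi> = pair u (psi t \<phi>)"
proof -
  define f where "f s = pair (T s u) (psi (t - s) \<phi>)" for s
  have uX: "u \<in> X" "opA p L u \<in> X" using u by (auto intro: DX opA_X)
  obtain B where B: "0 < B" "\<And>i x. i \<in> {1..N} \<Longrightarrow> \<bar>\<phi> i x\<bar> \<le> B" "\<And>i x. i \<in> {1..N} \<Longrightarrow> \<bar>\<phi>' i x\<bar> \<le> B"
    using tests_bounded[OF ts] by blast
  define R where "R h = scale (1 / h) (T h u - u) - opA p L u" for h
  have RX: "R h \<in> X" if "0 < h" for h
    unfolding R_def using that uX by (intro X_diff X_scale T_X) auto
  have "f t = f 0"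
  proof (rule constant_if_small_increments[OF t(1)])
    fix e :: real assume e: "0 < e"
    have half: "0 < e / (2 * K)" "K * (e / (2 * K)) = e / 2" if "0 < K" for K
      using that e by auto
    \<comment> \<open>\<open>e1\<close> limits the error \<open>R h\<close> of the difference
      quotient at time 0, and \<open>w\<close> below that of the Taylor expansion of \<phi>; each is
      scaled to contribute at most e / 2 per unit of time.\<close>
    define e1 where "e1 = e / (2 * (Km * B * Ctot * M))"
    have c1: "0 < Km * B * Ctot * M" using Km B(1) Ctot(2) M(1) by simp
    have e1: "0 < e1" "Km * B * Ctot * M * e1 = e / 2"
      unfolding e1_def by (rule half[OF c1])+
    have "eventually (\<lambda>h. NX (R h) < e1) (at_right 0)"
      using rd_opA[OF u] unfolding rd_def R_def by (rule order_tendstoD) (rule e1)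
    then obtain d1 where d1: "0 < d1" "\<And>h. 0 < h \<Longrightarrow> h < d1 \<Longrightarrow> NX (R h) < e1"
      by (auto simp: eventually_at_right_field)
    define w where "w = e / (2 * (Km * Ctot * M * (NX u + 1)))"
    have c2: "0 < Km * Ctot * M * (NX u + 1)" using Km Ctot(2) M(1) NX_nonneg[of u] by (simp add: add_nonneg_pos)
    have w: "0 < w" "Km * Ctot * M * (NX u + 1) * w = e / 2"
      unfolding w_def by (rule half[OF c2])+
    have "\<forall>i\<in>{1..N}. \<exists>d. 0 < d \<and> (\<forall>y h. 0 \<le> h \<longrightarrow> h < d \<longrightarrow> \<bar>\<phi> i (y + h) - \<phi> i y - h * \<phi>' i y\<bar> \<le> w * h)"
    proof
      fix i assume "i \<in> {1..N}"
      then have "tst (L i) (\<phi> i) (\<phi>' i)" using ts by (simp add: tests_def)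
      from tst_uniform_taylor[OF this w(1)]
      show "\<exists>d. 0 < d \<and> (\<forall>y h. 0 \<le> h \<longrightarrow> h < d \<longrightarrow> \<bar>\<phi> i (y + h) - \<phi> i y - h * \<phi>' i y\<bar> \<le> w * h)"
        by metis
    qed
    from bchoice[OF this] obtain d2 where "\<forall>i\<in>{1..N}. 0 < d2 i \<and> (\<forall>y h. 0 \<le> h \<longrightarrow> h < d2 i \<longrightarrow> \<bar>\<phi> i (y + h) - \<phi> i y - h * \<phi>' i y\<bar> \<le> w * h)"
      ..
    then have d2: "\<And>i. i \<in> {1..N} \<Longrightarrow> 0 < d2 i"
      "\<And>i y h. i \<in> {1..N} \<Longrightarrow> 0 \<le> h \<Longrightarrow> h < d2 i \<Longrightarrow> \<bar>\<phi> i (y + h) - \<phi> i y - h * \<phi>' i y\<bar> \<le> w * h"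
      by blast+
    define d3 where "d3 = Min (d2 ` {1..N})"
    have ne: "d2 ` {1..N} \<noteq> {}" using N by auto
    have d3: "0 < d3" unfolding d3_def using ne d2(1) by (subst Min_gr_iff) auto
    have d3_le: "d3 \<le> d2 i" if "i \<in> {1..N}" for i unfolding d3_def using that by (intro Min_le) auto
    have small: "\<bar>f v - f s\<bar> \<le> e * (v - s)" if sv: "0 \<le> s" "s \<le> v" "v \<le> t" "v - s < min d1 d3" for s v
    proof (cases "s = v")
      case False
      define h where "h = v - s"
      have h: "0 < h" "h < d1" "h < d3" "v = s + h" using sv False by (auto simp: h_def)
      define \<tau> where "\<tau> = t - s - h"
      have \<tau>: "0 \<le> \<tau>" "\<tau> \<le> Lmin" "t - s = \<tau> + h" using sv h t \<delta> by (auto simp: \<tau>_def)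
      have s: "0 \<le> s" "s \<le> \<delta>" using sv t by auto
      have sX: "T s u \<in> X" "T s (opA p L u) \<in> X" "T s (R h) \<in> X" "T h (T s u) \<in> X"
        using uX s h RX by (auto intro!: T_X)
      have b\<psi>: "bmeas (psi \<tau> \<phi>)" "bmeas (psi \<tau> \<phi>')" "bmeas (psi (\<tau> + h) \<phi>)" using bmeas_psi[OF ts] by auto
      have "pair (T v u) (psi \<tau> \<phi>) = pair (T h (T s u)) (psi \<tau> \<phi>)"
        using T_sg[of h s u] h s uX sX by (intro pair_cong[OF b\<psi>(1)] T_X) (auto simp: add.commute)
      moreover have "pair (scale (1 / h) (T h (T s u) - T s u) - T s (opA p L u)) (psi \<tau> \<phi>) = pair (T s (R h)) (psi \<tau> \<phi>)"
        using T_difference_quotient[OF s(1) h(1) u] sX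
        by (intro pair_cong[OF b\<psi>(1)]) (auto simp: R_def intro!: X_diff X_scale)
      then have "1 / h * (pair (T h (T s u)) (psi \<tau> \<phi>) - pair (T s u) (psi \<tau> \<phi>)) - pair (T s (opA p L u)) (psi \<tau> \<phi>) = pair (T s (R h)) (psi \<tau> \<phi>)"
        using sX by (simp add: pair_diff_left[OF b\<psi>(1)] pair_scale_left X_diff X_scale)
      then have "pair (T h (T s u)) (psi \<tau> \<phi>) - pair (T s u) (psi \<tau> \<phi>) = h * pair (T s (opA p L u)) (psi \<tau> \<phi>) + h * pair (T s (R h)) (psi \<tau> \<phi>)"
        using h by (simp add: field_simps)
      moreover have "pair (T s (opA p L u)) (psi \<tau> \<phi>) = pair (T s u) (psi \<tau> \<phi>')"
      proof -
        have "pair (T s (opA p L u)) (psi \<tau> \<phi>) = pair (opA p L (T s u)) (psi \<tau> \<phi>)"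
          using T_D[OF s(1) u] by (intro pair_cong[OF b\<psi>(1)] sX opA_X) (auto intro: Xeq_sym)
        also have "\<dots> = pair (T s u) (psi \<tau> \<phi>')"
          by (rule opA_duality[OF T_D(1)[OF s(1) u] psi_deriv[OF ts] psi_boundary[OF ts \<tau>(1,2)]])
        finally show ?thesis .
      qed
      moreover have "f v = pair (T v u) (psi \<tau> \<phi>)" "f s = pair (T s u) (psi (\<tau> + h) \<phi>)"
        by (simp_all add: f_def \<tau>(3)) (simp add: \<tau>_def h_def)
      ultimately have "f v - f s = h * pair (T s (R h)) (psi \<tau> \<phi>)
          + (h * pair (T s u) (psi \<tau> \<phi>') + pair (T s u) (psi \<tau> \<phi>) - pair (T s u) (psi (\<tau> + h) \<phi>))"
        by simp
      moreover have "\<bar>pair (T s (R h)) (psi \<tau> \<phi>)\<bar> \<le> e / 2"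
      proof -
        have "\<bar>pair (T s (R h)) (psi \<tau> \<phi>)\<bar> \<le> Km * B * Ctot * NX (T s (R h))"
          using psi_bound[OF B(2)] b\<psi>(1) Km B(1) by (intro pair_bound sX) (auto simp: bmeas_def)
        also have "\<dots> \<le> Km * B * Ctot * (M * e1)"
          using M(2)[OF s RX[OF h(1)]] d1(2)[OF h(1,2)] M(1) Km B(1) Ctot(3)
          by (intro mult_left_mono order_trans[OF M(2)[OF s RX[OF h(1)]]]) (auto intro: less_imp_le)
        finally show ?thesis using e1(2) by (simp add: mult.assoc)
      qed
      moreover have "\<bar>h * pair (T s u) (psi \<tau> \<phi>') + pair (T s u) (psi \<tau> \<phi>) - pair (T s u) (psi (\<tau> + h) \<phi>)\<bar> \<le> h * (e / 2)"
      proof -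
        define \<theta> where "\<theta> = (\<lambda>i x. \<phi> i (x + h) - \<phi> i x - h * \<phi>' i x)"
        have b\<theta>: "\<bar>\<theta> i x\<bar> \<le> w * h" if "i \<in> {1..N}" for i x
          unfolding \<theta>_def using d2(2)[OF that, of h x] h d3_le[OF that] by simp
        \<comment> \<open>\<open>psi\<close> is linear and commutes with translations, so the Taylor
          remainder of \<open>psi (\<tau> + h) \<phi>\<close> in h is \<open>psi \<tau>\<close>
          applied to the remainder \<theta> of \<phi>, which is uniformly small.\<close>
        have eq: "psi \<tau> \<theta> j x = psi (\<tau> + h) \<phi> j x - psi \<tau> \<phi> j x - h * psi \<tau> \<phi>' j x" for j x
          unfolding psi_def \<theta>_def
          by (simp add: right_diff_distrib distrib_left sum_subtractf sum.distrib sum_distrib_left algebra_simps)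
        have m\<theta>: "psi \<tau> \<theta> i \<in> borel_measurable borel" if "i \<in> {1..N}" for i
        proof -
          have "(\<lambda>x. psi (\<tau> + h) \<phi> i x - psi \<tau> \<phi> i x - h * psi \<tau> \<phi>' i x) \<in> borel_measurable borel"
            by (intro borel_measurable_diff borel_measurable_times borel_measurable_const)
               (use b\<psi> that in \<open>simp_all add: bmeas_def\<close>)
          then show ?thesis by (simp add: eq[symmetric])
        qed
        have "pair (T s u) (psi \<tau> \<theta>) = pair (T s u) (psi (\<tau> + h) \<phi>) - pair (T s u) (psi \<tau> \<phi>) - h * pair (T s u) (psi \<tau> \<phi>')"
          unfolding pair_def sum_subtractf[symmetric] sum_distrib_left
        proof (rule sum.cong[OF refl])
          fix i assume i: "i \<in> {1..N}"
          note int = bmeas_integrable[OF _ X_L1(1)[OF sX(1)] i]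
          have "(\<integral>x. T s u i x * psi \<tau> \<theta> i x \<partial>seg (L i)) = (\<integral>x. T s u i x * psi (\<tau> + h) \<phi> i x - T s u i x * psi \<tau> \<phi> i x
              - h * (T s u i x * psi \<tau> \<phi>' i x) \<partial>seg (L i))"
            by (rule Bochner_Integration.integral_cong) (auto simp: eq algebra_simps)
          also have "\<dots> = (\<integral>x. T s u i x * psi (\<tau> + h) \<phi> i x \<partial>seg (L i)) - (\<integral>x. T s u i x * psi \<tau> \<phi> i x \<partial>seg (L i))
              - h * (\<integral>x. T s u i x * psi \<tau> \<phi>' i x \<partial>seg (L i))"
            using int[OF b\<psi>(1)] int[OF b\<psi>(2)] int[OF b\<psi>(3)] by simp
          finally show "(\<integral>x. T s u i x * psi \<tau> \<theta> i x \<partial>seg (L i)) = (\<integral>x. T s u i x * psi (\<tau> + h) \<phi> i x \<partial>seg (L i)) - (\<integral>x. T s u i x * psi \<tau> \<phi> i x \<partial>seg (L i))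
              - h * (\<integral>x. T s u i x * psi \<tau> \<phi>' i x \<partial>seg (L i))" .
        qed
        moreover have "\<bar>pair (T s u) (psi \<tau> \<theta>)\<bar> \<le> Km * (w * h) * Ctot * NX (T s u)"
          using psi_bound[OF b\<theta>] m\<theta> Km w h by (intro pair_bound sX) auto
        moreover have "Km * (w * h) * Ctot * NX (T s u) \<le> Km * (w * h) * Ctot * (M * (NX u + 1))"
        proof (rule mult_left_mono)
          have "M * NX u \<le> M * (NX u + 1)" using M(1) by (intro mult_left_mono) auto
          then show "NX (T s u) \<le> M * (NX u + 1)" using M(2)[OF s uX(1)] by linarith
          show "0 \<le> Km * (w * h) * Ctot" using Km w h Ctot(3) by simp
        qed
        moreover have "Km * (w * h) * Ctot * (M * (NX u + 1)) = h * (e / 2)"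
          using w(2) by (simp add: mult_ac)
        ultimately show ?thesis by linarith
      qed
      moreover have "\<bar>h * pair (T s (R h)) (psi \<tau> \<phi>)\<bar> \<le> h * (e / 2)"
        using calculation(2) h(1) by (simp add: abs_mult)
      ultimately have "\<bar>f v - f s\<bar> \<le> h * (e / 2) + h * (e / 2)" by linarith
      then show ?thesis by (simp add: h_def mult.commute)
    qed simp
    show "\<exists>d>0. \<forall>s v. 0 \<le> s \<longrightarrow> s \<le> v \<longrightarrow> v \<le> t \<longrightarrow> v - s < d \<longrightarrow> \<bar>f v - f s\<bar> \<le> e * (v - s)"
      using small d1(1) d3 by (intro exI[of _ "min d1 d3"]) auto
  qed
  moreover have "f 0 = pair u (psi t \<phi>)"
    unfolding f_def using bmeas_psi(1)[OF ts] uX T_0[OF uX(1)] by (auto intro!: pair_cong T_X)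
  moreover have "f t = pair (T t u) \<phi>"
  proof -
    \<comment> \<open>At time 0 the re-entry terms of \<open>psi\<close> are evaluated at x - L i <
      0, where test functions vanish.\<close>
    have "(\<integral>x. T t u i x * psi 0 \<phi> i x \<partial>seg (L i)) = (\<integral>x. T t u i x * \<phi> i x \<partial>seg (L i))" if i: "i \<in> {1..N}" for i
    proof (rule Bochner_Integration.integral_cong[OF refl])
      fix x assume "x \<in> space (seg (L i))"
      then have "\<phi> k (x - L i) = 0" if "k \<in> {1..N}" for k
        using ts that tstD(4)[of "L k" "\<phi> k" "\<phi>' k" "x - L i"] by (auto simp: tests_def)
      then show "T t u i x * psi 0 \<phi> i x = T t u i x * \<phi> i x"
        by (simp add: psi_def)
    qed
    then show ?thesis by (simp add: f_def pair_def)
  qed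
  ultimately show ?thesis by simp
qed

text \<open>Both sides are continuous in u, and test functions form a dense part of the domain, on
  which \<open>T_duality_D\<close> applies.\<close>

lemma T_duality_local:
  obtains \<delta> where "0 < \<delta>" "\<delta> \<le> Lmin"
    "\<And>t u \<phi> \<phi>'. 0 \<le> t \<Longrightarrow> t \<le> \<delta> \<Longrightarrow> u \<in> X \<Longrightarrow> tests \<phi> \<phi>' \<Longrightarrow> pair (T t u) \<phi> = pair u (psi t \<phi>)"
proof -
  obtain \<delta>0 M where M: "0 < \<delta>0" "0 < M" "\<And>t u. 0 \<le> t \<Longrightarrow> t \<le> \<delta>0 \<Longrightarrow> u \<in> X \<Longrightarrow> NX (T t u) \<le> M * NX u"
    using T_locally_bounded by blast
  define \<delta> where "\<delta> = min \<delta>0 Lmin"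
  have M': "\<And>t u. 0 \<le> t \<Longrightarrow> t \<le> \<delta> \<Longrightarrow> u \<in> X \<Longrightarrow> NX (T t u) \<le> M * NX u"
    using M(3) by (simp add: \<delta>_def)
  have \<delta>: "\<delta> \<le> Lmin" by (simp add: \<delta>_def)
  have "pair (T t u) \<phi> = pair u (psi t \<phi>)" if t: "0 \<le> t" "t \<le> \<delta>" and u: "u \<in> X" and ts: "tests \<phi> \<phi>'" for t u \<phi> \<phi>'
  proof -
    obtain B where B: "0 < B" "\<And>i x. i \<in> {1..N} \<Longrightarrow> \<bar>\<phi> i x\<bar> \<le> B" "\<And>i x. i \<in> {1..N} \<Longrightarrow> \<bar>\<phi>' i x\<bar> \<le> B"
      using tests_bounded[OF ts] by blast
    note b = bmeas_tests(1)[OF ts] bmeas_psi(1)[OF ts, of t]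
    define C where "C = B * Ctot * M + Km * B * Ctot"
    have C: "0 < C" unfolding C_def using B(1) Ctot(2) M(2) Km by (intro add_pos_pos) auto
    have "\<bar>pair (T t u) \<phi> - pair u (psi t \<phi>)\<bar> \<le> e" if e: "0 < e" for e
    proof -
      obtain v v' where v: "tests v v'" "NX (u - v) < e / C"
        using tests_dense[OF u, of "e / C"] e C by auto
      have vX: "v \<in> X" "u - v \<in> X" using tests_X(1)[OF v(1)] u by (auto intro: X_diff)
      have "pair (T t v) \<phi> = pair v (psi t \<phi>)"
        by (rule T_duality_D[OF \<delta> M(2) M' tests_D[OF v(1)] ts t])
      then have "pair (T t u) \<phi> - pair u (psi t \<phi>) = pair (T t u - T t v) \<phi> - pair (u - v) (psi t \<phi>)"
        using u vX t by (simp add: pair_diff_left[OF b(1)] pair_diff_left[OF b(2)] T_X)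
      also have "pair (T t u - T t v) \<phi> = pair (T t (u - v)) \<phi>"
        using T_diff[OF t(1) u vX(1)] t u vX by (intro pair_cong[OF b(1)] X_diff T_X) (auto intro: Xeq_sym)
      finally have eq: "pair (T t u) \<phi> - pair u (psi t \<phi>) = pair (T t (u - v)) \<phi> - pair (u - v) (psi t \<phi>)" .
      have "\<bar>pair (T t (u - v)) \<phi>\<bar> \<le> B * Ctot * NX (T t (u - v))"
        using b(1) B t vX by (intro pair_bound T_X) (auto simp: bmeas_def)
      also have "\<dots> \<le> B * Ctot * (M * NX (u - v))"
        using M'[OF t vX(2)] B(1) Ctot(3) by (intro mult_left_mono) auto
      finally have 1: "\<bar>pair (T t (u - v)) \<phi>\<bar> \<le> B * Ctot * M * NX (u - v)" by (simp add: mult.assoc)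
      have 2: "\<bar>pair (u - v) (psi t \<phi>)\<bar> \<le> Km * B * Ctot * NX (u - v)"
        using b(2) psi_bound[OF B(2)] vX Km B(1) by (intro pair_bound) (auto simp: bmeas_def)
      have "C * NX (u - v) \<le> C * (e / C)" using v(2) C by (intro mult_left_mono) auto
      moreover have "C * NX (u - v) = B * Ctot * M * NX (u - v) + Km * B * Ctot * NX (u - v)"
        by (simp add: C_def distrib_right)
      ultimately show ?thesis using 1 2 C unfolding eq by simp
    qed
    then have "\<bar>pair (T t u) \<phi> - pair u (psi t \<phi>)\<bar> \<le> 0" by (rule field_le_epsilon) simp
    then show ?thesis by simp
  qed
  then show ?thesis
    using M(1) Lmin(1) \<delta> by (intro that[of \<delta>]) (auto simp: \<delta>_def)
qed

end

section \<open>Mild solutions\<close>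

context state_space
begin

lemma pair_sum_left:
  assumes "bmeas \<phi>" "finite I" "\<And>i. i \<in> I \<Longrightarrow> f i \<in> X"
  shows "pair (\<Sum>i\<in>I. f i) \<phi> = (\<Sum>i\<in>I. pair (f i) \<phi>)"
  using assms(2,3)
proof (induction I rule: finite_induct)
  case empty
  then show ?case by (simp add: pair_def zero_fun_def)
next
  case (insert i I)
  have A: "pair (f i + sum f I) \<phi> = pair (f i) \<phi> + pair (sum f I) \<phi>"
    using insert by (intro pair_add_left[OF assms(1)] X_sum) auto
  have IH: "pair (sum f I) \<phi> = (\<Sum>i\<in>I. pair (f i) \<phi>)"
    using insert by blast
  show ?case unfolding sum.insert[OF insert(1,2)] A IH ..
qed

lemma pair_Xnorm_bound:
  assumes "bmeas \<phi>"
  obtains C where "0 < C" "\<And>u. u \<in> X \<Longrightarrow> \<bar>pair u \<phi>\<bar> \<le> C * Xnorm p N L u"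
proof -
  obtain B where B: "\<And>i x. i \<in> {1..N} \<Longrightarrow> x \<in> {0<..<L i} \<Longrightarrow> \<bar>\<phi> i x\<bar> \<le> B"
    using assms unfolding bmeas_def by blast
  have nn: "0 \<le> Xnorm p N L u" for u by (simp add: Xnorm_def)
  have "\<bar>pair u \<phi>\<bar> \<le> ((\<bar>B\<bar> + 1) * Ctot * real N) * Xnorm p N L u" if "u \<in> X" for u
  proof -
    have "\<bar>\<phi> i x\<bar> \<le> \<bar>B\<bar> + 1" if "i \<in> {1..N}" "x \<in> {0<..<L i}" for i x
      using B[OF that] by linarith
    then have "\<bar>pair u \<phi>\<bar> \<le> (\<bar>B\<bar> + 1) * Ctot * NX u"
      using assms by (intro pair_bound that) (auto simp: bmeas_def)
    also have "\<dots> \<le> (\<bar>B\<bar> + 1) * Ctot * (real N * Xnorm p N L u)"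
      using Ctot(3) by (intro mult_left_mono NX_le) auto
    finally show ?thesis by (simp add: mult.assoc)
  qed
  moreover have "0 < (\<bar>B\<bar> + 1) * Ctot * real N" using Ctot(2) N by simp
  ultimately show ?thesis using that by blast
qed

lemma simple_integral_X:
  assumes "simple_on p N L t s"
  shows "simple_integral_on t s \<in> X"
  unfolding simple_integral_on_def using assms by (intro X_sum X_scale) (auto simp: simple_on_def)

lemma simple_pair_has_integral:
  assumes s: "simple_on p N L t s" and b: "bmeas \<phi>"
  shows "((\<lambda>\<tau>. pair (s \<tau>) \<phi>) has_integral pair (simple_integral_on t s) \<phi>) {0..t}"
proof -
  define V where "V = s ` {0..t}"
  define A where "A v = {\<tau> \<in> {0..t}. s \<tau> = v}" for v
  have V: "finite V" "\<And>v. v \<in> V \<Longrightarrow> v \<in> X" "\<And>v. A v \<in> sets borel"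
    using s by (auto simp: simple_on_def V_def A_def)
  have 1: "((\<lambda>\<tau>. (if \<tau> \<in> A v then 1 else 0) * pair v \<phi>) has_integral measure lborel (A v) * pair v \<phi>) {0..t}" for v
  proof (rule has_integral_mult_left)
    have "emeasure lborel (A v) \<le> emeasure lborel {0..t}" by (rule emeasure_mono) (auto simp: A_def)
    also have "\<dots> < \<infinity>" by (simp add: emeasure_lborel_Icc_eq)
    finally have "((\<lambda>x. 1) has_integral measure lborel (A v)) (A v)" by (intro has_integral_measure_lborel V)
    moreover have "A v \<subseteq> {0..t}" by (auto simp: A_def)
    ultimately show "((\<lambda>\<tau>. if \<tau> \<in> A v then 1 else 0) has_integral measure lborel (A v)) {0..t}"
      by (subst has_integral_restrict)
  qed
  have "((\<lambda>\<tau>. \<Sum>v\<in>V. (if \<tau> \<in> A v then 1 else 0) * pair v \<phi>) has_integral (\<Sum>v\<in>V. measure lborel (A v) * pair v \<phi>)) {0..t}"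
    by (rule has_integral_sum[OF V(1) 1])
  then have int: "((\<lambda>\<tau>. pair (s \<tau>) \<phi>) has_integral (\<Sum>v\<in>V. measure lborel (A v) * pair v \<phi>)) {0..t}"
  proof (rule has_integral_eq[rotated])
    fix \<tau> assume \<tau>: "\<tau> \<in> {0..t}"
    show "(\<Sum>v\<in>V. (if \<tau> \<in> A v then 1 else 0) * pair v \<phi>) = pair (s \<tau>) \<phi>"
    proof -
    have "(\<Sum>v\<in>V. (if \<tau> \<in> A v then 1 else 0) * pair v \<phi>) = (\<Sum>v\<in>V. if v = s \<tau> then pair v \<phi> else 0)"
      using \<tau> by (intro sum.cong) (auto simp: A_def)
    also have "\<dots> = pair (s \<tau>) \<phi>" using V(1) \<tau> by (simp add: V_def)
    finally show ?thesis .
    qed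
  qed
  have "pair (simple_integral_on t s) \<phi> = (\<Sum>v\<in>V. measure lborel (A v) * pair v \<phi>)"
    unfolding simple_integral_on_def V_def[symmetric] A_def[symmetric]
    using V by (simp add: pair_sum_left[OF b] X_scale pair_scale_left)
  with int show ?thesis by (simp only:)
qed

text \<open>The pairing with a fixed multiplier commutes with the Bochner integral. Since the integrand need
  not be Borel, the scalar integral is taken in the sense of Henstock and Kurzweil and squeezed
  between approximations.\<close>

lemma X_integral_pair:
  assumes H: "has_X_integral p N L t F w" and b: "bmeas \<phi>"
  shows "((\<lambda>\<tau>. pair (F \<tau>) \<phi>) has_integral pair w \<phi>) {0..t}"
proof -
  have FX: "\<And>\<tau>. \<tau> \<in> {0..t} \<Longrightarrow> F \<tau> \<in> X" and wX: "w \<in> X"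
    using H by (auto simp: has_X_integral_def)
  let ?M = "restrict_space lborel {0..t}"
  have "\<exists>s. (\<forall>k::nat. simple_on p N L t (s k)) \<and>
    (\<forall>k. (\<lambda>\<tau>. Xnorm p N L (F \<tau> - s k \<tau>)) \<in> borel_measurable ?M) \<and>
    (\<lambda>k. \<integral>\<^sup>+\<tau>. ennreal (Xnorm p N L (F \<tau> - s k \<tau>)) \<partial>?M) \<longlonglongrightarrow> 0 \<and>
    (\<lambda>k. Xnorm p N L (simple_integral_on t (s k) - w)) \<longlonglongrightarrow> 0"
    using H unfolding has_X_integral_def by (elim conjE)
  then obtain s where s: "\<And>k::nat. simple_on p N L t (s k)"
    and sm: "\<And>k. (\<lambda>\<tau>. Xnorm p N L (F \<tau> - s k \<tau>)) \<in> borel_measurable ?M"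
    and sl: "(\<lambda>k. \<integral>\<^sup>+\<tau>. ennreal (Xnorm p N L (F \<tau> - s k \<tau>)) \<partial>?M) \<longlonglongrightarrow> 0"
    and si: "(\<lambda>k. Xnorm p N L (simple_integral_on t (s k) - w)) \<longlonglongrightarrow> 0"
    by blast
  define e where "e k \<tau> = Xnorm p N L (F \<tau> - s k \<tau>)" for k \<tau>
  have nn: "0 \<le> Xnorm p N L u" for u by (simp add: Xnorm_def)
  have sX: "s k \<tau> \<in> X" if "\<tau> \<in> {0..t}" for k \<tau>
    using s[of k] that by (auto simp: simple_on_def)
  obtain C where C: "0 < C" "\<And>u. u \<in> X \<Longrightarrow> \<bar>pair u \<phi>\<bar> \<le> C * Xnorm p N L u"
    using pair_Xnorm_bound[OF b] by blast
  define R where "R k = pair (simple_integral_on t (s k)) \<phi>" for k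
  have r: "((\<lambda>\<tau>. pair (s k \<tau>) \<phi>) has_integral R k) {0..t}" for k
    unfolding R_def by (rule simple_pair_has_integral[OF s b])
  have close: "\<bar>pair (F \<tau>) \<phi> - pair (s k \<tau>) \<phi>\<bar> \<le> C * e k \<tau>" if "\<tau> \<in> {0..t}" for k \<tau>
    using C(2)[OF X_diff[OF FX[OF that] sX[OF that]]]
    by (simp add: pair_diff_left[OF b FX[OF that] sX[OF that]] e_def)
  \<comment> \<open>The definition of the Bochner integral makes the error functions
    \<open>e k\<close> measurable, whatever the pairing itself may be, so their integrals exist and
    become small.\<close>
  have approx: "\<exists>k J. (e k has_integral J) {0..t} \<and> J < \<epsilon> \<and> \<bar>R k - pair w \<phi>\<bar> < \<epsilon>" if "0 < \<epsilon>" for \<epsilon>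
  proof -
    have "eventually (\<lambda>k. (\<integral>\<^sup>+\<tau>. ennreal (e k \<tau>) \<partial>?M) < ennreal \<epsilon>) sequentially"
      using sl that unfolding e_def by (intro order_tendstoD(2)) auto
    moreover have "eventually (\<lambda>k. Xnorm p N L (simple_integral_on t (s k) - w) < \<epsilon> / C) sequentially"
      using si that C(1) by (intro order_tendstoD(2)) auto
    ultimately have "eventually (\<lambda>k. (\<integral>\<^sup>+\<tau>. ennreal (e k \<tau>) \<partial>?M) < ennreal \<epsilon> \<and>
        Xnorm p N L (simple_integral_on t (s k) - w) < \<epsilon> / C) sequentially"
      by (rule eventually_conj)
    then obtain k where k: "(\<integral>\<^sup>+\<tau>. ennreal (e k \<tau>) \<partial>?M) < ennreal \<epsilon>"
      "Xnorm p N L (simple_integral_on t (s k) - w) < \<epsilon> / C"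
      by (auto simp: eventually_sequentially)
    have int: "integrable ?M (e k)"
      by (rule integrableI_bounded)
         (use sm[of k] k(1) nn in \<open>auto simp: e_def[abs_def] order_less_trans[OF _ ennreal_less_top]\<close>)
    have Jeq: "(\<integral>\<^sup>+\<tau>. ennreal (e k \<tau>) \<partial>?M) = ennreal (\<integral>\<tau>. e k \<tau> \<partial>?M)"
      by (rule nn_integral_eq_integral[OF int]) (simp add: e_def nn)
    have J: "(\<integral>\<tau>. e k \<tau> \<partial>?M) < \<epsilon>"
    proof -
      have "0 \<le> (\<integral>\<tau>. e k \<tau> \<partial>?M)" by (rule integral_nonneg_AE) (simp add: e_def nn)
      then show ?thesis using k(1) unfolding Jeq by (simp only: ennreal_less_iff)
    qed
    have si: "set_integrable lborel {0..t} (e k)"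
      using int unfolding set_integrable_def by (subst (asm) integrable_restrict_space) auto
    have "(e k has_integral (LINT \<tau>:{0..t}|lborel. e k \<tau>)) {0..t}"
      using set_borel_integral_eq_integral[OF si] by (simp add: has_integral_integral)
    moreover have "(LINT \<tau>:{0..t}|lborel. e k \<tau>) = (\<integral>\<tau>. e k \<tau> \<partial>?M)"
      unfolding set_lebesgue_integral_def by (subst integral_restrict_space) auto
    moreover have "\<bar>R k - pair w \<phi>\<bar> < \<epsilon>"
    proof -
      have "\<bar>R k - pair w \<phi>\<bar> \<le> C * Xnorm p N L (simple_integral_on t (s k) - w)"
        unfolding R_def using C(2)[OF X_diff[OF simple_integral_X[OF s] wX]]
        by (simp add: pair_diff_left[OF b simple_integral_X[OF s] wX])
      also have "\<dots> < \<epsilon>" using k(2) C(1) by (simp add: pos_less_divide_eq mult.commute)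
      finally show ?thesis .
    qed
    ultimately show ?thesis using J by auto
  qed
  have bounds: "((\<lambda>\<tau>. pair (s k \<tau>) \<phi> - C * e k \<tau>) has_integral R k - C * J) {0..t}"
    "((\<lambda>\<tau>. pair (s k \<tau>) \<phi> + C * e k \<tau>) has_integral R k + C * J) {0..t}"
    if "(e k has_integral J) {0..t}" for k J
    by (intro has_integral_diff has_integral_add has_integral_mult_right r that)+
  have le: "pair (s k \<tau>) \<phi> - C * e k \<tau> \<le> pair (F \<tau>) \<phi>" "pair (F \<tau>) \<phi> \<le> pair (s k \<tau>) \<phi> + C * e k \<tau>"
    if "\<tau> \<in> {0..t}" for k \<tau>
    using close[OF that, of k] by linarith+
  \<comment> \<open>The lower and upper functions are the pairing with the simple function minus and
    plus \<open>C * e k\<close>; their integrals differ by \<open>2 * C * J\<close>.\<close>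
  have int: "(\<lambda>\<tau>. pair (F \<tau>) \<phi>) integrable_on {0..t}"
  proof (rule integrable_straddle)
    fix \<epsilon> :: real assume "0 < \<epsilon>"
    then have "0 < \<epsilon> / (2 * C)" using C(1) by simp
    from approx[OF this] obtain k J where J: "(e k has_integral J) {0..t}" "J < \<epsilon> / (2 * C)" by blast
    have "0 \<le> J" using J(1) by (rule has_integral_nonneg) (simp add: e_def nn)
    have "\<bar>(R k - C * J) - (R k + C * J)\<bar> = 2 * C * J" using C(1) \<open>0 \<le> J\<close> by simp
    also have "\<dots> < \<epsilon>" using J(2) C(1) by (simp add: pos_less_divide_eq mult.commute)
    finally show "\<exists>g h i j. (g has_integral i) {0..t} \<and> (h has_integral j) {0..t} \<and> \<bar>i - j\<bar> < \<epsilon> \<and>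
        (\<forall>x\<in>{0..t}. g x \<le> pair (F x) \<phi> \<and> pair (F x) \<phi> \<le> h x)"
      using bounds[OF J(1)] le by blast
  qed
  then obtain A where A: "((\<lambda>\<tau>. pair (F \<tau>) \<phi>) has_integral A) {0..t}" by blast
  have "\<bar>A - pair w \<phi>\<bar> \<le> \<epsilon>" if "0 < \<epsilon>" for \<epsilon>
  proof -
    have "0 < \<epsilon> / (C + 1)" using that C(1) by simp
    from approx[OF this] obtain k J where J: "(e k has_integral J) {0..t}" "J < \<epsilon> / (C + 1)" "\<bar>R k - pair w \<phi>\<bar> < \<epsilon> / (C + 1)" by blast
    have "R k - C * J \<le> A" "A \<le> R k + C * J"
      using has_integral_le[OF bounds(1)[OF J(1)] A le(1)] has_integral_le[OF A bounds(2)[OF J(1)] le(2)] by auto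
    moreover have "C * J \<le> C * (\<epsilon> / (C + 1))" using J(2) C(1) by (intro mult_left_mono) auto
    moreover have "C * (\<epsilon> / (C + 1)) + \<epsilon> / (C + 1) = \<epsilon>"
    proof -
      have "C * (\<epsilon> / (C + 1)) + \<epsilon> / (C + 1) = (C + 1) * (\<epsilon> / (C + 1))" by (simp only: distrib_right mult_1)
      then show ?thesis using C(1) by simp
    qed
    ultimately show ?thesis using J(3) by linarith
  qed
  then have "\<bar>A - pair w \<phi>\<bar> \<le> 0" by (rule field_le_epsilon) simp
  then show ?thesis using A by simp
qed

end

text \<open>The assumptions speak of all edges, with \<open>a i \<le> b i\<close> weakly, so that an
  uncontrolled edge fits in as one whose control window is the single point
  \<open>L i\<close>.\<close>

locale controlled = generated +
  fixes Nd :: nat and a b :: "nat \<Rightarrow> real" and \<alpha> :: "nat \<Rightarrow> real \<Rightarrow> real"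
    and z0 :: state and z :: "real \<Rightarrow> state"
  assumes Nd: "Nd \<le> N"
    and ab: "\<And>i. i \<in> {1..N} \<Longrightarrow> 0 \<le> a i \<and> a i \<le> b i \<and> b i \<le> L i"
    and \<alpha>_meas: "\<And>i. i \<in> {1..N} \<Longrightarrow> \<alpha> i \<in> borel_measurable borel"
    and \<alpha>_bound: "\<And>i. i \<in> {1..N} \<Longrightarrow> AE s in lborel. 0 \<le> \<alpha> i s \<and> \<alpha> i s \<le> 1"
    and uncontrolled: "\<And>i. i \<in> {Nd+1..N} \<Longrightarrow> a i = L i \<and> b i = L i"
    and z0: "z0 \<in> domA p N L m"
    and mild: "mild_solution p N Nd L a b \<alpha> T z0 z"
begin

definition ff :: "real \<Rightarrow> state" where
  "ff \<tau> = (\<Sum>i=1..Nd. scale (\<alpha> i \<tau>) (opB a b i (z \<tau>)))"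

lemma zX: "0 \<le> t \<Longrightarrow> z t \<in> X"
  using mild by (simp add: mild_solution_def)

lemma opB_X:
  assumes u: "u \<in> X" and i: "i \<in> {1..N}"
  shows "opB a b i u \<in> X"
  unfolding Xp_def
proof (safe)
  fix k assume k: "k \<in> {1..N}"
  have 0: "(\<lambda>x. 0) \<in> Lp p (L k)" using p by (intro Lp_bounded[where B = 0]) auto
  have "(\<lambda>x. - indicator {a i..b i} x * u i x) \<in> Lp p (L i)"
    unfolding Lp_def
  proof (safe)
    have [measurable]: "u i \<in> borel_measurable (seg (L i))" by (rule LpD(1)[OF XD[OF u i]])
    have [measurable]: "(indicator {a i..b i} :: real \<Rightarrow> real) \<in> borel_measurable (seg (L i))"
      by (intro measurable_seg_borel) auto
    show m: "(\<lambda>x. - indicator {a i..b i} x * u i x) \<in> borel_measurable (seg (L i))" by measurable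
    show "integrable (seg (L i)) (\<lambda>x. \<bar>- indicator {a i..b i} x * u i x\<bar> powr p)"
      by (rule Bochner_Integration.integrable_bound[OF LpD(2)[OF XD[OF u i]]])
         (use m in measurable, auto simp: indicator_def)
  qed
  then show "opB a b i u k \<in> Lp p (L k)"
    using 0 unfolding opB_def by (cases "k = i") (simp_all del: mult_minus_left)
qed

lemma ff_X: "0 \<le> \<tau> \<Longrightarrow> ff \<tau> \<in> X"
  unfolding ff_def using Nd by (intro X_sum X_scale opB_X zX) auto

lemma mild_representation:
  assumes "0 \<le> t"
  obtains w where "has_X_integral p N L t (\<lambda>\<tau>. T (t - \<tau>) (ff \<tau>)) w" "w \<in> X" "Xeq N L (z t) (T t z0 + w)"
proof -
  have "\<forall>t\<ge>0. \<exists>w. has_X_integral p N L t (\<lambda>\<tau>. T (t - \<tau>) (ff \<tau>)) w \<and> Xeq N L (z t) (T t z0 + w)"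
    using mild unfolding mild_solution_def ff_def by (elim conjE)
  then obtain w where w: "has_X_integral p N L t (\<lambda>\<tau>. T (t - \<tau>) (ff \<tau>)) w" "Xeq N L (z t) (T t z0 + w)"
    using assms by blast
  moreover have "w \<in> X" using w(1) by (simp add: has_X_integral_def)
  ultimately show ?thesis using that by blast
qed

lemma pair_z:
  assumes "0 \<le> t" "bmeas \<phi>"
  shows "((\<lambda>\<tau>. pair (T (t - \<tau>) (ff \<tau>)) \<phi>) has_integral pair (z t) \<phi> - pair (T t z0) \<phi>) {0..t}"
proof -
  obtain w where w: "has_X_integral p N L t (\<lambda>\<tau>. T (t - \<tau>) (ff \<tau>)) w" "w \<in> X" "Xeq N L (z t) (T t z0 + w)"
    using mild_representation[OF assms(1)] by blast
  have TX: "T t z0 \<in> X" using assms(1) DX[OF z0] by (rule T_X)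
  have "pair (z t) \<phi> = pair (T t z0 + w) \<phi>"
    by (rule pair_cong[OF assms(2) zX[OF assms(1)] X_add[OF TX w(2)] w(3)])
  also have "\<dots> = pair (T t z0) \<phi> + pair w \<phi>" by (rule pair_add_left[OF assms(2) TX w(2)])
  finally show ?thesis using X_integral_pair[OF w(1) assms(2)] by simp
qed

text \<open>Test the formula at time t0 + h with \<phi> and the one at t0 with
  \<open>psi h \<phi>\<close>. As \<open>psi h\<close> is the adjoint of \<open>T h\<close>, the
  integrands agree on [0, t0] and so do the contributions of z0; the difference is an integral over
  the new interval alone.\<close>

lemma weak_duhamel:
  assumes \<delta>: "\<And>t u \<phi> \<phi>'. 0 \<le> t \<Longrightarrow> t \<le> \<delta> \<Longrightarrow> u \<in> X \<Longrightarrow> tests \<phi> \<phi>' \<Longrightarrow> pair (T t u) \<phi> = pair u (psi t \<phi>)"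
    and t0: "0 \<le> t0" and h: "0 \<le> h" "h \<le> \<delta>" and ts: "tests \<phi> \<phi>'"
  shows "((\<lambda>\<sigma>. pair (ff (t0 + \<sigma>)) (psi (h - \<sigma>) \<phi>)) has_integral pair (z (t0 + h)) \<phi> - pair (z t0) (psi h \<phi>)) {0..h}"
proof -
  let ?g = "\<lambda>\<tau>. pair (T (t0 + h - \<tau>) (ff \<tau>)) \<phi>"
  have zX0: "z0 \<in> X" by (rule DX[OF z0])
  have split: "pair (T (t0' + h) u) \<phi> = pair (T t0' u) (psi h \<phi>)" if "0 \<le> t0'" "u \<in> X" for t0' u
  proof -
    have "pair (T (t0' + h) u) \<phi> = pair (T h (T t0' u)) \<phi>"
      using T_sg[OF h(1) that] h(1) that
      by (intro pair_cong[OF bmeas_tests(1)[OF ts]] T_X) (auto simp: add.commute)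
    also have "\<dots> = pair (T t0' u) (psi h \<phi>)" using h that by (intro \<delta>[OF _ _ _ ts] T_X)
    finally show ?thesis .
  qed
  have A: "(?g has_integral pair (z (t0 + h)) \<phi> - pair (T (t0 + h) z0) \<phi>) {0..t0 + h}"
    using pair_z[of "t0 + h" \<phi>] t0 h(1) bmeas_tests(1)[OF ts] by simp
  have "((\<lambda>\<tau>. pair (T (t0 - \<tau>) (ff \<tau>)) (psi h \<phi>)) has_integral pair (z t0) (psi h \<phi>) - pair (T t0 z0) (psi h \<phi>)) {0..t0}"
    using pair_z[OF t0] bmeas_psi(1)[OF ts] by simp
  then have B: "(?g has_integral pair (z t0) (psi h \<phi>) - pair (T (t0 + h) z0) \<phi>) {0..t0}"
    unfolding split[OF t0 zX0]
  proof (rule has_integral_eq[rotated])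
    fix \<tau> assume "\<tau> \<in> {0..t0}"
    then show "pair (T (t0 - \<tau>) (ff \<tau>)) (psi h \<phi>) = ?g \<tau>"
      using split[of "t0 - \<tau>" "ff \<tau>"] ff_X by (simp add: algebra_simps)
  qed
  have "?g integrable_on {t0..t0 + h}"
    by (rule integrable_on_subinterval[OF has_integral_integrable[OF A]]) (use t0 in auto)
  then obtain c where c: "(?g has_integral c) {t0..t0 + h}" by blast
  have "(?g has_integral (pair (z t0) (psi h \<phi>) - pair (T (t0 + h) z0) \<phi>) + c) {0..t0 + h}"
    by (rule has_integral_combine[OF _ _ B c]) (use t0 h in auto)
  from has_integral_unique[OF A this] have "c = pair (z (t0 + h)) \<phi> - pair (z t0) (psi h \<phi>)" by simp
  with c have "(?g has_integral pair (z (t0 + h)) \<phi> - pair (z t0) (psi h \<phi>)) (cbox (0 + t0) (h + t0))"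
    by (simp add: add.commute)
  then have "((?g \<circ> (+) t0) has_integral pair (z (t0 + h)) \<phi> - pair (z t0) (psi h \<phi>)) (cbox 0 h)"
    by (subst has_integral_shift_cbox_iff)
  then have "((\<lambda>\<sigma>. pair (T (h - \<sigma>) (ff (t0 + \<sigma>))) \<phi>) has_integral pair (z (t0 + h)) \<phi> - pair (z t0) (psi h \<phi>)) {0..h}"
    by (simp add: o_def)
  then show ?thesis
  proof (rule has_integral_eq[rotated])
    fix \<sigma> assume "\<sigma> \<in> {0..h}"
    then show "pair (T (h - \<sigma>) (ff (t0 + \<sigma>))) \<phi> = pair (ff (t0 + \<sigma>)) (psi (h - \<sigma>) \<phi>)"
      using t0 h by (intro \<delta>[OF _ _ _ ts] ff_X) auto
  qed
qed

lemma z_initial: "pair (z 0) \<phi> = pair z0 \<phi>" if "bmeas \<phi>"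
proof -
  have "((\<lambda>\<tau>. pair (T (0 - \<tau>) (ff \<tau>)) \<phi>) has_integral pair (z 0) \<phi> - pair (T 0 z0) \<phi>) {0..0}"
    by (rule pair_z[OF order_refl that])
  then have "pair (z 0) \<phi> - pair (T 0 z0) \<phi> = 0"
    by (rule has_integral_unique) (use has_integral_refl(1)[of _ 0] in simp)
  moreover have "pair (T 0 z0) \<phi> = pair z0 \<phi>"
    using DX[OF z0] by (intro pair_cong[OF that] T_X T_0) auto
  ultimately show ?thesis by simp
qed

lemma z_bounded:
  obtains Q where "\<And>s. s \<in> {t0..t1} \<Longrightarrow> 0 \<le> s \<Longrightarrow> NX (z s) \<le> Q"
proof -
  have "continuous_on {0..\<bar>t1\<bar>} (\<lambda>s. NX (z s))"
    unfolding continuous_on_def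
  proof
    fix t assume t: "t \<in> {0..\<bar>t1\<bar>}"
    have "\<forall>t\<ge>0. ((\<lambda>s. Xnorm p N L (z s - z t)) \<longlongrightarrow> 0) (at t within {0..})"
      using mild unfolding mild_solution_def by (elim conjE)
    then have "((\<lambda>s. NX (z s - z t)) \<longlongrightarrow> 0) (at t within {0..})"
      using t by (simp add: Xnorm_lim_iff)
    then have l: "((\<lambda>s. NX (z s - z t)) \<longlongrightarrow> 0) (at t within {0..\<bar>t1\<bar>})"
      by (rule tendsto_within_subset) auto
    have "((\<lambda>s. NX (z s) - NX (z t)) \<longlongrightarrow> 0) (at t within {0..\<bar>t1\<bar>})"
    proof (rule Lim_null_comparison[OF _ l])
      have "\<bar>NX (z s) - NX (z t)\<bar> \<le> NX (z s - z t)" if s: "s \<in> {0..\<bar>t1\<bar>}" for s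
        using NX_triangle[of "z s - z t" "z t"] NX_triangle[of "z t - z s" "z s"] NX_diff_swap[of "z s" "z t"] s t
          zX[of s] zX[of t] X_diff by simp
      then show "eventually (\<lambda>s. norm (NX (z s) - NX (z t)) \<le> NX (z s - z t)) (at t within {0..\<bar>t1\<bar>})"
        by (auto simp: eventually_at_filter)
    qed
    then show "((\<lambda>s. NX (z s)) \<longlongrightarrow> NX (z t)) (at t within {0..\<bar>t1\<bar>})"
      by (simp add: LIM_zero_iff)
  qed
  then have "compact ((\<lambda>s. NX (z s)) ` {0..\<bar>t1\<bar>})" by (rule compact_continuous_image) simp
  then have "bounded ((\<lambda>s. NX (z s)) ` {0..\<bar>t1\<bar>})" by (rule compact_imp_bounded)
  then obtain Q where Q: "\<forall>y\<in>(\<lambda>s. NX (z s)) ` {0..\<bar>t1\<bar>}. norm y \<le> Q" unfolding bounded_iff by blast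
  have "NX (z s) \<le> Q" if "s \<in> {t0..t1}" "0 \<le> s" for s
  proof -
    have "s \<in> {0..\<bar>t1\<bar>}" using that by auto
    then have "norm (NX (z s)) \<le> Q" using Q by blast
    then show ?thesis by simp
  qed
  then show ?thesis using that by blast
qed

end

section \<open>The explicit candidate on a short time interval\<close>

locale local_candidate = controlled +
  fixes t0 :: real and \<delta> :: real and F f :: "nat \<Rightarrow> real \<Rightarrow> real"
  assumes t0: "0 \<le> t0" and \<delta>: "0 < \<delta>" "\<delta> \<le> Lmin"
    and F: "\<And>i. i \<in> {1..N} \<Longrightarrow> prim p (F i) (f i)"
    and F0: "\<And>i. i \<in> {1..N} \<Longrightarrow> F i 0 = (\<Sum>j=1..N. m i j * F j (L j))"
begin

text \<open>The candidate for the solution restarted at time \<open>t0\<close> from the state with continuous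
  representatives \<open>F\<close>. Along the characteristic \<open>h - x = s\<close> of edge \<open>i\<close> the undamped value is \<open>V i s\<close>
  (given by the initial state for \<open>s \<le> 0\<close>, by the boundary condition for \<open>0 < s \<le> \<delta>\<close>), and \<open>G i s h\<close> is the
  damping accumulated up to time \<open>h\<close>.\<close>

definition A :: "nat \<Rightarrow> real \<Rightarrow> real" where "A i r = max 0 (min 1 (\<alpha> i (t0 + r)))"

definition G :: "nat \<Rightarrow> real \<Rightarrow> real \<Rightarrow> real" where
  "G i s h = exp (- (\<integral>r. (if 0 \<le> r \<and> r \<le> h \<and> s + a i \<le> r \<and> r \<le> s + b i then A i r else 0) \<partial>lborel))"

text \<open>On an incoming edge the damping is taken up to the fixed time \<delta> and not up to the
  arrival time s. At time s the characteristic has passed the whole control window because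
  \<open>b j \<le> L j\<close>, so both agree by \<open>G_eq\<close>, and a fixed time lets
  \<open>G_prim\<close> apply in s.\<close>

definition V :: "nat \<Rightarrow> real \<Rightarrow> real" where
  "V i s = (if s \<le> 0 then F i (- s) else \<Sum>j=1..N. m i j * (F j (L j - s) * G j (s - L j) \<delta>))"

definition y :: "real \<Rightarrow> state" where "y h = (\<lambda>i x. V i (h - x) * G i (h - x) h)"

text \<open>The purpose of the clipping in \<open>A\<close>: \<alpha> obeys its bounds only almost
  everywhere, while \<open>prim_exp\<close> asks for a bound at every point. Integrals are
  unaffected by \<open>A_eq_\<alpha>_AE\<close>.\<close>

lemma A_bounds: "0 \<le> A i r" "A i r \<le> 1" by (auto simp: A_def)

lemma A_measurable [measurable]: "i \<in> {1..N} \<Longrightarrow> A i \<in> borel_measurable borel"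
  unfolding A_def using \<alpha>_meas[of i] by measurable

lemma G_bounds: "0 < G i s h" "G i s h \<le> 1"
proof -
  have "0 \<le> (\<integral>r. (if 0 \<le> r \<and> r \<le> h \<and> s + a i \<le> r \<and> r \<le> s + b i then A i r else 0) \<partial>lborel)"
    by (rule integral_nonneg_AE) (auto simp: A_bounds)
  then show "0 < G i s h" "G i s h \<le> 1" by (simp_all add: G_def)
qed

lemma G_measurable:
  assumes "i \<in> {1..N}"
  shows "(\<lambda>(s, h). G i s h) \<in> borel_measurable (lborel \<Otimes>\<^sub>M lborel)"
proof -
  note [measurable] = A_measurable[OF assms]
  have "(\<lambda>x. \<integral>r. (if 0 \<le> r \<and> r \<le> snd x \<and> fst x + a i \<le> r \<and> r \<le> fst x + b i then A i r else 0) \<partial>lborel)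
      \<in> borel_measurable (lborel \<Otimes>\<^sub>M lborel)"
    by measurable
  then show ?thesis unfolding G_def by (simp add: split_beta')
qed

text \<open>In both cases the integral extends over at most one point, 0 or h: the control window
  was left before the start, or it is not yet reached.\<close>

lemma G_one: "s + b i \<le> 0 \<or> h \<le> s + a i \<Longrightarrow> i \<in> {1..N} \<Longrightarrow> G i s h = 1"
proof -
  assume h: "s + b i \<le> 0 \<or> h \<le> s + a i" and i: "i \<in> {1..N}"
  have "(\<integral>r. (if 0 \<le> r \<and> r \<le> h \<and> s + a i \<le> r \<and> r \<le> s + b i then A i r else 0) \<partial>lborel) = 0"
  proof (rule integral_eq_zero_AE)
    show "AE r in lborel. (if 0 \<le> r \<and> r \<le> h \<and> s + a i \<le> r \<and> r \<le> s + b i then A i r else 0) = 0"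
      using AE_lborel_singleton[of 0] AE_lborel_singleton[of h] by eventually_elim (use h in auto)
  qed
  then show ?thesis by (simp add: G_def)
qed

lemma G_eq: "s + b i \<le> h \<Longrightarrow> h \<le> h' \<Longrightarrow> G i s h = G i s h'"
  unfolding G_def by (intro arg_cong[where f = "\<lambda>x. exp (- x)"] Bochner_Integration.integral_cong) auto

lemma bounded_prim:
  fixes g :: "real \<Rightarrow> real"
  assumes m: "g \<in> borel_measurable borel" and B: "\<And>x. \<bar>g x\<bar> \<le> 1"
    and z: "\<And>x. x \<notin> {c..d} \<Longrightarrow> g x = 0"
  shows "prim p (\<lambda>x. \<integral>r. g r * indicator {..x} r \<partial>lborel) g"
proof (rule prim_indefinite_integral)
  show Ll: "Lloc p g" using p B by (intro Lloc_locally_bounded m) auto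
  have "g = (\<lambda>x. indicator {c..d} x *\<^sub>R g x)" using z by (auto simp: indicator_def fun_eq_iff)
  then show "integrable lborel g" using Lloc_L1[OF p Ll, of c d] by (simp add: set_integrable_def)
qed

text \<open>Along the characteristic the position at time \<sigma> is \<sigma> - s, and
  \<open>G\<close>, as a function of time, solves the damping equation G' = - A \<chi> G with value
  1 at time 0. The loss 1 - G is the integral of the damping rate.\<close>

lemma G_identity:
  assumes i: "i \<in> {1..N}" and h: "0 \<le> h"
  shows "1 - G i s h = (\<integral>\<sigma>. indicator {0..h} \<sigma> * (A i \<sigma> * indicator {a i..b i} (\<sigma> - s)) * G i s \<sigma> \<partial>lborel)"
proof -
  note [measurable] = A_measurable[OF i]
  define g where "g r = - (A i r * indicator ({0..} \<inter> {s + a i..s + b i}) r)" for r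
  have gm: "g \<in> borel_measurable borel" unfolding g_def by measurable
  have gb: "\<bar>g x\<bar> \<le> 1" for x
    using A_bounds[of i x] by (auto simp: g_def indicator_def)
  have P: "prim p (\<lambda>x. \<integral>r. g r * indicator {..x} r \<partial>lborel) g"
    by (rule bounded_prim[OF gm gb, of "s + a i" "s + b i"]) (auto simp: g_def)
  have Geq: "exp (\<integral>r. g r * indicator {..x} r \<partial>lborel) = G i s x" for x
  proof -
    have "(\<integral>r. g r * indicator {..x} r \<partial>lborel) = (\<integral>r. - (if 0 \<le> r \<and> r \<le> x \<and> s + a i \<le> r \<and> r \<le> s + b i then A i r else 0) \<partial>lborel)"
      by (rule Bochner_Integration.integral_cong) (auto simp: g_def indicator_def)
    then show ?thesis by (simp add: G_def)
  qed
  have "prim p (\<lambda>x. G i s x) (\<lambda>x. g x * G i s x)"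
    using prim_exp[OF p P gb] unfolding Geq .
  from primD(4)[OF this p h] have "G i s h = G i s 0 + (LINT x:{0..h}|lborel. g x * G i s x)" .
  moreover have "G i s 0 = 1"
  proof -
    have "(\<integral>r. (if 0 \<le> r \<and> r \<le> 0 \<and> s + a i \<le> r \<and> r \<le> s + b i then A i r else 0) \<partial>lborel) = 0"
    proof (rule integral_eq_zero_AE)
      show "AE r in lborel. (if 0 \<le> r \<and> r \<le> 0 \<and> s + a i \<le> r \<and> r \<le> s + b i then A i r else 0) = 0"
        using AE_lborel_singleton[of 0] by eventually_elim auto
    qed
    then show ?thesis by (simp add: G_def)
  qed
  moreover have "(LINT x:{0..h}|lborel. g x * G i s x) = (\<integral>\<sigma>. - (indicator {0..h} \<sigma> * (A i \<sigma> * indicator {a i..b i} (\<sigma> - s)) * G i s \<sigma>) \<partial>lborel)"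
    unfolding set_lebesgue_integral_def
    by (rule Bochner_Integration.integral_cong) (auto simp: g_def indicator_def)
  ultimately show ?thesis by simp
qed

text \<open>As s varies the window moves rigidly, so the exponent is the difference of one primitive
  of A at the two shifted end points; its density is bounded by 1 + 1, as \<open>prim_exp\<close>
  requires.\<close>

lemma G_prim:
  assumes i: "i \<in> {1..N}"
  obtains g where "prim p (\<lambda>s. G i s h) g"
proof -
  note [measurable] = A_measurable[OF i]
  define g where "g r = A i r * indicator {0..h} r" for r
  have gm: "g \<in> borel_measurable borel" unfolding g_def by measurable
  have gb: "\<bar>g x\<bar> \<le> 1" for x
    using A_bounds[of i x] by (auto simp: g_def indicator_def)
  define \<Phi> where "\<Phi> x = (\<integral>r. g r * indicator {..x} r \<partial>lborel)" for x
  have P: "prim p \<Phi> g"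
    unfolding \<Phi>_def by (rule bounded_prim[OF gm gb, of 0 h]) (auto simp: g_def)
  have i1: "integrable lborel (\<lambda>r. g r * indicator {..x} r)" for x
  proof -
    have "integrable lborel g"
      using primD(3)[OF P p, of 0 h] unfolding set_integrable_def
      by (rule Bochner_Integration.integrable_cong[THEN iffD1, rotated -1]) (auto simp: g_def indicator_def)
    then show ?thesis using integrable_mult_indicator[of "{..x}" lborel g] by (simp add: mult.commute)
  qed
  have eq: "exp (\<Phi> (a i + 1 * s) + (-1) * \<Phi> (b i + 1 * s)) = G i s h" for s
  proof -
    have "\<Phi> (b i + s) - \<Phi> (a i + s) = (\<integral>r. g r * indicator {..b i + s} r - g r * indicator {..a i + s} r \<partial>lborel)"
      unfolding \<Phi>_def using i1 by simp
    also have "\<dots> = (\<integral>r. (if 0 \<le> r \<and> r \<le> h \<and> s + a i \<le> r \<and> r \<le> s + b i then A i r else 0) \<partial>lborel)"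
    proof (rule integral_cong_AE)
      show "AE r in lborel. g r * indicator {..b i + s} r - g r * indicator {..a i + s} r
          = (if 0 \<le> r \<and> r \<le> h \<and> s + a i \<le> r \<and> r \<le> s + b i then A i r else 0)"
        using AE_lborel_singleton[of "s + a i"]
        by eventually_elim (use ab[OF i] in \<open>auto simp: g_def indicator_def\<close>)
    qed (use gm in measurable)
    finally show ?thesis by (simp add: G_def)
  qed
  have Q: "prim p (\<lambda>s. \<Phi> (a i + 1 * s) + (-1) * \<Phi> (b i + 1 * s)) (\<lambda>s. 1 * g (a i + 1 * s) + (-1) * (1 * g (b i + 1 * s)))"
    by (intro prim_add prim_cmult prim_affine p P) auto
  have "\<bar>1 * g (a i + 1 * s) + (-1) * (1 * g (b i + 1 * s))\<bar> \<le> 2" for s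
    using gb[of "a i + s"] gb[of "b i + s"] by simp
  from prim_exp[OF p Q this] show ?thesis
    unfolding eq by (rule that)
qed

text \<open>The two branches of \<open>V\<close> are glued at s = 0. Their values match by the
  boundary condition \<open>F0\<close>, the damping factors there being 1 by \<open>G_one\<close>;
  here the membership of the restart state in the domain is used.\<close>

lemma V_prim:
  assumes i: "i \<in> {1..N}"
  obtains g where "prim p (V i) g"
proof -
  have "\<exists>g. prim p (\<lambda>s. m i j * (F j (L j + (-1) * s) * G j (- L j + 1 * s) \<delta>)) g" if j: "j \<in> {1..N}" for j
  proof -
    obtain g where "prim p (\<lambda>s. G j s \<delta>) g" by (rule G_prim[OF j])
    from prim_cmult[OF p prim_mult[OF p prim_affine[OF p F[OF j], of "-1" "L j"] prim_affine[OF p this, of 1 "- L j"]], of "m i j"]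
    show ?thesis by auto
  qed
  then obtain g where g: "\<And>j. j \<in> {1..N} \<Longrightarrow> prim p (\<lambda>s. m i j * (F j (L j + (-1) * s) * G j (- L j + 1 * s) \<delta>)) (g j)"
    by metis
  have S: "prim p (\<lambda>s. \<Sum>j=1..N. m i j * (F j (L j + (-1) * s) * G j (- L j + 1 * s) \<delta>)) (\<lambda>s. \<Sum>j=1..N. g j s)"
    by (rule prim_sum[OF p]) (use g in auto)
  have "F i (0 + (-1) * 0) = (\<Sum>j=1..N. m i j * (F j (L j + (-1) * 0) * G j (- L j + 1 * 0) \<delta>))"
    using F0[OF i] ab by (simp add: G_one)
  from prim_glue[OF p prim_affine[OF p F[OF i] disjI2[OF refl], of 0] S this]
  moreover have "V i = (\<lambda>s. if s \<le> 0 then F i (0 + (-1) * s) else \<Sum>j=1..N. m i j * (F j (L j + (-1) * s) * G j (- L j + 1 * s) \<delta>))"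
    by (simp add: V_def fun_eq_iff)
  ultimately have "prim p (V i) (\<lambda>s. if s \<le> 0 then (-1) * f i (0 + (-1) * s) else \<Sum>j=1..N. g j s)"
    by (simp only:)
  then show ?thesis by (rule that)
qed

lemma V_continuous: "i \<in> {1..N} \<Longrightarrow> continuous_on UNIV (V i)"
  using V_prim[of i] prim_continuous[OF _ p] by metis

lemma G_continuous: "i \<in> {1..N} \<Longrightarrow> continuous_on UNIV (\<lambda>s. G i s h)"
  using G_prim[of i h] prim_continuous[OF _ p] by metis

lemma y_prim:
  assumes i: "i \<in> {1..N}"
  obtains g where "prim p (y h i) g"
proof -
  obtain g1 where g1: "prim p (V i) g1" by (rule V_prim[OF i])
  obtain g2 where g2: "prim p (\<lambda>s. G i s h) g2" by (rule G_prim[OF i])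
  have eq: "y h i = (\<lambda>x. V i (h + (-1) * x) * G i (h + (-1) * x) h)"
    by (simp add: y_def fun_eq_iff)
  have "prim p (y h i) (\<lambda>x. (-1) * g1 (h + (-1) * x) * G i (h + (-1) * x) h + (-1) * g2 (h + (-1) * x) * V i (h + (-1) * x))"
    unfolding eq by (intro prim_mult prim_affine p g1 g2) auto
  then show ?thesis by (rule that)
qed

lemma y_continuous: "i \<in> {1..N} \<Longrightarrow> continuous_on UNIV (y h i)"
  using y_prim[of i h] prim_continuous[OF _ p] by metis

lemma y_transport: "h \<le> x \<Longrightarrow> y h i x = F i (x - h) * G i (h - x) h"
  by (simp add: y_def V_def)

text \<open>At the end of an edge the damping up to h equals that up to \<delta> by
  \<open>G_eq\<close>, and \<open>h \<le> L j\<close> ensures that the outgoing value still stems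
  from the initial state.\<close>

lemma y_boundary:
  assumes i: "i \<in> {1..N}" and h: "0 \<le> h" "h \<le> \<delta>"
  shows "y h i 0 = (\<Sum>j=1..N. m i j * y h j (L j))"
proof -
  have "y h i 0 = V i h" using ab[OF i] i by (simp add: y_def G_one)
  also have "\<dots> = (\<Sum>j=1..N. m i j * (F j (L j - h) * G j (h - L j) \<delta>))"
  proof (cases "h = 0")
    case True
    then show ?thesis using F0[OF i] ab by (simp add: V_def G_one)
  qed (use h in \<open>simp add: V_def\<close>)
  also have "\<dots> = (\<Sum>j=1..N. m i j * y h j (L j))"
  proof (rule sum.cong[OF refl])
    fix j assume j: "j \<in> {1..N}"
    have "h \<le> L j" using Lmin(2)[OF j] \<delta>(2) h by simp
    moreover have "G j (h - L j) \<delta> = G j (h - L j) h"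
      by (rule G_eq[symmetric]) (use ab[OF j] h in auto)
    ultimately show "m i j * (F j (L j - h) * G j (h - L j) \<delta>) = m i j * y h j (L j)"
      by (simp add: y_transport)
  qed
  finally show ?thesis .
qed

text \<open>With the primitive from \<open>y_prim\<close> and the boundary values from
  \<open>y_boundary\<close> the candidate can serve as the next initial state, which closes the
  iteration in time.\<close>

lemma Xeq_y_D:
  assumes v: "v \<in> X" "Xeq N L v (y h)" and h: "0 \<le> h" "h \<le> \<delta>"
  shows "v \<in> D" "\<And>i x. i \<in> {1..N} \<Longrightarrow> x \<in> {0..L i} \<Longrightarrow> crep (L i) (v i) x = y h i x"
proof -
  have W: "v i \<in> W1p p (L i) \<and> (\<forall>x\<in>{0..L i}. crep (L i) (v i) x = y h i x)" if i: "i \<in> {1..N}" for i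
  proof -
    obtain g where g: "prim p (y h i) g" by (rule y_prim[OF i])
    have "AE x in seg (L i). y h i x = v i x" using XeqD[OF Xeq_sym[OF v(2)] i] .
    from W1p_if_prim[OF p L[OF i] g LpD(1)[OF XD[OF v(1) i]] this] show ?thesis by blast
  qed
  then show cr: "\<And>i x. i \<in> {1..N} \<Longrightarrow> x \<in> {0..L i} \<Longrightarrow> crep (L i) (v i) x = y h i x" by blast
  have "crep (L i) (v i) 0 = (\<Sum>j=1..N. m i j * crep (L j) (v j) (L j))" if i: "i \<in> {1..N}" for i
  proof -
    have "crep (L i) (v i) 0 = y h i 0" using L[OF i] by (intro cr i) auto
    also have "\<dots> = (\<Sum>j=1..N. m i j * y h j (L j))" by (rule y_boundary[OF i h])
    also have "\<dots> = (\<Sum>j=1..N. m i j * crep (L j) (v j) (L j))"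
      using cr L by (intro sum.cong refl arg_cong2[where f = "(*)"]) (auto simp: less_imp_le)
    finally show ?thesis .
  qed
  then show "v \<in> D" using W by (simp add: domA_def)
qed

lemma y_bounded:
  obtains Q where "\<And>i x h. i \<in> {1..N} \<Longrightarrow> x \<in> {0..L i} \<Longrightarrow> 0 \<le> h \<Longrightarrow> h \<le> \<delta> \<Longrightarrow> \<bar>y h i x\<bar> \<le> Q"
proof -
  have "\<forall>i\<in>{1..N}. \<exists>B. \<forall>s\<in>{- L i..\<delta>}. \<bar>V i s\<bar> \<le> B"
    using continuous_locally_bounded[OF V_continuous] by blast
  from bchoice[OF this] obtain B where B: "\<forall>i\<in>{1..N}. \<forall>s\<in>{- L i..\<delta>}. \<bar>V i s\<bar> \<le> B i" ..
  have "\<bar>y h i x\<bar> \<le> (\<Sum>i=1..N. \<bar>B i\<bar>)" if i: "i \<in> {1..N}" and x: "x \<in> {0..L i}" and h: "0 \<le> h" "h \<le> \<delta>" for i x h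
  proof -
    have s: "h - x \<in> {- L i..\<delta>}" using x h by auto
    have "\<bar>y h i x\<bar> \<le> \<bar>V i (h - x)\<bar> * 1"
      unfolding y_def abs_mult using G_bounds[of i "h - x" h] by (intro mult_left_mono) auto
    also have "\<dots> \<le> \<bar>B i\<bar>" using B i s by force
    also have "\<dots> \<le> (\<Sum>i=1..N. \<bar>B i\<bar>)" using i by (intro member_le_sum) auto
    finally show ?thesis .
  qed
  then show ?thesis using that by blast
qed

lemma y_X:
  assumes "0 \<le> h" "h \<le> \<delta>"
  shows "y h \<in> X"
proof -
  obtain Q where Q: "\<And>i x h. i \<in> {1..N} \<Longrightarrow> x \<in> {0..L i} \<Longrightarrow> 0 \<le> h \<Longrightarrow> h \<le> \<delta> \<Longrightarrow> \<bar>y h i x\<bar> \<le> Q"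
    using y_bounded by blast
  show ?thesis
    unfolding Xp_def
  proof (safe)
    fix i assume i: "i \<in> {1..N}"
    show "y h i \<in> Lp p (L i)"
      by (rule Lp_bounded[where B = Q])
         (use Q[OF i] assms p y_continuous[OF i] in \<open>auto intro!: measurable_seg_borel borel_measurable_continuous_onI\<close>)
  qed
qed

end

section \<open>The weak Duhamel formula for the candidate\<close>

lemma integrable_compact_support:
  fixes g :: "real \<Rightarrow> real"
  assumes "continuous_on UNIV g" "\<And>x. x \<notin> {c..d} \<Longrightarrow> g x = 0"
  shows "integrable lborel g"
proof -
  have "integrable lborel (\<lambda>x. indicator {c..d} x *\<^sub>R g x)"
    using borel_integrable_atLeastAtMost'[OF continuous_on_subset[OF assms(1) subset_UNIV]] by (simp add: set_integrable_def)
  moreover have "(\<lambda>x. indicator {c..d} x *\<^sub>R g x) = g"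
    using assms(2) by (auto simp: indicator_def fun_eq_iff)
  ultimately show ?thesis by simp
qed

lemma integral_reflect: "(\<integral>x. g x \<partial>lborel) = (\<integral>s. g (c - s) \<partial>lborel)" for g :: "real \<Rightarrow> real"
  using lborel_integral_real_affine[of "-1" g c] by simp

lemma integral_shift: "(\<integral>x. g x \<partial>lborel) = (\<integral>s. g (s - c) \<partial>lborel)" for g :: "real \<Rightarrow> real"
  using lborel_integral_real_affine[of 1 g "- c"] by (simp add: uminus_add_conv_diff)

context local_candidate
begin

text \<open>Substitute x = \<sigma> - s. Then
  \<open>psi (h - \<sigma>) \<phi> i (\<sigma> - s)\<close> is \<open>psi h \<phi> i (- s)\<close>
  and the undamped value is \<open>V i s\<close>, both free of \<sigma>; after Fubini's theorem the
  inner integral is that of \<open>G_identity\<close>.\<close>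

lemma duhamel_component:
  assumes i: "i \<in> {1..N}" and h: "0 \<le> h" and ts: "tests \<phi> \<phi>'"
    and int: "integrable lborel (\<lambda>s. V i s * psi h \<phi> i (- s))"
  shows "((\<lambda>\<sigma>. A i \<sigma> * (\<integral>x. indicator {a i..b i} x * y \<sigma> i x * psi (h - \<sigma>) \<phi> i x \<partial>seg (L i)))
    has_integral (\<integral>s. V i s * psi h \<phi> i (- s) * (1 - G i s h) \<partial>lborel)) {0..h}"
proof -
  define U where "U s = V i s * psi h \<phi> i (- s)" for s
  define w where "w s \<sigma> = A i \<sigma> * (indicator {0<..<L i} (\<sigma> - s) * indicator {a i..b i} (\<sigma> - s) * G i s \<sigma>)" for s \<sigma>
  note [measurable] = A_measurable[OF i]
  have Gm: "(\<lambda>x. G i (fst x) (snd x)) \<in> borel_measurable (lborel \<Otimes>\<^sub>M lborel)"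
    using G_measurable[OF i] by (simp add: split_beta')
  have wm: "(\<lambda>(s, \<sigma>). w s \<sigma>) \<in> borel_measurable (lborel \<Otimes>\<^sub>M lborel)"
    unfolding w_def split_beta' by (intro borel_measurable_times Gm) measurable
  have w1: "\<bar>w s \<sigma>\<bar> \<le> 1" for s \<sigma>
    using A_bounds[of i \<sigma>] G_bounds[of i s \<sigma>]
    by (auto simp: w_def indicator_def abs_mult intro!: mult_le_one)
  have vi: "integrable lborel (indicator {0..h} :: real \<Rightarrow> real)"
    by (rule integrable_real_indicator) (auto simp: emeasure_lborel_Icc_eq)
  have I: "integrable (lborel \<Otimes>\<^sub>M lborel) (\<lambda>(s, \<sigma>). U s * indicator {0..h} \<sigma> * w s \<sigma>)"
    unfolding U_def by (rule integrable_product_bounded[OF int vi wm w1])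
  have J: "(\<integral>s. U s * indicator {0..h} \<sigma> * w s \<sigma> \<partial>lborel) =
      indicator {0..h} \<sigma> * (A i \<sigma> * (\<integral>x. indicator {a i..b i} x * y \<sigma> i x * psi (h - \<sigma>) \<phi> i x \<partial>seg (L i)))" for \<sigma>
  proof -
    have "(\<integral>x. indicator {a i..b i} x * y \<sigma> i x * psi (h - \<sigma>) \<phi> i x \<partial>seg (L i))
      = (\<integral>s. indicator {0<..<L i} (\<sigma> - s) * (indicator {a i..b i} (\<sigma> - s) * y \<sigma> i (\<sigma> - s) * psi (h - \<sigma>) \<phi> i (\<sigma> - s)) \<partial>lborel)"
      unfolding integral_seg by (rule integral_reflect)
    also have "\<dots> = (\<integral>s. indicator {0<..<L i} (\<sigma> - s) * indicator {a i..b i} (\<sigma> - s) * G i s \<sigma> * U s \<partial>lborel)"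
    proof (rule Bochner_Integration.integral_cong[OF refl])
      fix s
      have "psi (h - \<sigma>) \<phi> i (\<sigma> - s) = psi h \<phi> i (- s)" by (simp add: psi_def)
      then show "indicator {0<..<L i} (\<sigma> - s) * (indicator {a i..b i} (\<sigma> - s) * y \<sigma> i (\<sigma> - s) * psi (h - \<sigma>) \<phi> i (\<sigma> - s))
          = indicator {0<..<L i} (\<sigma> - s) * indicator {a i..b i} (\<sigma> - s) * G i s \<sigma> * U s"
        by (simp add: y_def U_def)
    qed
    finally have "indicator {0..h} \<sigma> * (A i \<sigma> * (\<integral>x. indicator {a i..b i} x * y \<sigma> i x * psi (h - \<sigma>) \<phi> i x \<partial>seg (L i)))
      = (\<integral>s. indicator {0..h} \<sigma> * A i \<sigma> * (indicator {0<..<L i} (\<sigma> - s) * indicator {a i..b i} (\<sigma> - s) * G i s \<sigma> * U s) \<partial>lborel)"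
      by (simp add: mult.assoc)
    also have "\<dots> = (\<integral>s. U s * indicator {0..h} \<sigma> * w s \<sigma> \<partial>lborel)"
      by (rule Bochner_Integration.integral_cong) (auto simp: w_def mult_ac)
    finally show ?thesis by simp
  qed
  have swap: "(\<integral>\<sigma>. (\<integral>s. U s * indicator {0..h} \<sigma> * w s \<sigma> \<partial>lborel) \<partial>lborel) = (\<integral>s. (\<integral>\<sigma>. U s * indicator {0..h} \<sigma> * w s \<sigma> \<partial>lborel) \<partial>lborel)"
    by (rule lborel_pair.Fubini_integral[OF I])
  have inner: "(\<integral>\<sigma>. U s * indicator {0..h} \<sigma> * w s \<sigma> \<partial>lborel) = U s * (1 - G i s h)" for s
  proof -
    have Gs: "G i s \<in> borel_measurable borel"
      using measurable_compose[OF measurable_Pair1' Gm, of s] by simp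
    have "(\<integral>\<sigma>. indicator {0..h} \<sigma> * w s \<sigma> \<partial>lborel) = (\<integral>\<sigma>. indicator {0..h} \<sigma> * (A i \<sigma> * indicator {a i..b i} (\<sigma> - s)) * G i s \<sigma> \<partial>lborel)"
    proof (rule integral_cong_AE)
      \<comment> \<open>The control window lies in [0, L i], so it meets the complement of the open
        edge only at the two times at which the characteristic is at an end.\<close>
      show "AE \<sigma> in lborel. indicator {0..h} \<sigma> * w s \<sigma> = indicator {0..h} \<sigma> * (A i \<sigma> * indicator {a i..b i} (\<sigma> - s)) * G i s \<sigma>"
        using AE_lborel_singleton[of s] AE_lborel_singleton[of "s + L i"]
        by eventually_elim (use ab[OF i] in \<open>auto simp: w_def indicator_def\<close>)
      show "(\<lambda>\<sigma>. indicator {0..h} \<sigma> * w s \<sigma>) \<in> borel_measurable lborel"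
        unfolding w_def using Gs by measurable
      show "(\<lambda>\<sigma>. indicator {0..h} \<sigma> * (A i \<sigma> * indicator {a i..b i} (\<sigma> - s)) * G i s \<sigma>) \<in> borel_measurable lborel"
        using Gs by measurable
    qed
    also have "\<dots> = 1 - G i s h" by (rule G_identity[OF i h, symmetric])
    finally show ?thesis by (simp add: mult.assoc)
  qed
  have int2: "integrable lborel (\<lambda>\<sigma>. \<integral>s. U s * indicator {0..h} \<sigma> * w s \<sigma> \<partial>lborel)"
    using lborel_pair.integrable_snd[OF I] .
  then have si: "set_integrable lborel {0..h} (\<lambda>\<sigma>. A i \<sigma> * (\<integral>x. indicator {a i..b i} x * y \<sigma> i x * psi (h - \<sigma>) \<phi> i x \<partial>seg (L i)))"
    unfolding J by (simp add: set_integrable_def)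
  have "(LINT \<sigma>:{0..h}|lborel. A i \<sigma> * (\<integral>x. indicator {a i..b i} x * y \<sigma> i x * psi (h - \<sigma>) \<phi> i x \<partial>seg (L i)))
    = (\<integral>s. U s * (1 - G i s h) \<partial>lborel)"
    using swap unfolding J inner by (simp add: set_lebesgue_integral_def)
  then show ?thesis
    using set_borel_integral_eq_integral[OF si] by (simp add: has_integral_integral U_def)
qed

text \<open>A balance of undamped minus damped mass, with \<open>ac\<close> for mass found on its
  own edge at time h and \<open>c\<close> for mass that has passed to another edge. Besides the two
  pairings there remain the mass entering and the mass leaving, which the boundary condition
  equates.\<close>

lemma y_weak_duhamel:
  assumes h: "0 \<le> h" "h \<le> \<delta>" and ts: "tests \<phi> \<phi>'"
  shows "((\<lambda>\<sigma>. \<Sum>i=1..N. A i \<sigma> * (\<integral>x. indicator {a i..b i} x * y \<sigma> i x * psi (h - \<sigma>) \<phi> i x \<partial>seg (L i)))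
    has_integral pair F (psi h \<phi>) - pair (y h) \<phi>) {0..h}"
proof -
  have t: "tst (L k) (\<phi> k) (\<phi>' k)" if "k \<in> {1..N}" for k using ts that by (simp add: tests_def)
  have z: "\<phi> k x = 0" if "k \<in> {1..N}" "x \<notin> {0<..<L k}" for k x using tstD(4)[OF t[OF that(1)] that(2)] .
  have hL: "h \<le> L i" if "i \<in> {1..N}" for i using Lmin(2)[OF that] \<delta>(2) h by simp
  define ac where "ac i s = V i s * \<phi> i (h - s)" for i s
  define c where "c i k s = V i s * \<phi> k (h - s - L i)" for i k s
  have \<phi>c: "continuous_on UNIV (\<lambda>s. \<phi> k (d - s))" if "k \<in> {1..N}" for k d
    by (rule continuous_on_compose2[OF tstD(3)[OF t[OF that]]]) (auto intro!: continuous_intros)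
  have ai: "integrable lborel (ac i)" if i: "i \<in> {1..N}" for i
    unfolding ac_def
  proof (rule integrable_compact_support[of _ "h - L i" h])
    show "continuous_on UNIV (\<lambda>s. V i s * \<phi> i (h - s))"
      by (intro continuous_intros V_continuous \<phi>c i)
    show "V i s * \<phi> i (h - s) = 0" if "s \<notin> {h - L i..h}" for s
      using z[OF i, of "h - s"] that by auto
  qed
  have ci: "integrable lborel (c i k)" if i: "i \<in> {1..N}" and k: "k \<in> {1..N}" for i k
    unfolding c_def
  proof (rule integrable_compact_support[of _ "h - L i - L k" "h - L i"])
    have "continuous_on UNIV (\<lambda>s. V i s * \<phi> k ((h - L i) - s))"
      by (intro continuous_intros V_continuous \<phi>c i k)
    then show "continuous_on UNIV (\<lambda>s. V i s * \<phi> k (h - s - L i))" by (simp add: algebra_simps)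
    show "V i s * \<phi> k (h - s - L i) = 0" if "s \<notin> {h - L i - L k..h - L i}" for s
      using z[OF k, of "h - s - L i"] that by auto
  qed
  have Gm: "(\<lambda>s. G i s h) \<in> borel_measurable borel" if "i \<in> {1..N}" for i
    using G_continuous[OF that] by (intro borel_measurable_continuous_onI)
  have mi: "integrable lborel (\<lambda>s. g s * G i s h)" if "integrable lborel g" "i \<in> {1..N}" for g i
    using that Gm[OF that(2)] G_bounds[of i _ h] by (intro integrable_mult_bounded[where B = 1]) (auto simp: abs_le_iff less_imp_le intro: order_trans[of _ 0])
  have ind: "integrable lborel (\<lambda>s. indicator S s * g s)" if "integrable lborel g" "S \<in> sets borel" for g :: "real \<Rightarrow> real" and S
    using integrable_mult_indicator[of S lborel g] that by simp
  have VP: "V i s * psi h \<phi> i (- s) = ac i s + (\<Sum>k=1..N. m k i * c i k s)" for i s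
    by (simp add: psi_def ac_def c_def distrib_left sum_distrib_left mult_ac)
  have VPi: "integrable lborel (\<lambda>s. V i s * psi h \<phi> i (- s))" if i: "i \<in> {1..N}" for i
    unfolding VP using ai[OF i] ci[OF i] by (intro Bochner_Integration.integrable_add Bochner_Integration.integrable_sum integrable_mult_right) auto
  \<comment> \<open>\<open>e i\<close> is what has entered edge i since time 0, without the damping
    on that edge; \<open>d i k\<close> is what has left edge i for edge k, damped until its
    exit.\<close>
  define e where "e i = (\<integral>s. indicator {0<..} s * ac i s \<partial>lborel)" for i
  define d where "d i k = (\<integral>s. indicator {- L i<..} s * (c i k s * G i s h) \<partial>lborel)" for i k
  have main: "(\<integral>s. V i s * psi h \<phi> i (- s) * (1 - G i s h) \<partial>lborel)
      = (\<integral>x. F i x * psi h \<phi> i x \<partial>seg (L i)) - (\<integral>x. y h i x * \<phi> i x \<partial>seg (L i)) + e i - (\<Sum>k=1..N. m k i * d i k)"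
    if i: "i \<in> {1..N}" for i
  proof -
    have 1: "(\<integral>x. F i x * psi h \<phi> i x \<partial>seg (L i)) = (\<integral>s. indicator {- L i<..<0} s * ac i s + (\<Sum>k=1..N. m k i * (indicator {- L i<..<0} s * c i k s)) \<partial>lborel)"
    proof -
      have "(\<integral>x. F i x * psi h \<phi> i x \<partial>seg (L i)) = (\<integral>s. indicator {0<..<L i} (0 - s) * (F i (0 - s) * psi h \<phi> i (0 - s)) \<partial>lborel)"
        unfolding integral_seg by (rule integral_reflect)
      also have "\<dots> = (\<integral>s. indicator {- L i<..<0} s * (V i s * psi h \<phi> i (- s)) \<partial>lborel)"
        by (rule Bochner_Integration.integral_cong) (auto simp: V_def indicator_def)
      also have "\<dots> = (\<integral>s. indicator {- L i<..<0} s * ac i s + (\<Sum>k=1..N. m k i * (indicator {- L i<..<0} s * c i k s)) \<partial>lborel)"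
        unfolding VP by (simp add: distrib_left sum_distrib_left mult_ac)
      finally show ?thesis .
    qed
    have 2: "(\<integral>x. y h i x * \<phi> i x \<partial>seg (L i)) = (\<integral>s. ac i s * G i s h \<partial>lborel)"
    proof -
      have "(\<integral>x. y h i x * \<phi> i x \<partial>seg (L i)) = (\<integral>s. indicator {0<..<L i} (h - s) * (y h i (h - s) * \<phi> i (h - s)) \<partial>lborel)"
        unfolding integral_seg by (rule integral_reflect)
      also have "\<dots> = (\<integral>s. ac i s * G i s h \<partial>lborel)"
      proof (rule Bochner_Integration.integral_cong[OF refl])
        fix s show "indicator {0<..<L i} (h - s) * (y h i (h - s) * \<phi> i (h - s)) = ac i s * G i s h"
          using z[OF i, of "h - s"] by (cases "h - s \<in> {0<..<L i}") (auto simp: y_def ac_def)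
      qed
      finally show ?thesis .
    qed
    have "(\<integral>s. V i s * psi h \<phi> i (- s) * (1 - G i s h) \<partial>lborel)
      = (\<integral>s. (ac i s - ac i s * G i s h) + (\<Sum>k=1..N. m k i * (c i k s - c i k s * G i s h)) \<partial>lborel)"
      unfolding VP by (rule Bochner_Integration.integral_cong) (auto simp: algebra_simps sum_distrib_left sum_distrib_right sum_subtractf sum.distrib)
    also have "\<dots> = (\<integral>s. ((indicator {- L i<..<0} s * ac i s + (\<Sum>k=1..N. m k i * (indicator {- L i<..<0} s * c i k s)))
        - ac i s * G i s h) + indicator {0<..} s * ac i s
        - (\<Sum>k=1..N. m k i * (indicator {- L i<..} s * (c i k s * G i s h))) \<partial>lborel)"
    proof (rule integral_cong_AE)
      show "AE s in lborel. (ac i s - ac i s * G i s h) + (\<Sum>k=1..N. m k i * (c i k s - c i k s * G i s h))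
        = ((indicator {- L i<..<0} s * ac i s + (\<Sum>k=1..N. m k i * (indicator {- L i<..<0} s * c i k s)))
        - ac i s * G i s h) + indicator {0<..} s * ac i s
        - (\<Sum>k=1..N. m k i * (indicator {- L i<..} s * (c i k s * G i s h)))"
        using AE_lborel_singleton[of 0] AE_lborel_singleton[of "- L i"]
      proof eventually_elim
        case (elim s)
        \<comment> \<open>For s <= - L i the test function is evaluated at or beyond the end of the
          edge and vanishes, so only the initial mass (s < 0) and the incoming mass (s > 0)
          remain.\<close>
        have A1: "ac i s = indicator {- L i<..<0} s * ac i s + indicator {0<..} s * ac i s"
          using z[OF i, of "h - s"] h(1) elim by (auto simp: ac_def indicator_def)
        \<comment> \<open>For s <= - L i the characteristic is past the control window at time 0 and
          \<open>G\<close> is 1, so both sides are 0; for s >= 0 mass cannot leave before time h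
          because h <= L i.\<close>
        have C1: "c i k s - c i k s * G i s h = indicator {- L i<..<0} s * c i k s - indicator {- L i<..} s * (c i k s * G i s h)"
          if k: "k \<in> {1..N}" for k
        proof (cases "- L i < s")
          case True
          have "c i k s = 0" if "\<not> s < 0"
            using z[OF k, of "h - s - L i"] hL[OF i] that by (simp add: c_def)
          then show ?thesis using True by (auto simp: indicator_def)
        next
          case False
          then have "G i s h = 1" using ab[OF i] i by (intro G_one) auto
          then show ?thesis using False by (auto simp: indicator_def)
        qed
        have "(\<Sum>k=1..N. m k i * (c i k s - c i k s * G i s h))
          = (\<Sum>k=1..N. m k i * (indicator {- L i<..<0} s * c i k s)) - (\<Sum>k=1..N. m k i * (indicator {- L i<..} s * (c i k s * G i s h)))"
          unfolding sum_subtractf[symmetric] by (rule sum.cong) (auto simp: C1 right_diff_distrib)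
        then show ?case using A1 by linarith
      qed
      have [measurable]: "ac i \<in> borel_measurable borel" "(\<lambda>s. G i s h) \<in> borel_measurable borel"
        using ai[OF i] Gm[OF i] by auto
      have cm: "c i k \<in> borel_measurable lborel" if "k \<in> {1..N}" for k using ci[OF i that] by auto
      show "(\<lambda>s. (ac i s - ac i s * G i s h) + (\<Sum>k=1..N. m k i * (c i k s - c i k s * G i s h))) \<in> borel_measurable lborel"
        by (intro borel_measurable_add borel_measurable_diff borel_measurable_sum borel_measurable_times cm) auto
      show "(\<lambda>s. ((indicator {- L i<..<0} s * ac i s + (\<Sum>k=1..N. m k i * (indicator {- L i<..<0} s * c i k s)))
        - ac i s * G i s h) + indicator {0<..} s * ac i s
        - (\<Sum>k=1..N. m k i * (indicator {- L i<..} s * (c i k s * G i s h)))) \<in> borel_measurable lborel"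
        by (intro borel_measurable_add borel_measurable_diff borel_measurable_sum borel_measurable_times cm) auto
    qed
    also have "\<dots> = ((\<integral>s. indicator {- L i<..<0} s * ac i s + (\<Sum>k=1..N. m k i * (indicator {- L i<..<0} s * c i k s)) \<partial>lborel)
        - (\<integral>s. ac i s * G i s h \<partial>lborel)) + e i - (\<Sum>k=1..N. m k i * d i k)"
    proof -
      have I1: "integrable lborel (\<lambda>s. indicator {- L i<..<0} s * ac i s + (\<Sum>k=1..N. m k i * (indicator {- L i<..<0} s * c i k s)))"
        by (intro Bochner_Integration.integrable_add Bochner_Integration.integrable_sum integrable_mult_right ind ai ci i) auto
      have I2: "integrable lborel (\<lambda>s. ac i s * G i s h)" by (rule mi[OF ai[OF i] i])
      have I3: "integrable lborel (\<lambda>s. indicator {0<..} s * ac i s)" by (intro ind ai i) auto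
      have I4: "integrable lborel (\<lambda>s. m k i * (indicator {- L i<..} s * (c i k s * G i s h)))" if "k \<in> {1..N}" for k
        by (intro integrable_mult_right ind mi ci i that) auto
      have "(\<integral>s. (\<Sum>k=1..N. m k i * (indicator {- L i<..} s * (c i k s * G i s h))) \<partial>lborel) = (\<Sum>k=1..N. m k i * d i k)"
        unfolding d_def by (subst Bochner_Integration.integral_sum[OF I4]) auto
      moreover have I5: "integrable lborel (\<lambda>s. \<Sum>k=1..N. m k i * (indicator {- L i<..} s * (c i k s * G i s h)))"
        by (intro Bochner_Integration.integrable_sum I4)
      ultimately show ?thesis
        unfolding e_def
        by (simp only: Bochner_Integration.integral_diff[OF Bochner_Integration.integrable_add[OF Bochner_Integration.integrable_diff[OF I1 I2] I3] I5]
            Bochner_Integration.integral_add[OF Bochner_Integration.integrable_diff[OF I1 I2] I3] Bochner_Integration.integral_diff[OF I1 I2])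
    qed
    finally show ?thesis using 1 2 by simp
  qed
  \<comment> \<open>Balance at the vertices: r = s + L i is the exit time from edge i, and for 0 < r
    < h the weighted sum of the damped values that arrive at time r is the value
    \<open>V k r\<close> entering edge k.\<close>
  have ed: "(\<Sum>i=1..N. \<Sum>k=1..N. m k i * d i k) = (\<Sum>k=1..N. e k)"
  proof -
    have dshift: "d i k = (\<integral>r. indicator {0<..} r * (V i (r - L i) * G i (r - L i) h * \<phi> k (h - r)) \<partial>lborel)" for i k
    proof -
      have "d i k = (\<integral>r. indicator {- L i<..} (r - L i) * (c i k (r - L i) * G i (r - L i) h) \<partial>lborel)"
        unfolding d_def by (rule integral_shift)
      also have "\<dots> = (\<integral>r. indicator {0<..} r * (V i (r - L i) * G i (r - L i) h * \<phi> k (h - r)) \<partial>lborel)"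
        by (rule Bochner_Integration.integral_cong) (auto simp: c_def indicator_def)
      finally show ?thesis .
    qed
    have di: "integrable lborel (\<lambda>r. indicator {0<..} r * (V i (r - L i) * G i (r - L i) h * \<phi> k (h - r)))"
      if i: "i \<in> {1..N}" and k: "k \<in> {1..N}" for i k
    proof -
      have "integrable lborel (\<lambda>r. V i (r - L i) * G i (r - L i) h * \<phi> k (h - r))"
      proof (rule integrable_compact_support[of _ "h - L k" h])
        have "continuous_on UNIV (\<lambda>r. V i (r - L i))" "continuous_on UNIV (\<lambda>r. G i (r - L i) h)"
          by (rule continuous_on_compose2[OF V_continuous[OF i]] continuous_on_compose2[OF G_continuous[OF i]];
              auto intro!: continuous_intros)+
        then show "continuous_on UNIV (\<lambda>r. V i (r - L i) * G i (r - L i) h * \<phi> k (h - r))"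
          by (intro continuous_intros \<phi>c k)
        show "V i (r - L i) * G i (r - L i) h * \<phi> k (h - r) = 0" if "r \<notin> {h - L k..h}" for r
          using z[OF k, of "h - r"] that by auto
      qed
      then show ?thesis by (rule ind) simp
    qed
    have "(\<Sum>i=1..N. \<Sum>k=1..N. m k i * d i k) = (\<Sum>k=1..N. \<Sum>i=1..N. m k i * d i k)" by (rule sum.swap)
    also have "\<dots> = (\<Sum>k=1..N. e k)"
    proof (rule sum.cong[OF refl])
      fix k assume k: "k \<in> {1..N}"
      have "(\<Sum>i=1..N. m k i * d i k) = (\<integral>r. (\<Sum>i=1..N. m k i * (indicator {0<..} r * (V i (r - L i) * G i (r - L i) h * \<phi> k (h - r)))) \<partial>lborel)"
        unfolding dshift using di k by (subst Bochner_Integration.integral_sum) auto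
      also have "\<dots> = e k"
        unfolding e_def
      proof (rule Bochner_Integration.integral_cong[OF refl])
        fix r
        show "(\<Sum>i=1..N. m k i * (indicator {0<..} r * (V i (r - L i) * G i (r - L i) h * \<phi> k (h - r)))) = indicator {0<..} r * ac k r"
        proof (cases "0 < r \<and> r < h")
          case True
          have "m k i * (V i (r - L i) * G i (r - L i) h) = m k i * (F i (L i - r) * G i (r - L i) \<delta>)" if i: "i \<in> {1..N}" for i
          proof -
            have "r - L i \<le> 0" using True hL[OF i] by simp
            moreover have "G i (r - L i) h = G i (r - L i) \<delta>"
              by (rule G_eq) (use True ab[OF i] h in auto)
            ultimately show ?thesis by (simp add: V_def)
          qed
          then have "(\<Sum>i=1..N. m k i * (V i (r - L i) * G i (r - L i) h)) = (\<Sum>i=1..N. m k i * (F i (L i - r) * G i (r - L i) \<delta>))"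
            by (rule sum.cong[OF refl])
          then have "(\<Sum>i=1..N. m k i * (V i (r - L i) * G i (r - L i) h)) = V k r"
            using True by (simp only: V_def) simp
          moreover have "(\<Sum>i=1..N. m k i * (indicator {0<..} r * (V i (r - L i) * G i (r - L i) h * \<phi> k (h - r))))
            = (\<Sum>i=1..N. m k i * (V i (r - L i) * G i (r - L i) h)) * \<phi> k (h - r)"
            unfolding sum_distrib_right using True by (intro sum.cong) (auto simp: mult_ac)
          ultimately show ?thesis using True by (simp add: ac_def)
        next
          case False
          then have "indicator {0<..} r * \<phi> k (h - r) = 0"
            using z[OF k, of "h - r"] by (auto simp: indicator_def)
          then show ?thesis by (auto simp: ac_def)
        qed
      qed
      finally show "(\<Sum>i=1..N. m k i * d i k) = e k" .
    qed
    finally show ?thesis .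
  qed
  have "((\<lambda>\<sigma>. \<Sum>i=1..N. A i \<sigma> * (\<integral>x. indicator {a i..b i} x * y \<sigma> i x * psi (h - \<sigma>) \<phi> i x \<partial>seg (L i)))
    has_integral (\<Sum>i=1..N. \<integral>s. V i s * psi h \<phi> i (- s) * (1 - G i s h) \<partial>lborel)) {0..h}"
    by (intro has_integral_sum duhamel_component[OF _ h(1) ts VPi]) auto
  moreover have "(\<Sum>i=1..N. \<integral>s. V i s * psi h \<phi> i (- s) * (1 - G i s h) \<partial>lborel) = pair F (psi h \<phi>) - pair (y h) \<phi>"
  proof -
    have "(\<Sum>i=1..N. \<integral>s. V i s * psi h \<phi> i (- s) * (1 - G i s h) \<partial>lborel)
      = (\<Sum>i=1..N. (\<integral>x. F i x * psi h \<phi> i x \<partial>seg (L i)) - (\<integral>x. y h i x * \<phi> i x \<partial>seg (L i)) + e i - (\<Sum>k=1..N. m k i * d i k))"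
      by (rule sum.cong[OF refl main])
    also have "\<dots> = pair F (psi h \<phi>) - pair (y h) \<phi> + (\<Sum>k=1..N. e k) - (\<Sum>i=1..N. \<Sum>k=1..N. m k i * d i k)"
      by (simp only: sum_subtractf sum.distrib pair_def)
    finally show ?thesis unfolding ed by simp
  qed
  ultimately show ?thesis by (simp only:)
qed

end

section \<open>Identification of the solution\<close>

context local_candidate
begin

lemma ff_pair:
  assumes \<tau>: "0 \<le> \<tau>" and b: "bmeas \<psi>"
  shows "pair (ff \<tau>) \<psi> = - (\<Sum>i=1..Nd. \<alpha> i \<tau> * (\<integral>x. indicator {a i..b i} x * z \<tau> i x * \<psi> i x \<partial>seg (L i)))"
proof -
  have Bp: "pair (opB a b i (z \<tau>)) \<psi> = - (\<integral>x. indicator {a i..b i} x * z \<tau> i x * \<psi> i x \<partial>seg (L i))" if i: "i \<in> {1..Nd}" for i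
  proof -
    have iN: "i \<in> {1..N}" using i Nd by auto
    have "pair (opB a b i (z \<tau>)) \<psi> = (\<Sum>k=1..N. if k = i then - (\<integral>x. indicator {a i..b i} x * z \<tau> i x * \<psi> i x \<partial>seg (L i)) else 0)"
      unfolding pair_def
    proof (rule sum.cong[OF refl])
      fix k
      show "(\<integral>x. opB a b i (z \<tau>) k x * \<psi> k x \<partial>seg (L k)) = (if k = i then - (\<integral>x. indicator {a i..b i} x * z \<tau> i x * \<psi> i x \<partial>seg (L i)) else 0)"
        by (simp add: opB_def)
    qed
    also have "\<dots> = - (\<integral>x. indicator {a i..b i} x * z \<tau> i x * \<psi> i x \<partial>seg (L i))" using iN by simp
    finally show ?thesis .
  qed
  have "pair (ff \<tau>) \<psi> = (\<Sum>i=1..Nd. pair (scale (\<alpha> i \<tau>) (opB a b i (z \<tau>))) \<psi>)"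
    unfolding ff_def using Nd \<tau> by (intro pair_sum_left[OF b] X_scale opB_X zX) auto
  also have "\<dots> = (\<Sum>i=1..Nd. - (\<alpha> i \<tau> * (\<integral>x. indicator {a i..b i} x * z \<tau> i x * \<psi> i x \<partial>seg (L i))))"
    by (rule sum.cong[OF refl]) (simp only: pair_scale_left Bp mult_minus_right)
  finally show ?thesis by (simp add: sum_negf)
qed

text \<open>The window of such an edge is the single point L i, which the open segment does not
  contain.\<close>

lemma uncontrolled_zero:
  assumes "i \<in> {Nd+1..N}"
  shows "(\<integral>x. indicator {a i..b i} x * g x * g' x \<partial>seg (L i)) = (0::real)"
proof -
  have "(\<integral>x. indicator {a i..b i} x * g x * g' x \<partial>seg (L i)) = (\<integral>x. 0 \<partial>seg (L i))"
    by (rule Bochner_Integration.integral_cong) (use uncontrolled[OF assms] in \<open>auto simp: indicator_def\<close>)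
  then show ?thesis by simp
qed

lemma A_eq_\<alpha>_AE: "AE \<sigma> in lborel. \<forall>i\<in>{1..N}. A i \<sigma> = \<alpha> i (t0 + \<sigma>)"
proof (rule AE_finite_allI)
  fix i assume i: "i \<in> {1..N}"
  note [measurable] = \<alpha>_meas[OF i]
  have "AE \<sigma> in lborel. 0 \<le> \<alpha> i (t0 + 1 * \<sigma>) \<and> \<alpha> i (t0 + 1 * \<sigma>) \<le> 1"
    by (rule AE_borel_affine[OF _ _ \<alpha>_bound[OF i]]) (simp, measurable)
  then show "AE \<sigma> in lborel. A i \<sigma> = \<alpha> i (t0 + \<sigma>)"
    by eventually_elim (auto simp: A_def)
qed simp

lemma L1n_diff_le:
  assumes "u \<in> X" "v \<in> X"
  shows "L1n (u - v) \<le> L1n u + L1n v"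
  unfolding L1n_def sum.distrib[symmetric]
proof (rule sum_mono)
  fix i assume i: "i \<in> {1..N}"
  note int = X_L1(1)[OF assms(1) i] X_L1(1)[OF assms(2) i]
  have "(\<integral>x. \<bar>(u - v) i x\<bar> \<partial>seg (L i)) \<le> (\<integral>x. \<bar>u i x\<bar> + \<bar>v i x\<bar> \<partial>seg (L i))"
    using int by (intro integral_mono) (auto simp: fun_diff_def)
  then show "(\<integral>x. \<bar>(u - v) i x\<bar> \<partial>seg (L i)) \<le> (\<integral>x. \<bar>u i x\<bar> \<partial>seg (L i)) + (\<integral>x. \<bar>v i x\<bar> \<partial>seg (L i))"
    using int by simp
qed

text \<open>The repeated halving in \<open>z_eq_y\<close> starts from this bound; any finite value
  serves.\<close>

lemma difference_bounded:
  obtains Q where "\<And>\<sigma>. 0 \<le> \<sigma> \<Longrightarrow> \<sigma> \<le> \<delta> \<Longrightarrow> L1n (z (t0 + \<sigma>) - y \<sigma>) \<le> Q"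
proof -
  obtain Q1 where Q1: "\<And>s. s \<in> {t0..t0 + \<delta>} \<Longrightarrow> 0 \<le> s \<Longrightarrow> NX (z s) \<le> Q1"
    using z_bounded by blast
  obtain Q2 where Q2: "\<And>i x h. i \<in> {1..N} \<Longrightarrow> x \<in> {0..L i} \<Longrightarrow> 0 \<le> h \<Longrightarrow> h \<le> \<delta> \<Longrightarrow> \<bar>y h i x\<bar> \<le> Q2"
    using y_bounded by blast
  have "L1n (z (t0 + \<sigma>) - y \<sigma>) \<le> Ctot * Q1 + (\<Sum>i=1..N. L i * Q2)" if \<sigma>: "0 \<le> \<sigma>" "\<sigma> \<le> \<delta>" for \<sigma>
  proof -
    have zX': "z (t0 + \<sigma>) \<in> X" using t0 \<sigma> by (intro zX) auto
    have "L1n (z (t0 + \<sigma>)) \<le> Ctot * NX (z (t0 + \<sigma>))" by (rule X_L1(2)[OF zX'])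
    also have "\<dots> \<le> Ctot * Q1" using t0 \<sigma> Ctot(3) by (intro mult_left_mono Q1) auto
    finally have 1: "L1n (z (t0 + \<sigma>)) \<le> Ctot * Q1" .
    have "L1n (y \<sigma>) \<le> (\<Sum>i=1..N. L i * Q2)"
      unfolding L1n_def
    proof (rule sum_mono)
      fix i assume i: "i \<in> {1..N}"
      have "(\<integral>x. \<bar>y \<sigma> i x\<bar> \<partial>seg (L i)) \<le> (\<integral>x. Q2 \<partial>seg (L i))"
        using X_L1(1)[OF y_X[OF \<sigma>] i] Q2[OF i _ \<sigma>] by (intro integral_mono) auto
      also have "\<dots> = L i * Q2" using L[OF i] by (simp add: measure_seg)
      finally show "(\<integral>x. \<bar>y \<sigma> i x\<bar> \<partial>seg (L i)) \<le> L i * Q2" .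
    qed
    with 1 L1n_diff_le[OF zX' y_X[OF \<sigma>]] show ?thesis by linarith
  qed
  then show ?thesis using that by blast
qed

text \<open>The difference of two solutions of the weak Duhamel formula halves in \<open>L\<^sup>1\<close> norm at each
  application of the formula on a short time interval, hence vanishes.\<close>

lemma z_eq_y:
  assumes dual: "\<And>t u \<phi> \<phi>'. 0 \<le> t \<Longrightarrow> t \<le> \<delta> \<Longrightarrow> u \<in> X \<Longrightarrow> tests \<phi> \<phi>' \<Longrightarrow> pair (T t u) \<phi> = pair u (psi t \<phi>)"
    and short: "\<delta> * (4 * Km) \<le> 1"
    and rep: "\<And>i. i \<in> {1..N} \<Longrightarrow> AE x in seg (L i). F i x = z t0 i x"
    and h: "0 \<le> h" "h \<le> \<delta>"
  shows "Xeq N L (z (t0 + h)) (y h)"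
proof -
  define dd where "dd \<sigma> = z (t0 + \<sigma>) - y \<sigma>" for \<sigma>
  have ddX: "dd \<sigma> \<in> X" if "0 \<le> \<sigma>" "\<sigma> \<le> \<delta>" for \<sigma>
    unfolding dd_def using t0 that by (intro X_diff zX y_X) auto
  have FX: "F \<in> X"
    unfolding Xp_def
  proof (safe)
    fix i assume i: "i \<in> {1..N}"
    have "F i \<in> borel_measurable (seg (L i))"
      using prim_continuous[OF F[OF i] p] by (intro measurable_seg_borel borel_measurable_continuous_onI)
    moreover have "AE x in seg (L i). z t0 i x = F i x" using rep[OF i] by eventually_elim simp
    ultimately show "F i \<in> Lp p (L i)" by (rule Lp_cong_AE[OF XD[OF zX[OF t0] i]])
  qed
  \<comment> \<open>One use of the formula. The difference of the two Duhamel integrands is at most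
    2 Km Q, with 2 from the test functions and Km from \<open>psi\<close>; over a time \<delta> with
    \<open>\<delta> * (4 * Km) \<le> 1\<close> this gives Q / 2.\<close>
  have halve: "L1n (dd h) \<le> Q / 2" if h: "0 \<le> h" "h \<le> \<delta>" and Q: "\<And>\<sigma>. 0 \<le> \<sigma> \<Longrightarrow> \<sigma> \<le> \<delta> \<Longrightarrow> L1n (dd \<sigma>) \<le> Q" for h Q
  proof (rule L1n_le)
    show "\<And>i. i \<in> {1..N} \<Longrightarrow> integrable (seg (L i)) (dd h i)" by (rule X_L1(1)[OF ddX[OF h]])
    fix \<phi> \<phi>' assume ts: "tests \<phi> \<phi>'" and \<phi>2: "\<And>i x. i \<in> {1..N} \<Longrightarrow> \<bar>\<phi> i x\<bar> \<le> 2"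
    have "0 \<le> L1n (dd 0)" by (simp add: L1n_def sum_nonneg)
    then have Q0: "0 \<le> Q" using Q[of 0] \<delta>(1) by simp
    define J where "J \<sigma> i = (\<integral>x. indicator {a i..b i} x * y \<sigma> i x * psi (h - \<sigma>) \<phi> i x \<partial>seg (L i))" for \<sigma> i
    define k where "k \<sigma> = pair (ff (t0 + \<sigma>)) (psi (h - \<sigma>) \<phi>) + (\<Sum>i=1..N. A i \<sigma> * J \<sigma> i)" for \<sigma>
    have "pair (z t0) (psi h \<phi>) = pair F (psi h \<phi>)"
    proof (rule pair_cong[OF bmeas_psi(1)[OF ts] zX[OF t0] FX])
      show "Xeq N L (z t0) F"
        unfolding Xeq_def
      proof
        fix i assume "i \<in> {1..N}"
        from rep[OF this] show "AE x in seg (L i). z t0 i x = F i x" by eventually_elim simp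
      qed
    qed
    then have hi: "(k has_integral pair (z (t0 + h)) \<phi> - pair (y h) \<phi>) {0..h}"
      using has_integral_add[OF weak_duhamel[OF dual t0 h ts] y_weak_duhamel[OF h ts]]
      unfolding k_def J_def by simp
    have dpair: "pair (dd h) \<phi> = pair (z (t0 + h)) \<phi> - pair (y h) \<phi>"
      unfolding dd_def using t0 h by (intro pair_diff_left[OF bmeas_tests(1)[OF ts]] zX y_X) auto
    \<comment> \<open>On this null set \<open>A\<close> and \<alpha> may differ and the bound
      \<open>kb\<close> may fail, since \<open>ff\<close> contains \<alpha> itself; the integrand is
      set to 0 there.\<close>
    define S where "S = {\<sigma>. \<not> (\<forall>i\<in>{1..N}. A i \<sigma> = \<alpha> i (t0 + \<sigma>))}"
    have S: "negligible S"
    proof -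
      obtain Z where Z: "Z \<in> null_sets lborel" "{\<sigma> \<in> space lborel. \<not> (\<forall>i\<in>{1..N}. A i \<sigma> = \<alpha> i (t0 + \<sigma>))} \<subseteq> Z"
        using A_eq_\<alpha>_AE unfolding eventually_ae_filter by blast
      have "negligible Z" using null_sets_completionI[OF Z(1)] by (simp add: negligible_iff_null_sets)
      then show ?thesis by (rule negligible_subset) (use Z(2) in \<open>auto simp: S_def\<close>)
    qed
    have kb: "\<bar>k \<sigma>\<bar> \<le> 2 * Km * Q" if \<sigma>: "\<sigma> \<in> {0..h}" "\<sigma> \<notin> S" for \<sigma>
    proof -
      have \<sigma>': "0 \<le> \<sigma>" "\<sigma> \<le> \<delta>" "0 \<le> t0 + \<sigma>" using \<sigma> h t0 by auto
      have A\<alpha>: "A i \<sigma> = \<alpha> i (t0 + \<sigma>)" if "i \<in> {1..N}" for i using \<sigma>(2) that by (simp add: S_def)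
      define \<psi> where "\<psi> = psi (h - \<sigma>) \<phi>"
      have b\<psi>: "bmeas \<psi>" unfolding \<psi>_def by (rule bmeas_psi(1)[OF ts])
      \<comment> \<open>The multiplier that turns the integrand \<open>k\<close> into a pairing with
        the difference \<open>dd\<close>; it is 0 on the uncontrolled edges because
        \<open>ff\<close> sums only up to \<open>Nd\<close>.\<close>
      define \<xi> where "\<xi> = (\<lambda>i x. - (if i \<le> Nd then A i \<sigma> * indicator {a i..b i} x * \<psi> i x else 0))"
      have "{1..N} = {1..Nd} \<union> {Nd+1..N}" using Nd by auto
      then have "(\<Sum>i=1..N. A i \<sigma> * J \<sigma> i) = (\<Sum>i=1..Nd. A i \<sigma> * J \<sigma> i) + (\<Sum>i=Nd+1..N. A i \<sigma> * J \<sigma> i)"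
        by (simp only:) (rule sum.union_disjoint; auto)
      also have "(\<Sum>i=Nd+1..N. A i \<sigma> * J \<sigma> i) = 0"
        by (rule sum.neutral) (simp add: J_def uncontrolled_zero)
      finally have JN: "(\<Sum>i=1..N. A i \<sigma> * J \<sigma> i) = (\<Sum>i=1..Nd. A i \<sigma> * J \<sigma> i)" by simp
      have "k \<sigma> = (\<Sum>i=1..Nd. A i \<sigma> * J \<sigma> i - A i \<sigma> * (\<integral>x. indicator {a i..b i} x * z (t0 + \<sigma>) i x * \<psi> i x \<partial>seg (L i)))"
        unfolding k_def JN ff_pair[OF \<sigma>'(3) bmeas_psi(1)[OF ts]] sum_subtractf \<psi>_def using A\<alpha> Nd by simp
      also have "\<dots> = (\<Sum>i=1..Nd. \<integral>x. dd \<sigma> i x * \<xi> i x \<partial>seg (L i))"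
      proof (rule sum.cong[OF refl])
        fix i assume i: "i \<in> {1..Nd}"
        then have iN: "i \<in> {1..N}" using Nd by auto
        have bi: "bmeas (\<lambda>i x. indicator {a i..b i} x * \<psi> i x)"
        proof -
          obtain B where B: "\<forall>i\<in>{1..N}. \<forall>x\<in>{0<..<L i}. \<bar>\<psi> i x\<bar> \<le> B" using b\<psi> unfolding bmeas_def by blast
          have "\<bar>indicator {a i..b i} x * \<psi> i x\<bar> \<le> \<bar>B\<bar>" if "i \<in> {1..N}" "x \<in> {0<..<L i}" for i x
          proof -
            have "\<bar>\<psi> i x\<bar> \<le> B" using B that by blast
            then show ?thesis by (auto simp: indicator_def)
          qed
          moreover have "(\<lambda>x. indicator {a i..b i} x * \<psi> i x) \<in> borel_measurable borel" if "i \<in> {1..N}" for i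
            using b\<psi> that by (intro borel_measurable_times) (auto simp: bmeas_def)
          ultimately show ?thesis unfolding bmeas_def by blast
        qed
        have iz: "integrable (seg (L i)) (\<lambda>x. z (t0 + \<sigma>) i x * (indicator {a i..b i} x * \<psi> i x))"
          by (rule bmeas_integrable[OF bi X_L1(1)[OF zX[OF \<sigma>'(3)]] iN])
        have iy: "integrable (seg (L i)) (\<lambda>x. y \<sigma> i x * (indicator {a i..b i} x * \<psi> i x))"
          by (rule bmeas_integrable[OF bi X_L1(1)[OF y_X[OF \<sigma>'(1,2)]] iN])
        have "(\<integral>x. dd \<sigma> i x * \<xi> i x \<partial>seg (L i)) = (\<integral>x. A i \<sigma> * (y \<sigma> i x * (indicator {a i..b i} x * \<psi> i x)) - A i \<sigma> * (z (t0 + \<sigma>) i x * (indicator {a i..b i} x * \<psi> i x)) \<partial>seg (L i))"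
          by (rule Bochner_Integration.integral_cong) (use i in \<open>auto simp: dd_def \<xi>_def fun_diff_def algebra_simps\<close>)
        also have "\<dots> = A i \<sigma> * J \<sigma> i - A i \<sigma> * (\<integral>x. indicator {a i..b i} x * z (t0 + \<sigma>) i x * \<psi> i x \<partial>seg (L i))"
          using iz iy by (simp add: J_def \<psi>_def mult_ac)
        finally show "A i \<sigma> * J \<sigma> i - A i \<sigma> * (\<integral>x. indicator {a i..b i} x * z (t0 + \<sigma>) i x * \<psi> i x \<partial>seg (L i)) = (\<integral>x. dd \<sigma> i x * \<xi> i x \<partial>seg (L i))" by simp
      qed
      also have "\<dots> = pair (dd \<sigma>) \<xi>"
        unfolding pair_def using Nd by (intro sum.mono_neutral_left) (auto simp: \<xi>_def)
      finally have keq: "k \<sigma> = pair (dd \<sigma>) \<xi>" .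
      have "\<bar>pair (dd \<sigma>) \<xi>\<bar> \<le> (Km * 2) * L1n (dd \<sigma>)"
      proof (rule pair_L1_bound[OF X_L1(1)[OF ddX[OF \<sigma>'(1,2)]]])
        fix i assume i: "i \<in> {1..N}"
        have [measurable]: "\<psi> i \<in> borel_measurable borel" using b\<psi> i by (simp add: bmeas_def)
        show "\<xi> i \<in> borel_measurable borel" unfolding \<xi>_def by measurable
        fix x
        have p1: "\<bar>\<psi> i x\<bar> \<le> Km * 2" unfolding \<psi>_def by (rule psi_bound[OF \<phi>2 i])
        have "A i \<sigma> * \<bar>\<psi> i x\<bar> \<le> 1 * (Km * 2)"
          using A_bounds[of i \<sigma>] p1 by (intro mult_mono) auto
        then show "\<bar>\<xi> i x\<bar> \<le> Km * 2"
          using A_bounds[of i \<sigma>] Km by (auto simp: \<xi>_def indicator_def abs_mult)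
      qed
      also have "\<dots> \<le> (Km * 2) * Q" using Q[OF \<sigma>'(1,2)] Km by (intro mult_left_mono) auto
      finally show ?thesis using keq by (simp add: mult_ac)
    qed
    have hi': "((\<lambda>\<sigma>. if \<sigma> \<in> S then 0 else k \<sigma>) has_integral pair (dd h) \<phi>) {0..h}"
      unfolding dpair by (rule has_integral_spike[OF S _ hi]) auto
    have "norm (pair (dd h) \<phi>) \<le> 2 * Km * Q * measure lborel {0..h}"
      by (rule has_integral_bound_real[OF _ finite.emptyI hi']) (use kb Km Q0 in auto)
    then have "pair (dd h) \<phi> \<le> 2 * Km * Q * h" using h by simp
    also have "\<dots> \<le> 2 * Km * Q * \<delta>" using h Km Q0 by (intro mult_left_mono) auto
    also have "\<dots> = (\<delta> * (4 * Km)) * (Q / 2)" by simp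
    also have "\<dots> \<le> 1 * (Q / 2)" using short Q0 by (intro mult_right_mono) auto
    finally show "pair (dd h) \<phi> \<le> Q / 2" by simp
  qed
  obtain Q where Q: "\<And>\<sigma>. 0 \<le> \<sigma> \<Longrightarrow> \<sigma> \<le> \<delta> \<Longrightarrow> L1n (dd \<sigma>) \<le> Q"
    using difference_bounded unfolding dd_def by blast
  have pow: "L1n (dd \<sigma>) \<le> Q / 2 ^ n" if "0 \<le> \<sigma>" "\<sigma> \<le> \<delta>" for n \<sigma>
    using that
  proof (induction n arbitrary: \<sigma>)
    case (Suc n)
    have "L1n (dd \<sigma>) \<le> (Q / 2 ^ n) / 2" by (rule halve[OF Suc.prems Suc.IH])
    then show ?case by simp
  qed (use Q in simp)
  have "(\<lambda>n. Q / 2 ^ n) \<longlonglongrightarrow> 0" by (rule LIMSEQ_divide_realpow_zero) simp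
  then have "L1n (dd h) \<le> 0" using pow[OF h] by (intro LIMSEQ_le_const) auto
  then have "Xeq N L (dd h) 0" by (intro Xeq_zero_if_L1n_zero X_L1(1)[OF ddX[OF h]])
  then show ?thesis unfolding dd_def by (subst Xeq_iff_diff)
qed

end

section \<open>Restarting: the solution stays in the domain\<close>

context controlled
begin

text \<open>One restart: the continuous representatives of \<open>z t0\<close> feed
  \<open>local_candidate\<close>, and \<open>z_eq_y\<close> hands domain membership and the
  transport formula from the candidate to z.\<close>

lemma D_step:
  assumes dual: "\<And>t u \<phi> \<phi>'. 0 \<le> t \<Longrightarrow> t \<le> \<delta> \<Longrightarrow> u \<in> X \<Longrightarrow> tests \<phi> \<phi>' \<Longrightarrow> pair (T t u) \<phi> = pair u (psi t \<phi>)"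
    and \<delta>: "0 < \<delta>" "\<delta> \<le> Lmin" "\<delta> * (4 * Km) \<le> 1"
    and t0: "0 \<le> t0" "z t0 \<in> D" and h: "0 \<le> h" "h \<le> \<delta>"
  shows "z (t0 + h) \<in> D"
    and "i \<in> {1..N} \<Longrightarrow> h \<le> x \<Longrightarrow> x \<le> L i \<Longrightarrow> crep (L i) (z (t0 + h) i) x =
      crep (L i) (z t0 i) (x - h) * exp (- (LINT s:{t0..t0 + h} \<inter> {t0 + h - x + a i..t0 + h - x + b i}|lborel. \<alpha> i s))"
proof -
  obtain F where F0: "\<forall>i\<in>{1..N}. prim p (F i) (\<lambda>x. indicator {0<..<L i} x * wderiv p (L i) (z t0 i) x) \<and>
    (AE x in seg (L i). F i x = z t0 i x) \<and> (\<forall>x\<in>{0..L i}. crep (L i) (z t0 i) x = F i x) \<and>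
    F i 0 = (\<Sum>j=1..N. m i j * F j (L j))"
    using D_representative[OF t0(2)] ..
  interpret lc: local_candidate p N L T m Nd a b \<alpha> z0 z t0 \<delta> F "\<lambda>i x. indicator {0<..<L i} x * wderiv p (L i) (z t0 i) x"
    using F0 t0 \<delta> by unfold_locales blast+
  have eq: "Xeq N L (z (t0 + h)) (lc.y h)"
    by (rule lc.z_eq_y[OF dual \<delta>(3) _ h]) (use F0 in blast)+
  have zX': "z (t0 + h) \<in> X" using t0(1) h(1) by (intro zX) auto
  show "z (t0 + h) \<in> D" by (rule lc.Xeq_y_D(1)[OF zX' eq h])
  show "crep (L i) (z (t0 + h) i) x =
      crep (L i) (z t0 i) (x - h) * exp (- (LINT s:{t0..t0 + h} \<inter> {t0 + h - x + a i..t0 + h - x + b i}|lborel. \<alpha> i s))"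
    if i: "i \<in> {1..N}" and x: "h \<le> x" "x \<le> L i"
  proof -
    have "crep (L i) (z (t0 + h) i) x = lc.y h i x" using x h(1) by (intro lc.Xeq_y_D(2)[OF zX' eq h i]) auto
    also have "\<dots> = F i (x - h) * lc.G i (h - x) h" by (rule lc.y_transport[OF x(1)])
    also have "F i (x - h) = crep (L i) (z t0 i) (x - h)" using F0 i x h(1) by simp
    also have "lc.G i (h - x) h = exp (- (LINT s:{t0..t0 + h} \<inter> {t0 + h - x + a i..t0 + h - x + b i}|lborel. \<alpha> i s))"
    proof -
      note [measurable] = lc.A_measurable[OF i] \<alpha>_meas[OF i]
      have "(LINT s:{t0..t0 + h} \<inter> {t0 + h - x + a i..t0 + h - x + b i}|lborel. \<alpha> i s)
        = (\<integral>r. indicator ({t0..t0 + h} \<inter> {t0 + h - x + a i..t0 + h - x + b i}) (r - (- t0)) * \<alpha> i (r - (- t0)) \<partial>lborel)"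
        unfolding set_lebesgue_integral_def real_scaleR_def by (rule integral_shift)
      also have "\<dots> = (\<integral>r. (if 0 \<le> r \<and> r \<le> h \<and> h - x + a i \<le> r \<and> r \<le> h - x + b i then lc.A i r else 0) \<partial>lborel)"
      proof (rule integral_cong_AE)
        show "AE r in lborel. indicator ({t0..t0 + h} \<inter> {t0 + h - x + a i..t0 + h - x + b i}) (r - (- t0)) * \<alpha> i (r - (- t0))
          = (if 0 \<le> r \<and> r \<le> h \<and> h - x + a i \<le> r \<and> r \<le> h - x + b i then lc.A i r else 0)"
          using lc.A_eq_\<alpha>_AE
        proof eventually_elim
          case (elim r)
          then have "lc.A i r = \<alpha> i (t0 + r)" using i by blast
          then show ?case by (auto simp: indicator_def add.commute)
        qed
      qed measurable
      finally show ?thesis unfolding lc.G_def by simp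
    qed
    finally show ?thesis .
  qed
qed

lemma step_length:
  obtains \<delta> where "0 < \<delta>" "\<delta> \<le> Lmin" "\<delta> * (4 * Km) \<le> 1"
    "\<And>t u \<phi> \<phi>'. 0 \<le> t \<Longrightarrow> t \<le> \<delta> \<Longrightarrow> u \<in> X \<Longrightarrow> tests \<phi> \<phi>' \<Longrightarrow> pair (T t u) \<phi> = pair u (psi t \<phi>)"
proof -
  obtain d where d: "0 < d" "d \<le> Lmin"
    "\<And>t u \<phi> \<phi>'. 0 \<le> t \<Longrightarrow> t \<le> d \<Longrightarrow> u \<in> X \<Longrightarrow> tests \<phi> \<phi>' \<Longrightarrow> pair (T t u) \<phi> = pair u (psi t \<phi>)"
    using T_duality_local by blast
  have K: "0 < 4 * Km" using Km by simp
  have "min d (1 / (4 * Km)) * (4 * Km) \<le> 1 / (4 * Km) * (4 * Km)"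
    using K by (intro mult_right_mono) auto
  then have "min d (1 / (4 * Km)) * (4 * Km) \<le> 1" using K by simp
  then show ?thesis
    using d K by (intro that[of "min d (1 / (4 * Km))"]) auto
qed

lemma z_initial_Xeq: "Xeq N L (z 0) z0"
proof -
  have X: "z 0 \<in> X" "z0 \<in> X" "z 0 - z0 \<in> X" using zX[of 0] DX[OF z0] by (auto intro: X_diff)
  have "L1n (z 0 - z0) \<le> 0"
  proof (rule L1n_le[OF X_L1(1)[OF X(3)]])
    fix \<phi> \<phi>' assume ts: "tests \<phi> \<phi>'"
    show "pair (z 0 - z0) \<phi> \<le> 0"
      using z_initial[OF bmeas_tests(1)[OF ts]] X by (simp add: pair_diff_left[OF bmeas_tests(1)[OF ts]])
  qed
  then have "Xeq N L (z 0 - z0) 0" by (intro Xeq_zero_if_L1n_zero X_L1(1)[OF X(3)])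
  then show ?thesis by (subst Xeq_iff_diff)
qed

text \<open>Domain membership and traces depend on the class of a state alone. This serves at time
  0, where \<open>z 0\<close> is determined by \<open>z0\<close> only up to null sets.\<close>

lemma D_cong:
  assumes v: "v \<in> D" and w: "w \<in> X" "Xeq N L w v"
  shows "w \<in> D" "\<And>i x. i \<in> {1..N} \<Longrightarrow> x \<in> {0..L i} \<Longrightarrow> crep (L i) (w i) x = crep (L i) (v i) x"
proof -
  obtain F where F: "\<forall>i\<in>{1..N}. prim p (F i) (\<lambda>x. indicator {0<..<L i} x * wderiv p (L i) (v i) x) \<and>
    (AE x in seg (L i). F i x = v i x) \<and> (\<forall>x\<in>{0..L i}. crep (L i) (v i) x = F i x) \<and>
    F i 0 = (\<Sum>j=1..N. m i j * F j (L j))"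
    using D_representative[OF v] ..
  have W: "w i \<in> W1p p (L i) \<and> (\<forall>x\<in>{0..L i}. crep (L i) (w i) x = F i x)" if i: "i \<in> {1..N}" for i
  proof -
    have P: "prim p (F i) (\<lambda>x. indicator {0<..<L i} x * wderiv p (L i) (v i) x)" using F i by blast
    have "AE x in seg (L i). F i x = v i x" using F i by blast
    with XeqD[OF w(2) i] have "AE x in seg (L i). F i x = w i x" by eventually_elim simp
    from W1p_if_prim[OF p L[OF i] P LpD(1)[OF XD[OF w(1) i]] this] show ?thesis by blast
  qed
  then show cr: "\<And>i x. i \<in> {1..N} \<Longrightarrow> x \<in> {0..L i} \<Longrightarrow> crep (L i) (w i) x = crep (L i) (v i) x"
    using F by simp
  have "crep (L i) (w i) 0 = (\<Sum>j=1..N. m i j * crep (L j) (w j) (L j))" if i: "i \<in> {1..N}" for i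
  proof -
    have "crep (L i) (w i) 0 = crep (L i) (v i) 0" using L[OF i] by (intro cr i) auto
    also have "\<dots> = (\<Sum>j=1..N. m i j * crep (L j) (v j) (L j))" using v i by (simp add: domA_def)
    also have "\<dots> = (\<Sum>j=1..N. m i j * crep (L j) (w j) (L j))"
      using L by (intro sum.cong refl arg_cong2[where f = "(*)"] cr[symmetric]) (auto simp: less_imp_le)
    finally show ?thesis .
  qed
  then show "w \<in> D" using W by (simp add: domA_def)
qed

lemmas z_0_D = D_cong(1)[OF z0 zX[OF order_refl] z_initial_Xeq]
  and z_initial_crep = D_cong(2)[OF z0 zX[OF order_refl] z_initial_Xeq]

lemma z_D:
  assumes "0 \<le> t"
  shows "z t \<in> D"
proof -
  obtain \<delta> where \<delta>: "0 < \<delta>" "\<delta> \<le> Lmin" "\<delta> * (4 * Km) \<le> 1"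
    "\<And>t u \<phi> \<phi>'. 0 \<le> t \<Longrightarrow> t \<le> \<delta> \<Longrightarrow> u \<in> X \<Longrightarrow> tests \<phi> \<phi>' \<Longrightarrow> pair (T t u) \<phi> = pair u (psi t \<phi>)"
    using step_length by blast
  \<comment> \<open>\<delta> does not depend on the starting time, so finitely many steps reach
    every t.\<close>
  have "\<forall>t. 0 \<le> t \<longrightarrow> t \<le> real n * \<delta> \<longrightarrow> z t \<in> D" for n
  proof (induction n)
    case 0
    then show ?case using z_0_D by (auto simp: order.antisym)
  next
    case (Suc n)
    show ?case
    proof (intro allI impI)
      fix t assume t: "0 \<le> t" "t \<le> real (Suc n) * \<delta>"
      show "z t \<in> D"
      proof (cases "t \<le> real n * \<delta>")
        case False
        define s where "s = real n * \<delta>"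
        have s: "0 \<le> s" "z s \<in> D" using Suc \<delta>(1) by (auto simp: s_def)
        have h: "0 \<le> t - s" "t - s \<le> \<delta>" using t False by (auto simp: s_def distrib_right)
        have "z (s + (t - s)) \<in> D" by (rule D_step(1)[OF \<delta>(4,1,2,3) s h])
        then show ?thesis by simp
      qed (use Suc t in blast)
    qed
  qed
  moreover obtain n where "t / \<delta> < real n" using reals_Archimedean2 by blast
  then have "t \<le> real n * \<delta>" using \<delta>(1) by (simp add: divide_less_eq)
  ultimately show ?thesis using assms by blast
qed

end

section \<open>Expansion over paths\<close>

text \<open>A multi-index counts how often a path uses each edge; the sum of its entries is the
  number of edges on the path.\<close>

definition level :: "nat \<Rightarrow> nat \<Rightarrow> (nat \<Rightarrow> nat) set" where
  "level N K = {n \<in> multi_idx N. (\<Sum>i=1..N. n i) = K}"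

lemma finite_level: "finite (level N K)"
proof (rule finite_subset)
  show "level N K \<subseteq> {n. \<forall>i. (i \<in> {1..N} \<longrightarrow> n i \<in> {..K}) \<and> (i \<notin> {1..N} \<longrightarrow> n i = 0)}"
  proof
    fix n assume n: "n \<in> level N K"
    have "n i \<le> K" if "i \<in> {1..N}" for i
      using n that member_le_sum[of i "{1..N}" n] by (auto simp: level_def)
    then show "n \<in> {n. \<forall>i. (i \<in> {1..N} \<longrightarrow> n i \<in> {..K}) \<and> (i \<notin> {1..N} \<longrightarrow> n i = 0)}"
      using n by (auto simp: level_def multi_idx_def)
  qed
  show "finite {n. \<forall>i. (i \<in> {1..N} \<longrightarrow> n i \<in> {..K}) \<and> (i \<notin> {1..N} \<longrightarrow> n i = 0)}"
    by (rule finite_set_of_finite_funs) auto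
qed

text \<open>Written with \<open>n j\<close> added on the left because subtraction on natural numbers
  truncates.\<close>

lemma sum_upd:
  fixes n :: "nat \<Rightarrow> nat"
  assumes "j \<in> {1..N}"
  shows "(\<Sum>i=1..N. (n(j := c)) i) + n j = (\<Sum>i=1..N. n i) + c"
proof -
  have "(\<Sum>i=1..N. (n(j := c)) i) = c + (\<Sum>i\<in>{1..N} - {j}. (n(j := c)) i)"
    using assms by (subst sum.remove[of _ j]) auto
  also have "(\<Sum>i\<in>{1..N} - {j}. (n(j := c)) i) = (\<Sum>i\<in>{1..N} - {j}. n i)"
    by (rule sum.cong) auto
  finally show ?thesis
    using assms by (subst sum.remove[of "{1..N}" j n]) auto
qed

lemma len_upd:
  assumes "j \<in> {1..N}"
  shows "len N L (n(j := c)) = len N L n + (real c - real (n j)) * L j"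
proof -
  have "len N L (n(j := c)) = real c * L j + (\<Sum>i\<in>{1..N} - {j}. real ((n(j := c)) i) * L i)"
    unfolding len_def using assms by (subst sum.remove[of _ j]) auto
  also have "(\<Sum>i\<in>{1..N} - {j}. real ((n(j := c)) i) * L i) = (\<Sum>i\<in>{1..N} - {j}. real (n i) * L i)"
    by (rule sum.cong) auto
  also have "\<dots> = len N L n - real (n j) * L j"
    unfolding len_def using assms by (subst sum.remove[of "{1..N}" j]) auto
  finally show ?thesis unfolding left_diff_distrib by linarith
qed

lemma multi_idx_upd: "n \<in> multi_idx N \<Longrightarrow> j \<in> {1..N} \<Longrightarrow> n(j := c) \<in> multi_idx N"
  by (auto simp: multi_idx_def)

text \<open>A path of K edges takes at least time K l, which bounds the number of levels that
  contribute up to a given time.\<close>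

lemma level_len:
  assumes "n \<in> level N K" "\<And>i. i \<in> {1..N} \<Longrightarrow> l \<le> L i"
  shows "real K * l \<le> len N L n"
proof -
  have "real K * l = (\<Sum>i=1..N. real (n i) * l)"
    using assms(1) by (auto simp: level_def sum_distrib_right of_nat_sum)
  also have "\<dots> \<le> len N L n"
    unfolding len_def using assms(2) by (intro sum_mono mult_left_mono) auto
  finally show ?thesis .
qed

text \<open>The values \<open>W j s\<close> at the end of edge \<open>j\<close> satisfy a delay equation; unrolling it expresses the
  value at the start of an edge as a sum over all paths, indexed by the number of times each edge is used.\<close>

locale delay_network =
  fixes N :: nat and L a b :: "nat \<Rightarrow> real" and m :: "nat \<Rightarrow> nat \<Rightarrow> real" and \<alpha> :: "nat \<Rightarrow> real \<Rightarrow> real"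
    and W u0 :: "nat \<Rightarrow> real \<Rightarrow> real"
  assumes N: "1 \<le> N" and L: "\<And>i. i \<in> {1..N} \<Longrightarrow> 0 < L i"
    and ab: "\<And>i. i \<in> {1..N} \<Longrightarrow> 0 \<le> a i \<and> a i \<le> b i \<and> b i \<le> L i"
    and W_neg: "\<And>j s. s < 0 \<Longrightarrow> W j s = 0"
    and W_short: "\<And>j s. j \<in> {1..N} \<Longrightarrow> 0 \<le> s \<Longrightarrow> s < L j \<Longrightarrow>
      W j s = u0 j (L j - s) * exp (- (LINT r:{0..s} \<inter> {s - L j + a j..s - L j + b j}|lborel. \<alpha> j r))"
    and W_long: "\<And>j s. j \<in> {1..N} \<Longrightarrow> L j \<le> s \<Longrightarrow>
      W j s = (\<Sum>k=1..N. m j k * W k (s - L j)) * exp (- (LINT r:{0..s} \<inter> {s - L j + a j..s - L j + b j}|lborel. \<alpha> j r))"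
begin

abbreviation "th \<equiv> theta_end N L m a b \<alpha>"
abbreviation "ep \<equiv> eps N L a b \<alpha>"

text \<open>The part of the end value that comes directly from the initial state, before anything
  that entered the edge after time 0 reaches its end.\<close>

definition W0 :: "nat \<Rightarrow> real \<Rightarrow> real" where "W0 j s = (if 0 \<le> s \<and> s < L j then W j s else 0)"

text \<open>All ranges of s = t - len n fit one formula because W vanishes at negative times. For s
  >= L j the interval of \<open>eps\<close> at x = 0 is that of \<open>W_long\<close>: it lies in
  [0, s] since s - L j >= 0 and b j <= L j.\<close>

lemma W_split:
  assumes j: "j \<in> {1..N}"
  shows "W j (t - len N L n) = W0 j (t - len N L n) + ep j n 0 t * (\<Sum>k=1..N. m j k * W k (t - len N L n - L j))"
proof -
  define s where "s = t - len N L n"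
  consider "s < 0" | "0 \<le> s" "s < L j" | "L j \<le> s" by linarith
  then have "W j s = W0 j s + ep j n 0 t * (\<Sum>k=1..N. m j k * W k (s - L j))"
  proof cases
    case 1
    then show ?thesis using L[OF j] by (simp add: W0_def W_neg)
  next
    case 2
    then show ?thesis by (simp add: W0_def W_neg)
  next
    case 3
    have set: "{t - len N L n - L j + max 0 (a j)..t - len N L n - L j + b j} = {0..s} \<inter> {s - L j + a j..s - L j + b j}"
      using 3 ab[OF j] by (auto simp: s_def)
    have "W0 j s = 0" using 3 by (simp add: W0_def)
    then show ?thesis
      unfolding W_long[OF j 3] eps_def set by (simp only: add_0 mult.commute)
  qed
  then show ?thesis by (simp add: s_def)
qed

text \<open>Adding one passage through edge j maps the pairs (n, j) with n in level K bijectively to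
  those with n in level K + 1 and n j >= 1, and these are the terms of the recursion of
  \<open>theta_end\<close>. The delay L j is absorbed into \<open>len\<close>.\<close>

lemma level_Suc_reindex:
  "(\<Sum>n\<in>level N K. \<Sum>j=1..N. th i j n t * (ep j n 0 t * (\<Sum>k=1..N. m j k * W k (t - len N L n - L j))))
    = (\<Sum>n\<in>level N (Suc K). \<Sum>k=1..N. th i k n t * W k (t - len N L n))"
proof -
  have "(\<Sum>n\<in>level N K. \<Sum>j=1..N. th i j n t * (ep j n 0 t * (\<Sum>k=1..N. m j k * W k (t - len N L n - L j))))
    = (\<Sum>(n, j)\<in>level N K \<times> {1..N}. th i j n t * (ep j n 0 t * (\<Sum>k=1..N. m j k * W k (t - len N L n - L j))))"
    by (rule sum.cartesian_product)
  also have "\<dots> = (\<Sum>(n, j)\<in>(SIGMA n:level N (Suc K). {j \<in> {1..N}. 1 \<le> n j}).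
      th i j (n(j := n j - 1)) t * (ep j (n(j := n j - 1)) 0 t * (\<Sum>k=1..N. m j k * W k (t - len N L n))))"
  proof (rule sum.reindex_bij_witness[where i = "\<lambda>(n, j). (n(j := n j - 1), j)" and j = "\<lambda>(n, j). (n(j := n j + 1), j)"])
    fix x assume "x \<in> level N K \<times> {1..N}"
    then obtain n j where x: "x = (n, j)" "n \<in> level N K" "j \<in> {1..N}" by auto
    show "(case (case x of (n, j) \<Rightarrow> (n(j := n j + 1), j)) of (n, j) \<Rightarrow> (n(j := n j - 1), j)) = x"
      by (simp add: x(1))
    show "(case x of (n, j) \<Rightarrow> (n(j := n j + 1), j)) \<in> (SIGMA n:level N (Suc K). {j \<in> {1..N}. 1 \<le> n j})"
      using x(2,3) sum_upd[OF x(3), of n "n j + 1"] by (simp add: x(1) level_def multi_idx_upd)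
    have shift: "t - len N L (n(j := Suc (n j))) = t - len N L n - L j"
      by (simp add: len_upd[OF x(3)] algebra_simps)
    show "(case case x of (n, j) \<Rightarrow> (n(j := n j + 1), j) of (n, j) \<Rightarrow>
        th i j (n(j := n j - 1)) t * (ep j (n(j := n j - 1)) 0 t * (\<Sum>k=1..N. m j k * W k (t - len N L n))))
      = (case x of (n, j) \<Rightarrow> th i j n t * (ep j n 0 t * (\<Sum>k=1..N. m j k * W k (t - len N L n - L j))))"
      by (simp add: x(1) shift)
  next
    fix x assume "x \<in> (SIGMA n:level N (Suc K). {j \<in> {1..N}. 1 \<le> n j})"
    then obtain n j where x: "x = (n, j)" "n \<in> level N (Suc K)" "j \<in> {1..N}" "1 \<le> n j" by auto
    show "(case (case x of (n, j) \<Rightarrow> (n(j := n j - 1), j)) of (n, j) \<Rightarrow> (n(j := n j + 1), j)) = x"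
      using x(4) by (simp add: x(1))
    show "(case x of (n, j) \<Rightarrow> (n(j := n j - 1), j)) \<in> level N K \<times> {1..N}"
      using x(2-4) sum_upd[OF x(3), of n "n j - 1"] by (simp add: x(1) level_def multi_idx_upd)
  qed
  also have "\<dots> = (\<Sum>n\<in>level N (Suc K). \<Sum>j\<in>{j \<in> {1..N}. 1 \<le> n j}.
      th i j (n(j := n j - 1)) t * (ep j (n(j := n j - 1)) 0 t * (\<Sum>k=1..N. m j k * W k (t - len N L n))))"
    by (rule sum.Sigma[symmetric]) (auto simp: finite_level)
  also have "\<dots> = (\<Sum>n\<in>level N (Suc K). \<Sum>k=1..N. th i k n t * W k (t - len N L n))"
  proof (rule sum.cong[OF refl])
    fix n assume n: "n \<in> level N (Suc K)"
    have ne: "\<not> (\<forall>k\<in>{1..N}. n k = 0)"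
    proof
      assume "\<forall>k\<in>{1..N}. n k = 0"
      then have "(\<Sum>i=1..N. n i) = 0" by simp
      then show False using n by (simp add: level_def)
    qed
    have rec: "th i k n t = (\<Sum>j\<in>{j \<in> {1..N}. 1 \<le> n j}. m j k * (ep j (n(j := n j - 1)) 0 t * th i j (n(j := n j - 1)) t))" for k
      by (subst theta_end.simps) (rule if_not_P[OF ne])
    have "(\<Sum>k=1..N. th i k n t * W k (t - len N L n))
      = (\<Sum>k=1..N. \<Sum>j\<in>{j \<in> {1..N}. 1 \<le> n j}. m j k * (ep j (n(j := n j - 1)) 0 t * th i j (n(j := n j - 1)) t) * W k (t - len N L n))"
      by (intro sum.cong refl) (simp only: rec sum_distrib_right)
    also have "\<dots> = (\<Sum>j\<in>{j \<in> {1..N}. 1 \<le> n j}. \<Sum>k=1..N. m j k * (ep j (n(j := n j - 1)) 0 t * th i j (n(j := n j - 1)) t) * W k (t - len N L n))"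
      by (rule sum.swap)
    also have "\<dots> = (\<Sum>j\<in>{j \<in> {1..N}. 1 \<le> n j}.
      th i j (n(j := n j - 1)) t * (ep j (n(j := n j - 1)) 0 t * (\<Sum>k=1..N. m j k * W k (t - len N L n))))"
      by (intro sum.cong refl) (simp add: sum_distrib_left mult_ac)
    finally show "(\<Sum>j\<in>{j \<in> {1..N}. 1 \<le> n j}.
      th i j (n(j := n j - 1)) t * (ep j (n(j := n j - 1)) 0 t * (\<Sum>k=1..N. m j k * W k (t - len N L n))))
      = (\<Sum>k=1..N. th i k n t * W k (t - len N L n))" by simp
  qed
  finally show ?thesis .
qed

text \<open>The outcome of K uses of \<open>W_split\<close>: the first sum belongs to paths traced
  back to the initial state, the second to those still open after K edges.\<close>

lemma unrolled:
  "(\<Sum>j=1..N. m i j * W j t) = (\<Sum>k<K. \<Sum>n\<in>level N k. \<Sum>j=1..N. th i j n t * W0 j (t - len N L n))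
    + (\<Sum>n\<in>level N K. \<Sum>j=1..N. th i j n t * W j (t - len N L n))"
proof (induction K)
  case 0
  have "n = (\<lambda>_. 0)" if "n \<in> level N 0" for n
  proof
    fix x
    show "n x = 0" using that by (cases "x \<in> {1..N}") (auto simp: level_def multi_idx_def)
  qed
  then have "level N 0 = {\<lambda>_. 0}"
    by (auto simp: level_def multi_idx_def)
  moreover have "th i j (\<lambda>_. 0) t = m i j" for j by (subst theta_end.simps) simp
  moreover have "len N L (\<lambda>_. 0) = 0" by (simp add: len_def)
  ultimately show ?case by simp
next
  case (Suc K)
  have "(\<Sum>n\<in>level N K. \<Sum>j=1..N. th i j n t * W j (t - len N L n))
    = (\<Sum>n\<in>level N K. \<Sum>j=1..N. th i j n t * W0 j (t - len N L n)
      + th i j n t * (ep j n 0 t * (\<Sum>k=1..N. m j k * W k (t - len N L n - L j))))"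
    by (intro sum.cong refl) (subst W_split, simp_all add: distrib_left)
  also have "\<dots> = (\<Sum>n\<in>level N K. \<Sum>j=1..N. th i j n t * W0 j (t - len N L n))
      + (\<Sum>n\<in>level N (Suc K). \<Sum>k=1..N. th i k n t * W k (t - len N L n))"
    unfolding sum.distrib level_Suc_reindex ..
  finally show ?case using Suc by simp
qed

lemma path_expansion:
  assumes t: "0 \<le> t"
  shows "(\<Sum>j=1..N. m i j * W j t) =
    (\<Sum>j=1..N. \<Sum>n | n \<in> multi_idx0 N j \<and> len N L n \<le> t.
       theta N L m a b \<alpha> i j
         (n(j := n j + nat \<lfloor>(t - len N L n) / L j\<rfloor>))
         (L j - (t - len N L n) rmod L j) t *
       u0 j (L j - (t - len N L n) rmod L j))"
proof -
  define l where "l = Min (L ` {1..N})"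
  have ne: "L ` {1..N} \<noteq> {}" using N by auto
  have l: "0 < l" unfolding l_def using ne L by (subst Min_gr_iff) auto
  have lL: "\<And>i. i \<in> {1..N} \<Longrightarrow> l \<le> L i" unfolding l_def by (intro Min_le) auto
  \<comment> \<open>More than t / l edges take longer than t, so every open path of level K sits at
    a negative time, where W is 0.\<close>
  obtain K where "t / l < real K" using reals_Archimedean2 by blast
  then have K: "t < real K * l" using l by (simp add: pos_divide_less_eq)
  have "(\<Sum>n\<in>level N K. \<Sum>j=1..N. th i j n t * W j (t - len N L n)) = 0"
  proof (intro sum.neutral ballI)
    fix n j assume "n \<in> level N K"
    then have "t - len N L n < 0" using level_len[of n N K l L] lL K by simp
    then show "th i j n t * W j (t - len N L n) = 0" by (simp add: W_neg)
  qed
  then have "(\<Sum>j=1..N. m i j * W j t) = (\<Sum>k<K. \<Sum>n\<in>level N k. \<Sum>j=1..N. th i j n t * W0 j (t - len N L n))"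
    using unrolled[of i t K] by simp
  also have "\<dots> = (\<Sum>n\<in>(\<Union>k<K. level N k). \<Sum>j=1..N. th i j n t * W0 j (t - len N L n))"
    by (rule sum.UNION_disjoint[symmetric]) (auto simp: finite_level, auto simp: level_def)
  also have "\<dots> = (\<Sum>j=1..N. \<Sum>n\<in>(\<Union>k<K. level N k). th i j n t * W0 j (t - len N L n))"
    by (rule sum.swap)
  also have "\<dots> = (\<Sum>j=1..N. \<Sum>n | n \<in> multi_idx0 N j \<and> len N L n \<le> t.
       theta N L m a b \<alpha> i j (n(j := n j + nat \<lfloor>(t - len N L n) / L j\<rfloor>)) (L j - (t - len N L n) rmod L j) t *
       u0 j (L j - (t - len N L n) rmod L j))"
  proof (rule sum.cong[OF refl])
    fix j assume j: "j \<in> {1..N}"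
    \<comment> \<open>The indices that can give a nonzero term for edge j: after all passages
      counted by n the remaining time lies in [0, L j[.\<close>
    define B where "B = {n \<in> multi_idx N. len N L n \<le> t \<and> t < len N L n + L j}"
    have "(\<Sum>n\<in>(\<Union>k<K. level N k). th i j n t * W0 j (t - len N L n)) = (\<Sum>n\<in>B. th i j n t * W j (t - len N L n))"
    proof (rule sum.mono_neutral_cong_right)
      show "finite (\<Union>k<K. level N k)" by (auto simp: finite_level)
      show "B \<subseteq> (\<Union>k<K. level N k)"
      proof
        fix n assume n: "n \<in> B"
        then have lev: "n \<in> level N (\<Sum>i=1..N. n i)" by (simp add: B_def level_def)
        have "real (\<Sum>i=1..N. n i) * l \<le> len N L n" by (rule level_len[OF lev lL])
        also have "\<dots> \<le> t" using n by (simp add: B_def)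
        also have "t < real K * l" by (rule K)
        finally have "(\<Sum>i=1..N. n i) < K" using l by (simp add: mult_less_cancel_right_pos del: of_nat_sum)
        with lev show "n \<in> (\<Union>k<K. level N k)" by blast
      qed
      show "\<forall>n\<in>(\<Union>k<K. level N k) - B. th i j n t * W0 j (t - len N L n) = 0"
        by (auto simp: B_def W0_def level_def)
      show "\<And>n. n \<in> B \<Longrightarrow> th i j n t * W0 j (t - len N L n) = th i j n t * W j (t - len N L n)"
        by (auto simp: B_def W0_def)
    qed
    also have "\<dots> = (\<Sum>n | n \<in> multi_idx0 N j \<and> len N L n \<le> t.
       theta N L m a b \<alpha> i j (n(j := n j + nat \<lfloor>(t - len N L n) / L j\<rfloor>)) (L j - (t - len N L n) rmod L j) t *
       u0 j (L j - (t - len N L n) rmod L j))"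
    \<comment> \<open>For n in B the entry at j is determined by the others: dividing the time they
      leave by L j gives it as the quotient, and the rest of the division is the remaining time.
      Hence the indices with entry 0 at j.\<close>
    proof (rule sum.reindex_bij_witness[where i = "\<lambda>n. n(j := n j + nat \<lfloor>(t - len N L n) / L j\<rfloor>)" and j = "\<lambda>n. n(j := 0)"])
      fix n assume n: "n \<in> B"
      have l0: "len N L (n(j := 0)) = len N L n - real (n j) * L j"
        by (simp add: len_upd[OF j])
      have "(t - len N L (n(j := 0))) / L j = real (n j) + (t - len N L n) / L j"
        using L[OF j] by (simp add: l0 field_simps)
      moreover have "0 \<le> (t - len N L n) / L j" "(t - len N L n) / L j < 1"
        using n L[OF j] by (auto simp: B_def)
      ultimately have fl: "\<lfloor>(t - len N L (n(j := 0))) / L j\<rfloor> = int (n j)"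
        by (simp add: floor_unique)
      show inverse: "(n(j := 0))(j := (n(j := 0)) j + nat \<lfloor>(t - len N L (n(j := 0))) / L j\<rfloor>) = n"
        by (simp add: fl)
      have "0 \<le> real (n j) * L j" "len N L n \<le> t" using L[OF j] n by (simp_all add: B_def)
      then have "len N L n - real (n j) * L j \<le> t"
        by linarith
      then show "n(j := 0) \<in> {n. n \<in> multi_idx0 N j \<and> len N L n \<le> t}"
        using n j by (simp add: multi_idx0_def B_def l0 multi_idx_upd)
      define s where "s = t - len N L n"
      have s: "0 \<le> s" "s < L j" using n by (auto simp: B_def s_def)
      have rm: "(t - len N L (n(j := 0))) rmod L j = s"
        unfolding rmod_def using L[OF j] fl by (simp add: l0 s_def)
      \<comment> \<open>At x = L j - s the lower end is the maximum of 0 and s - L j + a j, and the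
        upper end is at most s because b j <= L j.\<close>
      have set: "{s - L j + max (L j - s) (a j)..s - L j + b j} = {0..s} \<inter> {s - L j + a j..s - L j + b j}"
        using ab[OF j] by auto
      show "theta N L m a b \<alpha> i j ((n(j := 0))(j := (n(j := 0)) j + nat \<lfloor>(t - len N L (n(j := 0))) / L j\<rfloor>))
          (L j - (t - len N L (n(j := 0))) rmod L j) t * u0 j (L j - (t - len N L (n(j := 0))) rmod L j)
        = th i j n t * W j (t - len N L n)"
        unfolding inverse rm theta_def eps_def s_def[symmetric] set W_short[OF j s] by (simp only: mult_ac)
    next
      fix n assume n: "n \<in> {n. n \<in> multi_idx0 N j \<and> len N L n \<le> t}"
      then have nj: "n j = 0" "n \<in> multi_idx N" "len N L n \<le> t" by (auto simp: multi_idx0_def)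
      then show "(n(j := n j + nat \<lfloor>(t - len N L n) / L j\<rfloor>))(j := 0) = n" by (simp add: fun_eq_iff)
      define q where "q = nat \<lfloor>(t - len N L n) / L j\<rfloor>"
      have "0 \<le> (t - len N L n) / L j" using nj(3) L[OF j] by simp
      then have "real q \<le> (t - len N L n) / L j" "(t - len N L n) / L j < real q + 1"
        unfolding q_def by linarith+
      then have "real q * L j \<le> t - len N L n" "t - len N L n < (real q + 1) * L j"
        using L[OF j] by (simp_all add: pos_le_divide_eq pos_divide_less_eq)
      then show "n(j := n j + nat \<lfloor>(t - len N L n) / L j\<rfloor>) \<in> B"
        using nj j by (simp add: B_def q_def[symmetric] multi_idx_upd len_upd[OF j] algebra_simps)
    qed
    finally show "(\<Sum>n\<in>(\<Union>k<K. level N k). th i j n t * W0 j (t - len N L n)) = (\<Sum>n | n \<in> multi_idx0 N j \<and> len N L n \<le> t.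
       theta N L m a b \<alpha> i j (n(j := n j + nat \<lfloor>(t - len N L n) / L j\<rfloor>)) (L j - (t - len N L n) rmod L j) t *
       u0 j (L j - (t - len N L n) rmod L j))" .
  qed
  finally show ?thesis .
qed

end

section \<open>Transport along characteristics\<close>

context controlled
begin

lemma \<alpha>_integrable:
  assumes i: "i \<in> {1..N}"
  shows "set_integrable lborel {c..d} (\<alpha> i)"
  unfolding set_integrable_def
proof (rule Bochner_Integration.integrable_bound[OF set_integrable_const_real[of c d 1, unfolded set_integrable_def]])
  note [measurable] = \<alpha>_meas[OF i]
  show "(\<lambda>x. indicator {c..d} x *\<^sub>R \<alpha> i x) \<in> borel_measurable lborel" by measurable
  show "AE x in lborel. norm (indicator {c..d} x *\<^sub>R \<alpha> i x) \<le> norm (indicator {c..d} x *\<^sub>R (1::real))"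
    using \<alpha>_bound[OF i] by eventually_elim (auto simp: indicator_def)
qed

lemma \<alpha>_integral_split:
  assumes i: "i \<in> {1..N}" and r: "r1 \<le> r2" "r2 \<le> r3"
  shows "(LINT s:{r1..r3} \<inter> {c..d}|lborel. \<alpha> i s)
    = (LINT s:{r1..r2} \<inter> {c..d}|lborel. \<alpha> i s) + (LINT s:{r2..r3} \<inter> {c..d}|lborel. \<alpha> i s)"
proof -
  note [measurable] = \<alpha>_meas[OF i]
  have int: "integrable lborel (\<lambda>s. indicator ({e..e'} \<inter> {c..d}) s *\<^sub>R \<alpha> i s)" for e e'
    using \<alpha>_integrable[OF i, of "max e c" "min e' d"] by (simp add: set_integrable_def)
  have "(LINT s:{r1..r3} \<inter> {c..d}|lborel. \<alpha> i s)
    = (\<integral>s. indicator ({r1..r2} \<inter> {c..d}) s *\<^sub>R \<alpha> i s + indicator ({r2..r3} \<inter> {c..d}) s *\<^sub>R \<alpha> i s \<partial>lborel)"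
    unfolding set_lebesgue_integral_def
  proof (rule integral_cong_AE)
    show "AE s in lborel. indicator ({r1..r3} \<inter> {c..d}) s *\<^sub>R \<alpha> i s
      = indicator ({r1..r2} \<inter> {c..d}) s *\<^sub>R \<alpha> i s + indicator ({r2..r3} \<inter> {c..d}) s *\<^sub>R \<alpha> i s"
      using AE_lborel_singleton[of r2] by eventually_elim (use r in \<open>auto simp: indicator_def\<close>)
  qed measurable
  then show ?thesis
    unfolding set_lebesgue_integral_def using int by (simp only: Bochner_Integration.integral_add)
qed

text \<open>\<open>D_step\<close> gives this up to the step length, and longer stretches are cut
  into steps. All pieces lie on one characteristic, with constant t - x, so they share the control
  window and their exponents add up.\<close>

lemma transport:
  assumes i: "i \<in> {1..N}" and t0: "0 \<le> t0" and h: "0 \<le> h" "h \<le> x" and x: "x \<le> L i"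
  shows "crep (L i) (z (t0 + h) i) x =
    crep (L i) (z t0 i) (x - h) * exp (- (LINT s:{t0..t0 + h} \<inter> {t0 + h - x + a i..t0 + h - x + b i}|lborel. \<alpha> i s))"
proof -
  obtain \<delta> where \<delta>: "0 < \<delta>" "\<delta> \<le> Lmin" "\<delta> * (4 * Km) \<le> 1"
    "\<And>t u \<phi> \<phi>'. 0 \<le> t \<Longrightarrow> t \<le> \<delta> \<Longrightarrow> u \<in> X \<Longrightarrow> tests \<phi> \<phi>' \<Longrightarrow> pair (T t u) \<phi> = pair u (psi t \<phi>)"
    using step_length by blast
  have "\<forall>h x. 0 \<le> h \<longrightarrow> h \<le> real n * \<delta> \<longrightarrow> h \<le> x \<longrightarrow> x \<le> L i \<longrightarrow> crep (L i) (z (t0 + h) i) x =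
    crep (L i) (z t0 i) (x - h) * exp (- (LINT s:{t0..t0 + h} \<inter> {t0 + h - x + a i..t0 + h - x + b i}|lborel. \<alpha> i s))" for n
  proof (induction n)
    case 0
    show ?case
    proof (intro allI impI)
      fix h x assume "0 \<le> h" "h \<le> real 0 * \<delta>" "h \<le> x" "x \<le> L i"
      then show "crep (L i) (z (t0 + h) i) x =
        crep (L i) (z t0 i) (x - h) * exp (- (LINT s:{t0..t0 + h} \<inter> {t0 + h - x + a i..t0 + h - x + b i}|lborel. \<alpha> i s))"
        using \<delta>(1) by (intro D_step(2)[OF \<delta>(4,1,2,3) t0 z_D[OF t0] _ _ i]) auto
    qed
  next
    case (Suc n)
    show ?case
    proof (intro allI impI)
      fix h x assume h: "0 \<le> h" "h \<le> real (Suc n) * \<delta>" "h \<le> x" "x \<le> L i"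
      \<comment> \<open>The induction hypothesis covers h1 and one more step the remaining h - h1;
        the minimum includes the case of an h that is already short enough.\<close>
      define h1 where "h1 = min h (real n * \<delta>)"
      have h1: "0 \<le> h1" "h1 \<le> real n * \<delta>" "h1 \<le> h" "h - h1 \<le> \<delta>"
        using h \<delta>(1) by (auto simp: h1_def min_def distrib_right)
      let ?E = "\<lambda>r r'. exp (- (LINT s:{r..r'} \<inter> {t0 + h - x + a i..t0 + h - x + b i}|lborel. \<alpha> i s))"
      have eq: "t0 + h1 + (h - h1) = t0 + h" "t0 + h1 - (x - (h - h1)) = t0 + h - x" "x - (h - h1) - h1 = x - h" by auto
      have t1: "0 \<le> t0 + h1" using t0 h1 by simp
      have "crep (L i) (z (t0 + h1 + (h - h1)) i) x = crep (L i) (z (t0 + h1) i) (x - (h - h1)) *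
          exp (- (LINT s:{t0 + h1..t0 + h1 + (h - h1)} \<inter> {t0 + h1 + (h - h1) - x + a i..t0 + h1 + (h - h1) - x + b i}|lborel. \<alpha> i s))"
        using h h1 by (intro D_step(2)[OF \<delta>(4,1,2,3) t1 z_D[OF t1] _ _ i]) auto
      then have 1: "crep (L i) (z (t0 + h) i) x = crep (L i) (z (t0 + h1) i) (x - (h - h1)) * ?E (t0 + h1) (t0 + h)"
        by (simp only: eq)
      have "h1 \<le> x - (h - h1)" "x - (h - h1) \<le> L i" using h h1 by auto
      with Suc h1(1,2) have "crep (L i) (z (t0 + h1) i) (x - (h - h1)) = crep (L i) (z t0 i) (x - (h - h1) - h1) *
          exp (- (LINT s:{t0..t0 + h1} \<inter> {t0 + h1 - (x - (h - h1)) + a i..t0 + h1 - (x - (h - h1)) + b i}|lborel. \<alpha> i s))"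
        by blast
      then have 2: "crep (L i) (z (t0 + h1) i) (x - (h - h1)) = crep (L i) (z t0 i) (x - h) * ?E t0 (t0 + h1)"
        by (simp only: eq)
      have "?E t0 (t0 + h) = ?E t0 (t0 + h1) * ?E (t0 + h1) (t0 + h)"
        using \<alpha>_integral_split[OF i, of t0 "t0 + h1" "t0 + h"] h1 by (simp add: exp_add[symmetric])
      then show "crep (L i) (z (t0 + h) i) x = crep (L i) (z t0 i) (x - h) * ?E t0 (t0 + h)"
        using 1 2 by (simp only: mult.assoc)
    qed
  qed
  moreover obtain n where "h / \<delta> < real n" using reals_Archimedean2 by blast
  then have "h \<le> real n * \<delta>" using \<delta>(1) by (simp add: divide_less_eq)
  ultimately show ?thesis using h x by blast
qed

lemma z_boundary:
  assumes "0 \<le> t" "i \<in> {1..N}"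
  shows "crep (L i) (z t i) 0 = (\<Sum>j=1..N. m i j * crep (L j) (z t j) (L j))"
  using z_D[OF assms(1)] assms(2) by (simp add: domA_def)

lemma solution_early:
  assumes i: "i \<in> {1..N}" and t: "0 \<le> t" "t \<le> x" and x: "x \<le> L i"
  shows "crep (L i) (z t i) x = crep (L i) (z0 i) (x - t) *
    exp (- (LINT s:{0..t} \<inter> {t - x + a i..t - x + b i}|lborel. \<alpha> i s))"
proof -
  have "crep (L i) (z 0 i) (x - t) = crep (L i) (z0 i) (x - t)"
    using t x by (intro z_initial_crep i) auto
  then show ?thesis using transport[OF i order_refl t x] by simp
qed

text \<open>Follow the characteristic back to the vertex, which it left at time t - x. The damping
  integral over [t - x, t] may be extended to [0, t] because the window starts at t - x + a i >= t -
  x.\<close>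

lemma solution_late:
  assumes i: "i \<in> {1..N}" and x: "0 \<le> x" "x \<le> t" "x \<le> L i"
  shows "crep (L i) (z t i) x = crep (L i) (z (t - x) i) 0 *
    exp (- (LINT s:{0..t} \<inter> {t - x + a i..t - x + b i}|lborel. \<alpha> i s))"
proof -
  have eq: "{t - x..t - x + x} \<inter> {t - x + x - x + a i..t - x + x - x + b i} = {0..t} \<inter> {t - x + a i..t - x + b i}"
    using ab[OF i] x by auto
  show ?thesis
    using transport[OF i _ x(1) order_refl x(3), of "t - x"] x(2) unfolding eq
    by (simp del: Int_atLeastAtMost)
qed

end

theorem theorem3p6:
  fixes N Nd :: nat
    and L a b :: "nat \<Rightarrow> real"
    and m :: "nat \<Rightarrow> nat \<Rightarrow> real"
    and \<alpha> :: "nat \<Rightarrow> real \<Rightarrow> real"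
    and p :: real
    and T :: "real \<Rightarrow> state \<Rightarrow> state"
    and z0 :: state
    and z :: "real \<Rightarrow> state"
    and u0 :: state
    and u :: "nat \<Rightarrow> real \<Rightarrow> real \<Rightarrow> real"
  assumes "2 \<le> N" and "Nd \<le> N" and "1 \<le> p"
    and "\<And>i. i \<in> {1..N} \<Longrightarrow> 0 < L i"
    and "\<And>i. i \<in> {1..Nd} \<Longrightarrow> 0 \<le> a i \<and> a i < b i \<and> b i \<le> L i"
    and "\<And>i. i \<in> {1..Nd} \<Longrightarrow> \<alpha> i \<in> borel_measurable borel"
    and "\<And>i. i \<in> {1..Nd} \<Longrightarrow> AE s in lborel. 0 \<le> \<alpha> i s \<and> \<alpha> i s \<le> 1"
    and "\<And>i. i \<in> {Nd+1..N} \<Longrightarrow> \<alpha> i = (\<lambda>_. 1) \<and> a i = L i \<and> b i = L i"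
    and "semigroup_of_A p N L m T"
    and "z0 \<in> domA p N L m"
    and "mild_solution p N Nd L a b \<alpha> T z0 z"
    and "u0 = (\<lambda>i. crep (L i) (z0 i))"
    and "u = (\<lambda>i t. crep (L i) (z t i))"
  shows "\<forall>t\<ge>0. z t \<in> domA p N L m \<and>
    (\<forall>i\<in>{1..N}.
      (\<forall>x\<in>{0..L i}.
        (t \<le> x \<longrightarrow> u i t x =
           u0 i (x - t) * exp (- (LINT s:{0..t} \<inter> {t - x + a i..t - x + b i}|lborel. \<alpha> i s))) \<and>
        (x \<le> t \<longrightarrow> u i t x =
           u i (t - x) 0 * exp (- (LINT s:{0..t} \<inter> {t - x + a i..t - x + b i}|lborel. \<alpha> i s)))) \<and>
      u i t 0 =
        (\<Sum>j=1..N. \<Sum>n | n \<in> multi_idx0 N j \<and> len N L n \<le> t.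
           theta N L m a b \<alpha> i j
             (n(j := n j + nat \<lfloor>(t - len N L n) / L j\<rfloor>))
             (L j - (t - len N L n) rmod L j) t *
           u0 j (L j - (t - len N L n) rmod L j)))"
proof -
  have ab: "0 \<le> a i \<and> a i \<le> b i \<and> b i \<le> L i" if "i \<in> {1..N}" for i
    using assms(4,5,8)[of i] that by (cases "i \<le> Nd") auto
  have \<alpha>: "\<alpha> i \<in> borel_measurable borel \<and> (AE s in lborel. 0 \<le> \<alpha> i s \<and> \<alpha> i s \<le> 1)" if "i \<in> {1..N}" for i
    using assms(6,7,8)[of i] that by (cases "i \<le> Nd") auto
  interpret controlled p N L T m Nd a b \<alpha> z0 z
  proof
    show "c0_semigroup p N L T" using assms(9) by (simp only: semigroup_of_A_def)
  qed (use assms ab \<alpha> in auto)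
  \<comment> \<open>The value 0 at negative times lets the delay equation be unrolled past the
    initial time, where paths end.\<close>
  define W where "W j s = (if s < 0 then 0 else crep (L j) (z s j) (L j))" for j s
  interpret delay_network N L a b m \<alpha> W u0
  proof
    fix j s assume j: "j \<in> {1..N}"
    show "W j s = u0 j (L j - s) * exp (- (LINT r:{0..s} \<inter> {s - L j + a j..s - L j + b j}|lborel. \<alpha> j r))"
      if "0 \<le> s" "s < L j"
      using solution_early[OF j that(1) less_imp_le[OF that(2)] order_refl] that by (simp only: W_def assms(12)) simp
    show "W j s = (\<Sum>k=1..N. m j k * W k (s - L j)) * exp (- (LINT r:{0..s} \<inter> {s - L j + a j..s - L j + b j}|lborel. \<alpha> j r))"
      if "L j \<le> s"
    proof -
      have "crep (L j) (z (s - L j) j) 0 = (\<Sum>k=1..N. m j k * W k (s - L j))"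
        using z_boundary[of "s - L j" j] j that by (simp add: W_def)
      then show ?thesis
        using solution_late[OF j less_imp_le[OF L[OF j]] that order_refl] L[OF j] that by (simp only: W_def) simp
    qed
  qed (use assms(1) L ab in \<open>auto simp: W_def\<close>)
  show ?thesis
  proof (intro allI impI conjI ballI)
    fix t :: real assume t: "0 \<le> t"
    show "z t \<in> domA p N L m" by (rule z_D[OF t])
    fix i assume i: "i \<in> {1..N}"
    \<comment> \<open>The boundary condition at time t passes from the start of edge i to the ends
      of all edges, whose values obey the delay equation.\<close>
    have "u i t 0 = (\<Sum>j=1..N. m i j * W j t)"
      using z_boundary[OF t i] t by (simp add: assms(13) W_def)
    then show "u i t 0 = (\<Sum>j=1..N. \<Sum>n | n \<in> multi_idx0 N j \<and> len N L n \<le> t.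
           theta N L m a b \<alpha> i j
             (n(j := n j + nat \<lfloor>(t - len N L n) / L j\<rfloor>))
             (L j - (t - len N L n) rmod L j) t *
           u0 j (L j - (t - len N L n) rmod L j))"
      unfolding path_expansion[OF t] .
    fix x assume x: "x \<in> {0..L i}"
    show "u i t x = u0 i (x - t) * exp (- (LINT s:{0..t} \<inter> {t - x + a i..t - x + b i}|lborel. \<alpha> i s))" if "t \<le> x"
      using solution_early[OF i t that] x by (simp only: assms(12,13)) simp
    show "u i t x = u i (t - x) 0 * exp (- (LINT s:{0..t} \<inter> {t - x + a i..t - x + b i}|lborel. \<alpha> i s))" if "x \<le> t"
      using solution_late[OF i _ that] x by (simp only: assms(12,13)) simp
  qed
qed

end
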